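(* Let $m\in C^2([0,1])$ and $c\in C([0,1])$, where $m$ is not constant and $m'$ changes sign at most finitely many times on $[0,1]$. For $s>0$ let $\lambda_1^{\mathcal N}(s)$ be the principal eigenvalue of the Neumann problem $$-\varphi''-2s\,m'\varphi'+c\varphi=\lambda\varphi \ \text{ in }(0,1),\qquad \varphi'(0)=\varphi'(1)=0,$$ and let $w(s,\cdot)=e^{sm}\varphi$, where $\varphi>0$ is a corresponding principal eigenfunction, normalized so that $\int_0^1w^2(s,x)\,dx=1$ for each $s>0$. Let $\{s_j\}$ with $s_j\to\infty$ be a sequence and $\mu$ a probability measure on $[0,1]$ such that $$\lim_{j\to\infty}\int_0^1w^2(s_j,x)\zeta(x)\,dx=\int_{[0,1]}\zeta(x)\,\mu(dx)\qquad\text{for all }\zeta\in C([0,1]).$$ With $\mathcal{M}_1,\dots,\mathcal{M}_9$ as defined in the context, the following assertions hold. (1) Assume that $x_0\in\mathcal{M}_1$ satisfies $m^{(k)}(x_0)=0$ for all $1\le k\le k^*-1$ and $m^{(k^* )}(x_0)\ne0$ for some integer $k^*\ge2$, and that $\mu(\{x_0\})>0$. Then $\lim_{s\to\infty}\lambda_1^{\mathcal N}(s)=c(x_0)$. Moreover, up to a subsequence of $\{s_j\}$: (1-i) If $x_0\in(0,1)$, then $\mu(\{x_0\})^{-\frac12}s^{-\frac{1}{2k^*}}\,w(s,x_0+s^{-\frac1{k^*}}y)\to W^*$ locally uniformly in $\mathbb{R}$, where $W^*$ with $\int_{-\infty}^\infty (W^* )^2(y)\,dy=1$ is a positive solution of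 the linear ODE $$(W^* )''(y)=\big((m^{(k^* )}(x_0))^2y^{2(k^*-1)}+m^{(k^* )}(x_0)\,y^{k^*-2}\big)W^*(y),\quad y\in\mathbb{R}.$$ (1-ii) If $x_0=0$ or $x_0=1$, then $\mu(\{x_0\})^{-\frac12}s^{-\frac{1}{2k^*}}\,w(s,x_0+s^{-\frac1{k^*}}y)\to W_*$ locally uniformly in $\mathbb{R}_*$, where $\mathbb{R}_*=(0,\infty)$ if $x_0=0$ and $\mathbb{R}_*=(-\infty,0)$ if $x_0=1$, and $W_*$ with $\int_{\mathbb{R}_*}(W_* )^2(y)\,dy=1$ is a positive solution of the linear ODE $$(W_* )''(y)=\big((m^{(k^* )}(x_0))^2y^{2(k^*-1)}+m^{(k^* )}(x_0)\,y^{k^*-2}\big)W_*(y),\quad y\in\mathbb{R}_*.$$ (2) Assume that $[a,b]\in\mathcal{M}_2$ and $\mu((a,b))>0$. Then $\lim_{s\to\infty}\lambda_1^{\mathcal N}(s)=\lambda_1^{\mathcal{ND}}(a,b)$, and $w(s,\cdot)\to\varphi_1$ in $C^1([a,b])$, where $\varphi_1$ is an eigenfunction corresponding to $\lambda_1^{\mathcal{ND}}(a,b)$. (3) Assume that $[a,b]\in\mathcal{M}_3$ and $\mu((a,b))>0$. Then $\lim_{s\to\infty}\lambda_1^{\mathcal N}(s)=\lambda_1^{\mathcal{NN}}(a,b)$, and $w(s,\cdot)\to\varphi_1$ in $C^1([a,b])$, where $\varphi_1$ is an eigenfunction corresponding to $\lambda_1^{\mathcal{NN}}(a,b)$. (4)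 Assume that $[a,b]\in\mathcal{M}_4$ and $\mu((a,b))>0$. Then $\lim_{s\to\infty}\lambda_1^{\mathcal N}(s)=\lambda_1^{\mathcal{DD}}(a,b)$, and $w(s,\cdot)\to\varphi_1$ in $C^1([a,b])$, where $\varphi_1$ is an eigenfunction corresponding to $\lambda_1^{\mathcal{DD}}(a,b)$. (5) Assume that $[a,b]\in\mathcal{M}_5$ and $\mu((a,b))>0$. Then $\lim_{s\to\infty}\lambda_1^{\mathcal N}(s)=\lambda_1^{\mathcal{DN}}(a,b)$, and $w(s,\cdot)\to\varphi_1$ in $C^1([a,b])$, where $\varphi_1$ is an eigenfunction corresponding to $\lambda_1^{\mathcal{DN}}(a,b)$. (6) Assume that $[0,a^I]\in\mathcal{M}_6$ and $\mu([0,a^I))>0$. Then $\lim_{s\to\infty}\lambda_1^{\mathcal N}(s)=\lambda_1^{\mathcal{ND}}(0,a^I)$, and $w(s,\cdot)\to\varphi_1$ in $C^1([0,a^I])$, where $\varphi_1$ is an eigenfunction corresponding to $\lambda_1^{\mathcal{ND}}(0,a^I)$. (7) Assume that $[0,a^D]\in\mathcal{M}_7$ and $\mu([0,a^D))>0$. Then $\lim_{s\to\infty}\lambda_1^{\mathcal N}(s)=\lambda_1^{\mathcal{NN}}(0,a^D)$, and $w(s,\cdot)\to\varphi_1$ in $C^1([0,a^D])$, where $\varphi_1$ is an eigenfunction corresponding to $\lambda_1^{\mathcal{NN}}(0,a^D)$. (8) Assume that $[a^I,1]\in\mathcal{M}_8$ and $\mu((a^I,1])>0$. Then $\lim_{s\to\infty}\lambda_1^{\mathcal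 N}(s)=\lambda_1^{\mathcal{NN}}(a^I,1)$, and $w(s,\cdot)\to\varphi_1$ in $C^1([a^I,1])$, where $\varphi_1$ is an eigenfunction corresponding to $\lambda_1^{\mathcal{NN}}(a^I,1)$. (9) Assume that $[a^D,1]\in\mathcal{M}_9$ and $\mu((a^D,1])>0$. Then $\lim_{s\to\infty}\lambda_1^{\mathcal N}(s)=\lambda_1^{\mathcal{DN}}(a^D,1)$, and $w(s,\cdot)\to\varphi_1$ in $C^1([a^D,1])$, where $\varphi_1$ is an eigenfunction corresponding to $\lambda_1^{\mathcal{DN}}(a^D,1)$.
   Context: Principal eigenvalue: the unique real eigenvalue admitting a positive eigenfunction (a principal eigenfunction), unique up to scaling. "$m'$ changes sign at most finitely many times on $[0,1]$" means that $[0,1]$ is a finite union of closed intervals on each of which $m'\ge0$ or $m'\le 0$. Isolated point of local maximum of $m$: a point $x_0\in[0,1]$ such that for some $\epsilon_0>0$, $m(x_0)>m(x)$ for all $x\in\big((x_0-\epsilon_0,x_0+\epsilon_0)\cap[0,1]\big)\setminus\{x_0\}$. $\mathcal{M}_1$ is the set of all isolated points of local maximum. Segment of local maximum of $m$ (it need not be a set of genuine local maxima): a closed interval $[a,b]\subset[0,1]$, $a<b$, such that $m$ is constant on $[a,b]$, for some $\epsilon_0>0$ $m$ is monotone (in the weak sense) on $[a-\epsilon_0,a]\cap[0,1]$ and on $[b,b+\epsilon_0]\cap[0,1]$, and for every small $\epsilon>0$, $m'$ is not identically zero on $(a-\epsilon,a)$ if $a>0$, and $m'$ is not identically zero on $(b,b+\epsilon)$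 if $b<1$. If $a>0$, the left endpoint is of type $I$ if $m$ is non-decreasing on $[a-\epsilon_0,a]$ for some small $\epsilon_0>0$ and of type $D$ if $m$ is non-increasing there. If $b<1$, the right endpoint is of type $I$ if $m$ is non-decreasing on $[b,b+\epsilon_0]$ for some small $\epsilon_0>0$ and of type $D$ if $m$ is non-increasing there. For $0<a<b<1$: $\mathcal{M}_2$ = segments with (left type, right type) $=(I,I)$; $\mathcal{M}_3$: $(I,D)$; $\mathcal{M}_4$: $(D,I)$; $\mathcal{M}_5$: $(D,D)$. Segments $[0,b]$ with $0<b<1$: $\mathcal{M}_6$ if $b$ is of type $I$ (written $[0,a^I]$), $\mathcal{M}_7$ if of type $D$ (written $[0,a^D]$). Segments $[a,1]$ with $0<a<1$: $\mathcal{M}_8$ if $a$ is of type $I$ (written $[a^I,1]$), $\mathcal{M}_9$ if of type $D$ (written $[a^D,1]$). For $0\le a<b\le1$ and $i,j\in\{\mathcal{N},\mathcal{D}\}$, $\lambda_1^{ij}(a,b)$ is the principal eigenvalue of $-\varphi''+c\varphi=\lambda\varphi$ on $(a,b)$ with Neumann ($\mathcal N$) or Dirichlet ($\mathcal D$) condition at $a$ according to $i$ and at $b$ according to $j$.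
   Formalization: In (1-i) and (1-ii) the ODE is corrected to W''=((m^(k* )(x0)/(k*-1)!)^2 y^(2(k*-1)) + (m^(k* )(x0)/(k*-2)!) y^(k*-2))W; as printed, without factorials, it is false for k*≥3 (e.g. m=-(x-1/2)^4, c=0) and it agrees for k*=2. *)

theory Defs
  imports "HOL-Analysis.Analysis" "HOL-Probability.Probability_Measure"
begin

section \<open>Derivatives relative to a set\<close>

text \<open>
  Functions on \<open>[a,b]\<close> are total functions of type \<open>real \<Rightarrow> real\<close> whose values outside \<open>[a,b]\<close>
  are irrelevant.  All derivatives are therefore taken within \<open>[a,b]\<close>, so they are one-sided
  at the endpoints.
\<close>

primrec nderiv :: "real set \<Rightarrow> nat \<Rightarrow> (real \<Rightarrow> real) \<Rightarrow> real \<Rightarrow> real" where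
  "nderiv S 0 f = f"
| "nderiv S (Suc k) f = (\<lambda>x. vector_derivative (nderiv S k f) (at x within S))"

definition Ck_on :: "nat \<Rightarrow> real set \<Rightarrow> (real \<Rightarrow> real) \<Rightarrow> bool" where
  "Ck_on k S f \<longleftrightarrow>
     (\<forall>i<k. \<forall>x\<in>S. nderiv S i f differentiable (at x within S)) \<and>
     (\<forall>i\<le>k. continuous_on S (nderiv S i f))"

text \<open>
  The derivatives of order at most \<open>k\<close> exist at \<open>x\<close>; as usual this needs those of order less
  than \<open>k\<close> in a neighbourhood of \<open>x\<close> in \<open>S\<close>, but no continuity of the last one.
\<close>

definition differentiable_times_at :: "nat \<Rightarrow> real set \<Rightarrow> (real \<Rightarrow> real) \<Rightarrow> real \<Rightarrow> bool" where
  "differentiable_times_at k S f x \<longleftrightarrow>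
     (\<forall>i. Suc i < k \<longrightarrow>
        (\<forall>\<^sub>F y in at x within S. nderiv S i f differentiable (at y within S))) \<and>
     (\<forall>i<k. nderiv S i f differentiable (at x within S))"

definition C1_tendsto :: "(nat \<Rightarrow> real \<Rightarrow> real) \<Rightarrow> (real \<Rightarrow> real) \<Rightarrow> real \<Rightarrow> real \<Rightarrow> bool" where
  "C1_tendsto f g a b \<longleftrightarrow>
     uniform_limit {a..b} f g sequentially \<and>
     uniform_limit {a..b} (\<lambda>j. nderiv {a..b} 1 (f j)) (nderiv {a..b} 1 g) sequentially"


section \<open>Eigenvalue problems\<close>

datatype bdry = Neumann | Dirichlet

fun bdry_cond :: "bdry \<Rightarrow> real set \<Rightarrow> (real \<Rightarrow> real) \<Rightarrow> real \<Rightarrow> bool" where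
  "bdry_cond Neumann S \<phi> x \<longleftrightarrow> nderiv S 1 \<phi> x = 0"
| "bdry_cond Dirichlet S \<phi> x \<longleftrightarrow> \<phi> x = 0"

text \<open>
  Classical eigenfunctions of \<open>- \<phi>'' - p \<phi>' + c \<phi> = \<lambda> \<phi>\<close> on \<open>(a,b)\<close>, with condition \<open>i\<close> at \<open>a\<close>
  and condition \<open>j\<close> at \<open>b\<close>.
\<close>

definition eigenfunction ::
  "bdry \<Rightarrow> bdry \<Rightarrow> real \<Rightarrow> real \<Rightarrow> (real \<Rightarrow> real) \<Rightarrow> (real \<Rightarrow> real) \<Rightarrow> real \<Rightarrow> (real \<Rightarrow> real) \<Rightarrow> bool"
where
  "eigenfunction i j a b p c lam \<phi> \<longleftrightarrow>
     Ck_on 2 {a..b} \<phi> \<and>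
     (\<forall>x\<in>{a<..<b}. - nderiv {a..b} 2 \<phi> x - p x * nderiv {a..b} 1 \<phi> x + c x * \<phi> x = lam * \<phi> x) \<and>
     bdry_cond i {a..b} \<phi> a \<and> bdry_cond j {a..b} \<phi> b \<and>
     (\<exists>x\<in>{a..b}. \<phi> x \<noteq> 0)"

text \<open>
  Positivity is required in the open interval only, since Dirichlet eigenfunctions vanish at the
  boundary.  Under Neumann conditions it extends to the closed interval.
\<close>

definition principal_eigenvalue ::
  "bdry \<Rightarrow> bdry \<Rightarrow> real \<Rightarrow> real \<Rightarrow> (real \<Rightarrow> real) \<Rightarrow> (real \<Rightarrow> real) \<Rightarrow> real"
where
  "principal_eigenvalue i j a b p c =
     (THE lam. \<exists>\<phi>. eigenfunction i j a b p c lam \<phi> \<and> (\<forall>x\<in>{a<..<b}. \<phi> x > 0))"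

definition drift :: "(real \<Rightarrow> real) \<Rightarrow> real \<Rightarrow> real \<Rightarrow> real" where
  "drift m s x = 2 * s * nderiv {0..1} 1 m x"

definition lambdaN :: "(real \<Rightarrow> real) \<Rightarrow> (real \<Rightarrow> real) \<Rightarrow> real \<Rightarrow> real" where
  "lambdaN m c s = principal_eigenvalue Neumann Neumann 0 1 (drift m s) c"

definition lambda1 :: "bdry \<Rightarrow> bdry \<Rightarrow> (real \<Rightarrow> real) \<Rightarrow> real \<Rightarrow> real \<Rightarrow> real" where
  "lambda1 i j c a b = principal_eigenvalue i j a b (\<lambda>_. 0) c"


section \<open>The shape of the potential\<close>

definition finitely_many_sign_changes :: "(real \<Rightarrow> real) \<Rightarrow> bool" where
  "finitely_many_sign_changes f \<longleftrightarrow>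
     (\<exists>P :: (real \<times> real) set. finite P \<and> (\<Union>(a, b)\<in>P. {a..b}) = {0..1} \<and>
        (\<forall>(a, b)\<in>P. (\<forall>x\<in>{a..b}. f x \<ge> 0) \<or> (\<forall>x\<in>{a..b}. f x \<le> 0)))"

definition M1 :: "(real \<Rightarrow> real) \<Rightarrow> real set" where
  "M1 m = {x0 \<in> {0..1}. \<exists>e>0. \<forall>x \<in> ({x0 - e<..<x0 + e} \<inter> {0..1}) - {x0}. m x0 > m x}"

definition segment_of_local_max :: "(real \<Rightarrow> real) \<Rightarrow> real \<Rightarrow> real \<Rightarrow> bool" where
  "segment_of_local_max m a b \<longleftrightarrow>
     0 \<le> a \<and> a < b \<and> b \<le> 1 \<and> m constant_on {a..b} \<and>
     (\<exists>e>0. (mono_on ({a - e..a} \<inter> {0..1}) m \<or> antimono_on ({a - e..a} \<inter> {0..1}) m) \<and>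
            (mono_on ({b..b + e} \<inter> {0..1}) m \<or> antimono_on ({b..b + e} \<inter> {0..1}) m)) \<and>
     (a > 0 \<longrightarrow> (\<forall>\<^sub>F e in at_right 0. \<exists>x\<in>{a - e<..<a}. nderiv {0..1} 1 m x \<noteq> 0)) \<and>
     (b < 1 \<longrightarrow> (\<forall>\<^sub>F e in at_right 0. \<exists>x\<in>{b<..<b + e}. nderiv {0..1} 1 m x \<noteq> 0))"

definition left_I :: "(real \<Rightarrow> real) \<Rightarrow> real \<Rightarrow> bool" where
  "left_I m a \<longleftrightarrow> (\<exists>e>0. mono_on ({a - e..a} \<inter> {0..1}) m)"

definition left_D :: "(real \<Rightarrow> real) \<Rightarrow> real \<Rightarrow> bool" where
  "left_D m a \<longleftrightarrow> (\<exists>e>0. antimono_on ({a - e..a} \<inter> {0..1}) m)"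

definition right_I :: "(real \<Rightarrow> real) \<Rightarrow> real \<Rightarrow> bool" where
  "right_I m b \<longleftrightarrow> (\<exists>e>0. mono_on ({b..b + e} \<inter> {0..1}) m)"

definition right_D :: "(real \<Rightarrow> real) \<Rightarrow> real \<Rightarrow> bool" where
  "right_D m b \<longleftrightarrow> (\<exists>e>0. antimono_on ({b..b + e} \<inter> {0..1}) m)"

text \<open>Segments \<open>[a,b]\<close> are represented by the pairs \<open>(a, b)\<close> of their endpoints.\<close>

definition M2 :: "(real \<Rightarrow> real) \<Rightarrow> (real \<times> real) set" where
  "M2 m = {(a, b). 0 < a \<and> b < 1 \<and> segment_of_local_max m a b \<and> left_I m a \<and> right_I m b}"

definition M3 :: "(real \<Rightarrow> real) \<Rightarrow> (real \<times> real) set" where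
  "M3 m = {(a, b). 0 < a \<and> b < 1 \<and> segment_of_local_max m a b \<and> left_I m a \<and> right_D m b}"

definition M4 :: "(real \<Rightarrow> real) \<Rightarrow> (real \<times> real) set" where
  "M4 m = {(a, b). 0 < a \<and> b < 1 \<and> segment_of_local_max m a b \<and> left_D m a \<and> right_I m b}"

definition M5 :: "(real \<Rightarrow> real) \<Rightarrow> (real \<times> real) set" where
  "M5 m = {(a, b). 0 < a \<and> b < 1 \<and> segment_of_local_max m a b \<and> left_D m a \<and> right_D m b}"

definition M6 :: "(real \<Rightarrow> real) \<Rightarrow> (real \<times> real) set" where
  "M6 m = {(a, b). a = 0 \<and> b < 1 \<and> segment_of_local_max m a b \<and> right_I m b}"

definition M7 :: "(real \<Rightarrow> real) \<Rightarrow> (real \<times> real) set" where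
  "M7 m = {(a, b). a = 0 \<and> b < 1 \<and> segment_of_local_max m a b \<and> right_D m b}"

definition M8 :: "(real \<Rightarrow> real) \<Rightarrow> (real \<times> real) set" where
  "M8 m = {(a, b). 0 < a \<and> b = 1 \<and> segment_of_local_max m a b \<and> left_I m a}"

definition M9 :: "(real \<Rightarrow> real) \<Rightarrow> (real \<times> real) set" where
  "M9 m = {(a, b). 0 < a \<and> b = 1 \<and> segment_of_local_max m a b \<and> left_D m a}"


section \<open>The limiting profiles\<close>

text \<open>
  The function \<open>w = e\<^sup>s\<^sup>m \<phi>\<close> satisfies \<open>w'' = (s\<^sup>2 m'\<^sup>2 + s m'' + c - \<lambda>) w\<close>.  If \<open>A = m\<^sup>(\<^sup>k\<^sup>)(x\<^sub>0)\<close> is the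
  first non-vanishing derivative, then with \<open>z = x - x\<^sub>0\<close>, to leading order,
  \<open>m' = A z\<^sup>k\<^sup>-\<^sup>1 / (k - 1)!\<close> and \<open>m'' = A z\<^sup>k\<^sup>-\<^sup>2 / (k - 2)!\<close>, so the rescaled limit \<open>W\<close> solves
  \<open>W'' = ((A / (k - 1)!)\<^sup>2 y\<^sup>2\<^sup>(\<^sup>k\<^sup>-\<^sup>1\<^sup>) + (A / (k - 2)!) y\<^sup>k\<^sup>-\<^sup>2) W\<close>.

  The source prints this equation as \<open>W'' = (A\<^sup>2 y\<^sup>2\<^sup>(\<^sup>k\<^sup>-\<^sup>1\<^sup>) + A y\<^sup>k\<^sup>-\<^sup>2) W\<close>, without the factorials.  The two
  agree for \<open>k = 2\<close>, but for larger \<open>k\<close> the printed equation is false: for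
  \<open>m(x) = - (x - 1/2)\<^sup>4\<close> and \<open>c = 0\<close> the principal eigenvalue is \<open>0\<close>, \<open>\<phi>\<close> is constant in \<open>x\<close>,
  \<open>W(y)\<close> is a multiple of \<open>exp (- y\<^sup>4)\<close>, and \<open>W'' = (16 y\<^sup>6 - 12 y\<^sup>2) W\<close>, whereas \<open>A = -24\<close> would
  give \<open>W'' = (576 y\<^sup>6 - 24 y\<^sup>2) W\<close>.
\<close>

definition positive_profile :: "real \<Rightarrow> nat \<Rightarrow> real set \<Rightarrow> (real \<Rightarrow> real) \<Rightarrow> bool" where
  "positive_profile A k R W \<longleftrightarrow>
     (\<forall>y\<in>R. W y > 0) \<and>
     (\<exists>V. \<forall>y\<in>R.
        (W has_real_derivative V y) (at y) \<and>
        (V has_real_derivative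
          (((A / fact (k - 1)) ^ 2 * y ^ (2 * (k - 1)) + (A / fact (k - 2)) * y ^ (k - 2)) * W y))
          (at y)) \<and>
     ((\<lambda>y. (W y) ^ 2) has_integral 1) R"

definition rescaled ::
  "(real \<Rightarrow> real \<Rightarrow> real) \<Rightarrow> real measure \<Rightarrow> real \<Rightarrow> nat \<Rightarrow> real \<Rightarrow> real \<Rightarrow> real"
where
  "rescaled w \<mu> x0 k s y =
     measure \<mu> {x0} powr (- 1 / 2) * s powr (- 1 / (2 * real k)) *
     w s (x0 + s powr (- 1 / real k) * y)"

text \<open>
  For \<open>y\<close> in a fixed compact subset of \<open>R\<close> the point \<open>x\<^sub>0 + s\<^sup>-\<^sup>1\<^sup>/\<^sup>k y\<close> lies in \<open>[0,1]\<close> once \<open>s\<close> is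
  large, provided \<open>R\<close> is the half-line pointing into \<open>[0,1]\<close> when \<open>x\<^sub>0\<close> is an endpoint.
\<close>

definition converges_to_profile ::
  "(real \<Rightarrow> real) \<Rightarrow> (real \<Rightarrow> real \<Rightarrow> real) \<Rightarrow> real measure \<Rightarrow> (nat \<Rightarrow> real) \<Rightarrow> real \<Rightarrow> nat \<Rightarrow> real set \<Rightarrow> bool"
where
  "converges_to_profile m w \<mu> s x0 k R \<longleftrightarrow>
     (\<exists>r :: nat \<Rightarrow> nat. \<exists>W. strict_mono r \<and>
        positive_profile (nderiv {0..1} k m x0) k R W \<and>
        (\<forall>K. compact K \<and> K \<subseteq> R \<longrightarrow>
           uniform_limit K (\<lambda>j. rescaled w \<mu> x0 k (s (r j))) W sequentially))"

definition converges_to_eigenfunction ::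
  "(real \<Rightarrow> real) \<Rightarrow> (real \<Rightarrow> real \<Rightarrow> real) \<Rightarrow> (nat \<Rightarrow> real) \<Rightarrow> bdry \<Rightarrow> bdry \<Rightarrow> real \<Rightarrow> real \<Rightarrow> bool"
where
  "converges_to_eigenfunction c w s i j a b \<longleftrightarrow>
     (\<exists>\<phi>1. eigenfunction i j a b (\<lambda>_. 0) c (lambda1 i j c a b) \<phi>1 \<and>
           C1_tendsto (\<lambda>n. w (s n)) \<phi>1 a b)"

end

theory Submission
  imports Defs
begin

text \<open>
  Put \<open>w = e\<^sup>s\<^sup>m \<phi>\<close>, \<open>g = e\<^sup>s\<^sup>m \<phi>'\<close>.  Then \<open>w' = s m' w + g\<close> and \<open>g' = - s m' g + (c - \<lambda>) w\<close>, and both \<open>w\<close> and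
  \<open>g\<close> are bounded in \<open>L\<^sup>2\<close> uniformly in \<open>s\<close>.  Integrating the first equation from a point into a region
  where \<open>m\<close> increases shows \<open>w \<rightarrow> 0\<close> there; the second equation gives \<open>g \<rightarrow> 0\<close> where \<open>m\<close> decreases.  On a
  segment where \<open>m\<close> is constant, \<open>w' = g\<close> and \<open>w'' = (c - \<lambda>) w\<close>, so \<open>w\<close> is compact in \<open>C\<^sup>1\<close> and its limits
  inherit a Dirichlet condition (\<open>w \<rightarrow> 0\<close>) or a Neumann condition (\<open>g \<rightarrow> 0\<close>) at each end.  A nonzero limit is
  a principal eigenfunction, and Picone's inequality with it as test function bounds \<open>limsup \<lambda>(s)\<close> by
  its eigenvalue.

  At an isolated maximum \<open>x\<^sub>0\<close> the flux \<open>Q = e\<^sup>2\<^sup>s\<^sup>m \<phi>'\<close> is monotone near \<open>x\<^sub>0\<close> as soon as \<open>\<lambda>\<close> stays away from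
  \<open>c(x\<^sub>0)\<close>, and the weight \<open>e\<^sup>2\<^sup>s\<^sup>m\<close> amplifies it exponentially.  Hence \<open>limsup \<lambda>(s) \<le> c(x\<^sub>0)\<close>, and \<open>w(x\<^sub>0) \<rightarrow> 0\<close>
  along sequences on which \<open>\<lambda>\<close> tends to a smaller value.  If \<open>\<lambda>(s\<^sub>j) \<rightarrow> L\<close> and \<open>limsup \<lambda>(s) > L\<close>, then no segment
  and no isolated maximum carries mass, \<open>w \<rightarrow> 0\<close> boundedly and pointwise, which contradicts \<open>\<integral>w\<^sup>2 = 1\<close>; so
  \<open>\<lambda>(s)\<close> converges.  The profile at \<open>x\<^sub>0\<close> comes from \<open>w(x) = exp (s (m(x) - m(x\<^sub>0))) w(x\<^sub>0) + O(\<bar>x - x\<^sub>0\<bar>\<^sup>1\<^sup>/\<^sup>2)\<close> and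
  Laplace's method.
\<close>

section \<open>Integral estimates\<close>

text \<open>The obstacle is that the drift \<open>2 s m'\<close> blows up, so no estimate may rest
  on the size of the coefficients of the equation for w. In the pair (w, g) each equation has an
  integrating factor, \<open>exp (- s m)\<close> or \<open>exp (s m)\<close>, and its source is
  bounded in L2 independently of s; the estimates then run on continuity and piecewise monotonicity
  of m. The sign in the factor fixes a direction: w is controlled from points where m is higher, g
  from points where m is lower. This is the origin of the table that assigns Dirichlet or Neumann
  conditions to ends of type I or D.

  Arguments are made for right ends and carried to left ends by x -> 1 - x, which keeps w and
  changes the sign of Q and g. The constant K bounds \<open>c - lam\<close> for all s: lam cannot
  leave the range of c because the flux vanishes at both ends.

  At a peak the error of order sqrt of the distance is uniform in s, so after rescaling it vanishes;
  what is left to find is one number, the amplitude at the peak, and the mass of the point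
  determines it.\<close>

lemma integral_Cauchy_Schwarz:
  fixes f g :: "real \<Rightarrow> real"
  assumes f: "continuous_on {a..b} f" and g: "continuous_on {a..b} g"
  shows "(integral {a..b} (\<lambda>x. f x * g x))\<^sup>2
    \<le> integral {a..b} (\<lambda>x. (f x)\<^sup>2) * integral {a..b} (\<lambda>x. (g x)\<^sup>2)"
proof -
  let ?F = "integral {a..b} (\<lambda>x. (f x)\<^sup>2)" and ?G = "integral {a..b} (\<lambda>x. (g x)\<^sup>2)"
    and ?H = "integral {a..b} (\<lambda>x. f x * g x)"
  have i: "(\<lambda>x. (f x)\<^sup>2) integrable_on {a..b}" "(\<lambda>x. (g x)\<^sup>2) integrable_on {a..b}"
    "(\<lambda>x. f x * g x) integrable_on {a..b}"
    by (intro integrable_continuous_real continuous_intros f g)+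
  have quad: "0 \<le> ?G * t\<^sup>2 + 2 * ?H * t + ?F" for t
  proof -
    have "0 \<le> integral {a..b} (\<lambda>x. (f x + t * g x)\<^sup>2)"
      by (rule integral_nonneg) (auto intro!: integrable_continuous_real continuous_intros f g)
    also have "(\<lambda>x. (f x + t * g x)\<^sup>2) = (\<lambda>x. (f x)\<^sup>2 + (2 * t) * (f x * g x) + t\<^sup>2 * (g x)\<^sup>2)"
      by (auto simp: power2_eq_square algebra_simps)
    also have "integral {a..b} \<dots> = ?F + (2 * t) * ?H + t\<^sup>2 * ?G"
      using i by (subst integral_add | simp add: integrable_on_mult_right integrable_add)+
    finally show ?thesis by (simp add: algebra_simps)
  qed
  have F0: "?F \<ge> 0" and G0: "?G \<ge> 0" using i by (auto intro!: integral_nonneg)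
  show ?thesis
  proof (cases "?G = 0")
    case True
    have "?H = 0"
    proof (rule ccontr)
      \<comment> \<open>With the quadratic term gone, the affine function takes the value -1 at
        \<open>t = - (?F + 1) / (2 * ?H)\<close>.\<close>
      assume "?H \<noteq> 0"
      then have "2 * ?H * (- (?F + 1) / (2 * ?H)) = - (?F + 1)" by simp
      then show False using quad[of "- (?F + 1) / (2 * ?H)"] True by simp
    qed
    then show ?thesis using F0 G0 by simp
  next
    case False
    then have "?G > 0" using G0 by simp
    then show ?thesis using quad[of "- ?H / ?G"]
      by (simp add: field_simps power2_eq_square)
  qed
qed

lemma integral_square_mono_interval:
  fixes f :: "real \<Rightarrow> real"
  assumes f: "continuous_on {a..b} f" and "a \<le> x" "y \<le> b"
  shows "integral {x..y} (\<lambda>t. (f t)\<^sup>2) \<le> integral {a..b} (\<lambda>t. (f t)\<^sup>2)"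
  using assms
  by (intro integral_subset_le integrable_continuous_real continuous_intros)
    (auto elim!: continuous_on_subset)

text \<open>If the minimum of f^2 exceeded K / (b - a), the integral would be too large. This yields
  starting points at which \<open>w\<close> or \<open>g\<close> is controlled pointwise by its L2
  bound alone.\<close>

lemma exists_small_value:
  fixes f :: "real \<Rightarrow> real"
  assumes f: "continuous_on {a..b} f" and "a < b" and le: "integral {a..b} (\<lambda>x. (f x)\<^sup>2) \<le> K"
  shows "\<exists>z\<in>{a..b}. \<bar>f z\<bar> \<le> sqrt (K / (b - a))"
proof (rule ccontr)
  assume neg: "\<not> ?thesis"
  have c2: "continuous_on {a..b} (\<lambda>x. (f x)\<^sup>2)" by (intro continuous_intros f)
  obtain z where z: "z \<in> {a..b}" "\<And>x. x \<in> {a..b} \<Longrightarrow> (f z)\<^sup>2 \<le> (f x)\<^sup>2"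
    using continuous_attains_inf[of "{a..b}", OF _ _ c2] \<open>a < b\<close> by auto
  have "(f z)\<^sup>2 > K / (b - a)"
    using neg z(1) by (metis linorder_not_less real_sqrt_abs real_sqrt_le_mono)
  then have "K < (f z)\<^sup>2 * (b - a)" using \<open>a < b\<close> by (simp add: field_simps)
  also have "\<dots> = integral {a..b} (\<lambda>x. (f z)\<^sup>2)" using \<open>a < b\<close> by simp
  also have "\<dots> \<le> integral {a..b} (\<lambda>x. (f x)\<^sup>2)"
    by (rule integral_le) (auto intro!: integrable_continuous_real c2 z(2))
  finally show False using le by simp
qed

text \<open>The hypothesis is the equation \<open>X' = s n' X + Y\<close>, stated without differentiating \<open>n\<close>.\<close>

lemma transport_formula:
  fixes X Y n :: "real \<Rightarrow> real"
  assumes "x \<le> z"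
    and d: "\<And>t. t \<in> {x..z} \<Longrightarrow>
      ((\<lambda>t. exp (- (s * n t)) * X t) has_real_derivative exp (- (s * n t)) * Y t) (at t within {x..z})"
  shows "((\<lambda>t. exp (- (s * (n t - n x))) * Y t) has_integral
    exp (- (s * (n z - n x))) * X z - X x) {x..z}"
proof -
  have "((\<lambda>t. exp (- (s * n t)) * Y t) has_integral
      exp (- (s * n z)) * X z - exp (- (s * n x)) * X x) {x..z}"
    using d by (intro fundamental_theorem_of_calculus[OF \<open>x \<le> z\<close>])
      (simp add: has_real_derivative_iff_has_vector_derivative)
  from has_integral_mult_right[OF this, of "exp (s * n x)"] show ?thesis
    by (simp add: right_diff_distrib mult.assoc [symmetric] flip: exp_add)
qed

text \<open>Cauchy-Schwarz in \<open>transport_formula\<close>, with the weight integral kept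
  explicit: it tends to 0 as s grows if n rises strictly above \<open>n x\<close>, and this is how
  decay of X at x is obtained.\<close>

lemma transport_bound:
  fixes X Y n :: "real \<Rightarrow> real"
  assumes "x \<le> z" "s \<ge> 0"
    and d: "\<And>t. t \<in> {x..z} \<Longrightarrow>
      ((\<lambda>t. exp (- (s * n t)) * X t) has_real_derivative exp (- (s * n t)) * Y t) (at t within {x..z})"
    and n: "continuous_on {x..z} n" and Y: "continuous_on {x..z} Y"
    and K: "integral {x..z} (\<lambda>t. (Y t)\<^sup>2) \<le> K"
  shows "\<bar>X x - exp (- (s * (n z - n x))) * X z\<bar>
    \<le> sqrt (K * integral {x..z} (\<lambda>t. exp (- (2 * s * (n t - n x)))))"
proof -
  let ?E = "\<lambda>t. exp (- (s * (n t - n x)))"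
  have hi: "((\<lambda>t. ?E t * Y t) has_integral ?E z * X z - X x) {x..z}"
    using transport_formula[OF assms(1) d] .
  have "(integral {x..z} (\<lambda>t. ?E t * Y t))\<^sup>2
      \<le> integral {x..z} (\<lambda>t. (?E t)\<^sup>2) * integral {x..z} (\<lambda>t. (Y t)\<^sup>2)"
    by (rule integral_Cauchy_Schwarz) (intro continuous_intros n Y)+
  also have "\<dots> \<le> integral {x..z} (\<lambda>t. (?E t)\<^sup>2) * K"
    by (intro mult_left_mono K integral_nonneg integrable_continuous_real continuous_intros n) auto
  also have "(\<lambda>t. (?E t)\<^sup>2) = (\<lambda>t. exp (- (2 * s * (n t - n x))))"
    by (auto simp: power2_eq_square simp flip: exp_add)
  finally have "\<bar>integral {x..z} (\<lambda>t. ?E t * Y t)\<bar>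
      \<le> sqrt (K * integral {x..z} (\<lambda>t. exp (- (2 * s * (n t - n x)))))"
    using real_le_rsqrt by (simp add: mult.commute)
  moreover have "X x = ?E z * X z - integral {x..z} (\<lambda>t. ?E t * Y t)"
    using integral_unique[OF hi] by simp
  ultimately show ?thesis
    by linarith
qed

text \<open>Where n stays above its value at x the weight is at most 1, which leaves an error of
  order sqrt (z - x), uniform in s and valid across plateaus of n.\<close>

lemma transport_bound_mono:
  fixes X Y n :: "real \<Rightarrow> real"
  assumes "x \<le> z" "s \<ge> 0"
    and d: "\<And>t. t \<in> {x..z} \<Longrightarrow>
      ((\<lambda>t. exp (- (s * n t)) * X t) has_real_derivative exp (- (s * n t)) * Y t) (at t within {x..z})"
    and n: "continuous_on {x..z} n" and Y: "continuous_on {x..z} Y"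
    and K: "integral {x..z} (\<lambda>t. (Y t)\<^sup>2) \<le> K"
    and ge: "\<And>t. t \<in> {x..z} \<Longrightarrow> n x \<le> n t"
  shows "\<bar>X x - exp (- (s * (n z - n x))) * X z\<bar> \<le> sqrt (K * (z - x))"
proof -
  have K0: "K \<ge> 0"
    using K integral_nonneg[of "\<lambda>t. (Y t)\<^sup>2" "{x..z}"] integrable_continuous_real[of x z "\<lambda>t. (Y t)\<^sup>2"] Y
    by (force intro: continuous_intros)
  have "integral {x..z} (\<lambda>t. exp (- (2 * s * (n t - n x)))) \<le> integral {x..z} (\<lambda>t. 1)"
    using ge \<open>s \<ge> 0\<close>
    by (intro integral_le integrable_continuous_real continuous_intros n) auto
  then have "K * integral {x..z} (\<lambda>t. exp (- (2 * s * (n t - n x)))) \<le> K * (z - x)"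
    using K0 \<open>x \<le> z\<close> by (auto intro: mult_left_mono)
  then show ?thesis
    using transport_bound[OF assms(1,2) d n Y K] by (smt (verit) real_sqrt_le_mono)
qed

text \<open>The integrand tends to 0 at every t except t = x, and 1 dominates it.\<close>

lemma exp_integral_vanishes:
  fixes n :: "real \<Rightarrow> real"
  assumes n: "continuous_on {x..y} n" and gt: "\<And>t. t \<in> {x<..y} \<Longrightarrow> n x < n t"
  shows "((\<lambda>s. integral {x..y} (\<lambda>t. exp (- (2 * s * (n t - n x))))) \<longlongrightarrow> 0) at_top"
proof (rule tendsto_at_topI_sequentially)
  fix S :: "nat \<Rightarrow> real" assume S: "filterlim S at_top sequentially"
  then obtain N where N: "\<And>k. k \<ge> N \<Longrightarrow> S k \<ge> 0"
    by (metis (no_types, lifting) eventually_sequentially filterlim_at_top)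
  \<comment> \<open>The shift by N discards the finitely many possibly negative parameters, for
    which 1 is no dominating bound.\<close>
  have "(\<lambda>k. integral {x..y} (\<lambda>t. exp (- (2 * S (k + N) * (n t - n x)))))
      \<longlonglongrightarrow> integral {x..y} (\<lambda>t. if t = x then 1 else 0)"
  proof (rule dominated_convergence(2)[where h = "\<lambda>_. 1"])
    fix k t assume t: "t \<in> {x..y}"
    have "n x \<le> n t" using gt[of t] t by (cases "t = x") auto
    then show "norm (exp (- (2 * S (k + N) * (n t - n x)))) \<le> 1"
      using N[of "k + N"] by simp
  next
    fix t assume t: "t \<in> {x..y}"
    show "(\<lambda>k. exp (- (2 * S (k + N) * (n t - n x)))) \<longlonglongrightarrow> (if t = x then 1 else 0)"
    proof (cases "t = x")
      case False
      then have "n t - n x > 0" using gt[of t] t by auto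
      moreover have "filterlim (\<lambda>k. S (k + N)) at_top sequentially"
        using S by (rule filterlim_compose) (rule filterlim_add_const_nat_at_top)
      ultimately have "filterlim (\<lambda>k. (2 * (n t - n x)) * S (k + N)) at_top sequentially"
        by (intro filterlim_tendsto_pos_mult_at_top[OF tendsto_const]) auto
      then have "(\<lambda>k. exp (- ((2 * (n t - n x)) * S (k + N)))) \<longlonglongrightarrow> 0"
        by (intro filterlim_compose[OF exp_at_bot] filterlim_compose[OF filterlim_uminus_at_bot_at_top])
      then show ?thesis using False by (simp add: algebra_simps)
    qed simp
  qed (auto intro!: integrable_continuous_real continuous_intros n)
  moreover have "integral {x..y} (\<lambda>t. if t = x then 1 else 0 :: real) = 0"
    by (rule integral_unique) (rule has_integral_spike_finite[of "{x}" _ _ "\<lambda>_. 0"], auto)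
  ultimately show "(\<lambda>k. integral {x..y} (\<lambda>t. exp (- (2 * S k * (n t - n x))))) \<longlonglongrightarrow> 0"
    by (simp add: LIMSEQ_offset)
qed

text \<open>The value at x is compared with the value at a point of the right half where the L2 norm
  bounds X; the exponential factor kills that value, the weight integral kills the source. It serves
  \<open>w\<close> with n = m and \<open>g\<close> with n = - m.\<close>

lemma transport_vanishes:
  fixes X Y :: "real \<Rightarrow> real \<Rightarrow> real" and n :: "real \<Rightarrow> real"
  assumes "x < y"
    and d: "\<And>s t. s > 0 \<Longrightarrow> t \<in> {x..y} \<Longrightarrow>
      ((\<lambda>t. exp (- (s * n t)) * X s t) has_real_derivative exp (- (s * n t)) * Y s t) (at t within {x..y})"
    and n: "continuous_on {x..y} n"
    and X: "\<And>s. s > 0 \<Longrightarrow> continuous_on {x..y} (X s)"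
    and Y: "\<And>s. s > 0 \<Longrightarrow> continuous_on {x..y} (Y s)"
    and KX: "\<And>s. s > 0 \<Longrightarrow> integral {x..y} (\<lambda>t. (X s t)\<^sup>2) \<le> K"
    and KY: "\<And>s. s > 0 \<Longrightarrow> integral {x..y} (\<lambda>t. (Y s t)\<^sup>2) \<le> K"
    and mono: "mono_on {x..y} n" and gt: "\<And>t. t \<in> {x<..y} \<Longrightarrow> n x < n t"
  shows "((\<lambda>s. X s x) \<longlongrightarrow> 0) at_top"
proof -
  \<comment> \<open>The comparison point depends on s and lies anywhere in {z..y}. Keeping it beyond
    the midpoint gives \<open>n z \<le> n \<xi>\<close>, hence the decay rate
    \<open>n z - n x\<close> independent of s.\<close>
  define z where "z = (x + y) / 2"
  have z: "x < z" "z < y" using \<open>x < y\<close> by (auto simp: z_def)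
  define B where "B = sqrt (K / (y - z))"
  let ?I = "\<lambda>s. integral {x..y} (\<lambda>t. exp (- (2 * s * (n t - n x))))"
  have K0: "K \<ge> 0"
    using KY[of 1] integral_nonneg[of "\<lambda>t. (Y 1 t)\<^sup>2" "{x..y}"]
      integrable_continuous_real[of x y "\<lambda>t. (Y 1 t)\<^sup>2"] Y[of 1]
    by (force intro: continuous_intros)
  have bound: "norm (X s x) \<le> exp (- (s * (n z - n x))) * B + sqrt (K * ?I s)" if "s > 0" for s
  proof -
    have sub: "continuous_on {z..y} (X s)" "integral {z..y} (\<lambda>t. (X s t)\<^sup>2) \<le> K"
      using X[OF that] KX[OF that] z integral_square_mono_interval[of x y "X s" z y]
      by (auto elim: continuous_on_subset)
    obtain \<xi> where \<xi>: "\<xi> \<in> {z..y}" "\<bar>X s \<xi>\<bar> \<le> B"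
      using exists_small_value[OF sub(1) \<open>z < y\<close> sub(2)] by (auto simp: B_def)
    have sb: "{x..\<xi>} \<subseteq> {x..y}" using \<xi> by auto
    have "\<bar>X s x - exp (- (s * (n \<xi> - n x))) * X s \<xi>\<bar>
        \<le> sqrt (K * integral {x..\<xi>} (\<lambda>t. exp (- (2 * s * (n t - n x)))))"
    proof (rule transport_bound)
      fix t assume "t \<in> {x..\<xi>}"
      then show "((\<lambda>t. exp (- (s * n t)) * X s t) has_real_derivative exp (- (s * n t)) * Y s t)
          (at t within {x..\<xi>})"
        using d[OF that, of t] sb by (auto intro: has_field_derivative_subset)
    next
      show "integral {x..\<xi>} (\<lambda>t. (Y s t)\<^sup>2) \<le> K"
        using integral_square_mono_interval[of x y "Y s" x \<xi>] Y[OF that] KY[OF that] \<xi> by auto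
    qed (use sb n Y[OF that] that \<xi> z in \<open>auto elim: continuous_on_subset\<close>)
    then have "\<bar>X s x\<bar> \<le> exp (- (s * (n \<xi> - n x))) * \<bar>X s \<xi>\<bar>
        + sqrt (K * integral {x..\<xi>} (\<lambda>t. exp (- (2 * s * (n t - n x)))))"
      using abs_mult[of "exp (- (s * (n \<xi> - n x)))" "X s \<xi>"] by simp
    also have "exp (- (s * (n \<xi> - n x))) * \<bar>X s \<xi>\<bar> \<le> exp (- (s * (n z - n x))) * B"
    proof (rule mult_mono)
      have "n z \<le> n \<xi>" using mono \<xi> z by (auto simp: mono_on_def)
      then show "exp (- (s * (n \<xi> - n x))) \<le> exp (- (s * (n z - n x)))" using that by simp
    qed (use \<xi> in auto)
    also have "integral {x..\<xi>} (\<lambda>t. exp (- (2 * s * (n t - n x)))) \<le> ?I s"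
      using sb n
      by (intro integral_subset_le integrable_continuous_real continuous_intros)
        (auto elim: continuous_on_subset)
    finally show ?thesis using K0 by (simp add: mult_left_mono)
  qed
  have "((\<lambda>s. exp (- (s * (n z - n x))) * B + sqrt (K * ?I s)) \<longlongrightarrow> 0 * B + sqrt (K * 0)) at_top"
  proof (intro tendsto_intros exp_integral_vanishes n gt)
    have "n z - n x > 0" using gt[of z] z by auto
    then show "((\<lambda>s. exp (- (s * (n z - n x)))) \<longlongrightarrow> 0) at_top"
      by real_asymp
  qed
  then have "((\<lambda>s. exp (- (s * (n z - n x))) * B + sqrt (K * ?I s)) \<longlongrightarrow> 0) at_top" by simp
  moreover have "\<forall>\<^sub>F s in at_top. norm (X s x) \<le> exp (- (s * (n z - n x))) * B + sqrt (K * ?I s)"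
    using eventually_gt_at_top[of 0] by eventually_elim (rule bound)
  ultimately show ?thesis by (rule Lim_null_comparison[rotated])
qed

section \<open>Eigenfunctions as solutions of a first-order system\<close>

text \<open>Strictness is imposed only against the value at x: plateaus beyond x are allowed, but
  the level \<open>m x\<close> is left at once.\<close>

definition rises_right :: "(real \<Rightarrow> real) \<Rightarrow> real \<Rightarrow> bool" where
  "rises_right m x \<longleftrightarrow> (\<exists>y>x. y \<le> 1 \<and> mono_on {x..y} m \<and> (\<forall>t\<in>{x<..y}. m x < m t))"

text \<open>The condition inherited at the right endpoint of a flat segment; at a left endpoint \<open>a\<close> it is
  used for the reflected potential at \<open>1 - a\<close>.\<close>

definition right_end :: "(real \<Rightarrow> real) \<Rightarrow> real \<Rightarrow> bdry \<Rightarrow> bool" where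
  "right_end m b i \<longleftrightarrow> (b = 1 \<and> i = Neumann) \<or> (rises_right m b \<and> i = Dirichlet) \<or>
     (rises_right (\<lambda>t. - m t) b \<and> i = Neumann)"

text \<open>A boundary condition on a bare pair (value, derivative), so that it applies to limits of
  \<open>w\<close> and \<open>g\<close> and survives reflection.\<close>

definition bc :: "bdry \<Rightarrow> real \<Rightarrow> real \<Rightarrow> bool" where
  "bc i u v \<longleftrightarrow> (case i of Dirichlet \<Rightarrow> u = 0 | Neumann \<Rightarrow> v = 0)"

lemma has_real_derivative_reflect:
  fixes f :: "real \<Rightarrow> real"
  assumes "(f has_real_derivative D) (at (1 - x) within {0..1})"
  shows "((\<lambda>x. f (1 - x)) has_real_derivative - D) (at x within {0..1})"
proof -
  have "(\<lambda>x::real. 1 - x) ` {0..1} = {0..1}"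
    by (auto simp: image_iff intro!: bexI[where x = "1 - _"])
  then have "((f \<circ> (\<lambda>x. 1 - x)) has_real_derivative D * (-1)) (at x within {0..1})"
    using assms by (intro DERIV_image_chain) (auto intro!: derivative_eq_intros)
  then show ?thesis by (simp add: o_def)
qed

lemma integral_reflect_01:
  fixes f :: "real \<Rightarrow> real"
  shows "((\<lambda>x. f (1 - x)) has_integral i) {0..1} \<longleftrightarrow> (f has_integral i) {0..1}"
proof -
  have *: "((\<lambda>x. f (1 - x)) has_integral i) {0..1}" if "(f has_integral i) {0..1}" for f :: "real \<Rightarrow> real"
  proof -
    have "(\<lambda>x::real. 1 - x) ` {0..1} = {0..1}"
      by (auto simp: image_iff intro!: bexI[where x = "1 - _"])
    then show ?thesis
      using has_integral_affinity[of f i 0 1 "-1" 1] that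
      by (simp add: box_real)
  qed
  show ?thesis using *[of f] *[of "\<lambda>x. f (1 - x)"] by auto
qed

text \<open>
  \<open>Q = e\<^sup>2\<^sup>s\<^sup>m \<phi>'\<close> is the flux of the eigenfunction, so the equation becomes a first-order system that does
  not involve \<open>m'\<close>.
\<close>

locale neumann_family =
  fixes m c lam :: "real \<Rightarrow> real" and \<phi> Q :: "real \<Rightarrow> real \<Rightarrow> real" and K :: real
  assumes m_cont: "continuous_on {0..1} m"
    and c_cont: "continuous_on {0..1} c"
    and K1: "K \<ge> 1"
    and cK: "s > 0 \<Longrightarrow> x \<in> {0..1} \<Longrightarrow> \<bar>c x - lam s\<bar> \<le> K"
    and pos: "s > 0 \<Longrightarrow> x \<in> {0..1} \<Longrightarrow> \<phi> s x > 0"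
    and deriv_\<phi>: "s > 0 \<Longrightarrow> x \<in> {0..1} \<Longrightarrow>
      (\<phi> s has_real_derivative exp (- (2 * s * m x)) * Q s x) (at x within {0..1})"
    and deriv_Q: "s > 0 \<Longrightarrow> x \<in> {0..1} \<Longrightarrow>
      (Q s has_real_derivative (c x - lam s) * exp (2 * s * m x) * \<phi> s x) (at x within {0..1})"
    and Q0: "s > 0 \<Longrightarrow> Q s 0 = 0" and Q1: "s > 0 \<Longrightarrow> Q s 1 = 0"
    and normalized: "s > 0 \<Longrightarrow> ((\<lambda>x. (exp (s * m x) * \<phi> s x)\<^sup>2) has_integral 1) {0..1}"
    and pieces: "\<exists>P. finite P \<and> (\<Union>(a, b)\<in>P. {a..b}) = {0..1} \<and>
      (\<forall>(a, b)\<in>P. mono_on {a..b} m \<or> mono_on {a..b} (\<lambda>x. - m x))"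
begin

definition w :: "real \<Rightarrow> real \<Rightarrow> real" where "w s x = exp (s * m x) * \<phi> s x"
definition g :: "real \<Rightarrow> real \<Rightarrow> real" where "g s x = exp (- (s * m x)) * Q s x"

text \<open>Reflection reverses the direction of the derivative, hence the sign of the flux; the
  other data are merely read backwards. Each statement about right ends thus yields one about left
  ends.\<close>

lemma mirror: "neumann_family (\<lambda>x. m (1 - x)) (\<lambda>x. c (1 - x)) lam
  (\<lambda>s x. \<phi> s (1 - x)) (\<lambda>s x. - Q s (1 - x)) K"
proof
  show "continuous_on {0..1} (\<lambda>x. m (1 - x))"
    by (rule continuous_on_compose2[OF m_cont]) (auto intro!: continuous_intros)
  show "continuous_on {0..1} (\<lambda>x. c (1 - x))"
    by (rule continuous_on_compose2[OF c_cont]) (auto intro!: continuous_intros)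
  show "1 \<le> K" by (rule K1)
  show "\<And>s. s > 0 \<Longrightarrow> - Q s (1 - 0) = 0" "\<And>s. s > 0 \<Longrightarrow> - Q s (1 - 1) = 0"
    by (simp_all add: Q0 Q1)
  obtain P where P: "finite P" "(\<Union>(a, b)\<in>P. {a..b}) = {0..1}"
    "\<forall>(a, b)\<in>P. mono_on {a..b} m \<or> mono_on {a..b} (\<lambda>x. - m x)"
    using pieces by blast
  show "\<exists>P. finite P \<and> (\<Union>(a, b)\<in>P. {a..b}) = {0..1} \<and>
      (\<forall>(a, b)\<in>P. mono_on {a..b} (\<lambda>x. m (1 - x)) \<or> mono_on {a..b} (\<lambda>x. - m (1 - x)))"
  proof (intro exI[of _ "(\<lambda>(a, b). (1 - b, 1 - a)) ` P"] conjI)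
    show "(\<Union>(a, b)\<in>(\<lambda>(a, b). (1 - b, 1 - a)) ` P. {a..b}) = {0..1}"
    proof (rule set_eqI)
      fix x
      have "x \<in> (\<Union>(a, b)\<in>(\<lambda>(a, b). (1 - b, 1 - a)) ` P. {a..b}) \<longleftrightarrow> 1 - x \<in> (\<Union>(a, b)\<in>P. {a..b})"
        by (auto split: prod.splits) (force simp: algebra_simps)+
      then show "x \<in> (\<Union>(a, b)\<in>(\<lambda>(a, b). (1 - b, 1 - a)) ` P. {a..b}) \<longleftrightarrow> x \<in> {0..1}"
        using P(2) by auto
    qed
    show "\<forall>(a, b)\<in>(\<lambda>(a, b). (1 - b, 1 - a)) ` P.
        mono_on {a..b} (\<lambda>x. m (1 - x)) \<or> mono_on {a..b} (\<lambda>x. - m (1 - x))"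
      using P(3) by (fastforce simp: mono_on_def)
  qed (use P in auto)
next
  fix s x :: real assume sx: "s > 0" "x \<in> {0..1}"
  then have x': "1 - x \<in> {0..1}" by auto
  show "\<bar>c (1 - x) - lam s\<bar> \<le> K" using cK[OF sx(1) x'] .
  show "\<phi> s (1 - x) > 0" using pos[OF sx(1) x'] .
  show "((\<lambda>x. \<phi> s (1 - x)) has_real_derivative exp (- (2 * s * m (1 - x))) * - Q s (1 - x))
      (at x within {0..1})"
    using has_real_derivative_reflect[OF deriv_\<phi>[OF sx(1) x']] by (simp only: mult_minus_right)
  show "((\<lambda>x. - Q s (1 - x)) has_real_derivative
      (c (1 - x) - lam s) * exp (2 * s * m (1 - x)) * \<phi> s (1 - x)) (at x within {0..1})"
    using DERIV_minus[OF has_real_derivative_reflect[OF deriv_Q[OF sx(1) x']]]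
    by (simp only: minus_minus)
next
  fix s :: real assume "s > 0"
  show "((\<lambda>x. (exp (s * m (1 - x)) * \<phi> s (1 - x))\<^sup>2) has_integral 1) {0..1}"
    using normalized[OF \<open>s > 0\<close>] integral_reflect_01[of "\<lambda>x. (exp (s * m x) * \<phi> s x)\<^sup>2"] by simp
qed

section \<open>Transport identities and L2 bounds uniform in s\<close>

lemma cont_\<phi>: "s > 0 \<Longrightarrow> continuous_on {0..1} (\<phi> s)"
  by (rule DERIV_continuous_on) (rule deriv_\<phi>)

lemma cont_Q: "s > 0 \<Longrightarrow> continuous_on {0..1} (Q s)"
  by (rule DERIV_continuous_on) (rule deriv_Q)

lemma cont_w: "s > 0 \<Longrightarrow> continuous_on {0..1} (w s)"
  unfolding w_def by (intro continuous_intros m_cont cont_\<phi>)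

lemma cont_g: "s > 0 \<Longrightarrow> continuous_on {0..1} (g s)"
  unfolding g_def by (intro continuous_intros m_cont cont_Q)

lemma w_pos: "s > 0 \<Longrightarrow> x \<in> {0..1} \<Longrightarrow> w s x > 0"
  using pos by (simp add: w_def)

text \<open>The integrating factor turns \<open>w\<close> back into \<phi>, so m itself is never
  differentiated.\<close>

lemma transport_w:
  assumes "s > 0" "t \<in> {x..y}" "0 \<le> x" "y \<le> 1"
  shows "((\<lambda>t. exp (- (s * m t)) * w s t) has_real_derivative exp (- (s * m t)) * g s t)
    (at t within {x..y})"
proof -
  have "(\<lambda>t. exp (- (s * m t)) * w s t) = \<phi> s"
    by (auto simp: w_def exp_minus)
  moreover have "exp (- (s * m t)) * g s t = exp (- (2 * s * m t)) * Q s t"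
    by (simp add: g_def mult.assoc[symmetric] flip: exp_add)
  moreover have "(\<phi> s has_real_derivative exp (- (2 * s * m t)) * Q s t) (at t within {x..y})"
    by (rule has_field_derivative_subset[OF deriv_\<phi>]) (use assms in auto)
  ultimately show ?thesis by simp
qed

text \<open>The integrating factor recovers Q. The exponent carries \<open>- m\<close> where that of
  w carries \<open>m\<close>, so g decays next to falling stretches and w next to rising
  ones.\<close>

lemma transport_g:
  assumes "s > 0" "t \<in> {x..y}" "0 \<le> x" "y \<le> 1"
  shows "((\<lambda>t. exp (- (s * - m t)) * g s t) has_real_derivative
    exp (- (s * - m t)) * ((c t - lam s) * w s t)) (at t within {x..y})"
proof -
  have "(\<lambda>t. exp (- (s * - m t)) * g s t) = Q s"
    by (auto simp: g_def exp_minus)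
  moreover have "exp (- (s * - m t)) * ((c t - lam s) * w s t) = (c t - lam s) * exp (2 * s * m t) * \<phi> s t"
    using exp_double[of "s * m t"] by (simp add: w_def power2_eq_square mult.assoc)
  moreover have "(Q s has_real_derivative (c t - lam s) * exp (2 * s * m t) * \<phi> s t) (at t within {x..y})"
    by (rule has_field_derivative_subset[OF deriv_Q]) (use assms in auto)
  ultimately show ?thesis by (simp only:)
qed

lemma mass_w: "s > 0 \<Longrightarrow> integral {0..1} (\<lambda>x. (w s x)\<^sup>2) = 1"
  using normalized integral_unique unfolding w_def by blast

text \<open>The flux equation is multiplied by \<phi> and integrated. The end terms vanish with Q,
  so the energy equals the integral of \<open>(lam s - c) * w^2\<close>, at most K by the
  normalization.\<close>

lemma energy:
  assumes "s > 0" shows "integral {0..1} (\<lambda>x. (g s x)\<^sup>2) \<le> K"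
proof -
  have "((\<lambda>x. (g s x)\<^sup>2 + (c x - lam s) * (w s x)\<^sup>2) has_integral Q s 1 * \<phi> s 1 - Q s 0 * \<phi> s 0) {0..1}"
  proof (rule fundamental_theorem_of_calculus)
    fix x :: real assume x: "x \<in> {0..1}"
    have "((\<lambda>x. Q s x * \<phi> s x) has_real_derivative
        (c x - lam s) * exp (2 * s * m x) * \<phi> s x * \<phi> s x + exp (- (2 * s * m x)) * Q s x * Q s x)
        (at x within {0..1})"
      by (rule DERIV_mult[OF deriv_Q deriv_\<phi>]) (use assms x in auto)
    also have "(c x - lam s) * exp (2 * s * m x) * \<phi> s x * \<phi> s x + exp (- (2 * s * m x)) * Q s x * Q s x
        = (g s x)\<^sup>2 + (c x - lam s) * (w s x)\<^sup>2"
      by (simp add: g_def w_def power_mult_distrib power2_eq_square[of "\<phi> s x"]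
          power2_eq_square[of "Q s x"] mult_ac flip: exp_double)
    finally show "((\<lambda>x. Q s x * \<phi> s x) has_vector_derivative (g s x)\<^sup>2 + (c x - lam s) * (w s x)\<^sup>2)
        (at x within {0..1})"
      by (simp add: has_real_derivative_iff_has_vector_derivative)
  qed simp
  then have i0: "((\<lambda>x. (g s x)\<^sup>2 + (c x - lam s) * (w s x)\<^sup>2) has_integral 0) {0..1}"
    using Q0 Q1 assms by simp
  have iw: "((\<lambda>x. (w s x)\<^sup>2) has_integral 1) {0..1}"
    using normalized[OF assms] by (simp add: w_def)
  have "integral {0..1} (\<lambda>x. (g s x)\<^sup>2)
      \<le> integral {0..1} (\<lambda>x. ((g s x)\<^sup>2 + (c x - lam s) * (w s x)\<^sup>2) + K * (w s x)\<^sup>2)"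
  proof (rule integral_le)
    fix x :: real assume x: "x \<in> {0..1}"
    have "- K \<le> c x - lam s" using cK[OF assms x] by linarith
    then have "(- K) * (w s x)\<^sup>2 \<le> (c x - lam s) * (w s x)\<^sup>2" by (rule mult_right_mono) simp
    then show "(g s x)\<^sup>2 \<le> (g s x)\<^sup>2 + (c x - lam s) * (w s x)\<^sup>2 + K * (w s x)\<^sup>2" by simp
  qed (intro integrable_continuous_real continuous_intros cont_g cont_w c_cont assms)+
  also have "\<dots> = K"
    using has_integral_add[OF i0 has_integral_mult_right[OF iw, of K]] by (simp add: integral_unique)
  finally show ?thesis .
qed

lemma source_L2:
  assumes "s > 0" shows "integral {0..1} (\<lambda>x. ((c x - lam s) * w s x)\<^sup>2) \<le> K\<^sup>2"
proof -
  have "integral {0..1} (\<lambda>x. ((c x - lam s) * w s x)\<^sup>2) \<le> integral {0..1} (\<lambda>x. K\<^sup>2 * (w s x)\<^sup>2)"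
  proof (rule integral_le)
    fix x :: real assume x: "x \<in> {0..1}"
    have "(c x - lam s)\<^sup>2 \<le> K\<^sup>2" using cK[OF assms x] K1
      by (metis abs_ge_zero power2_abs power_mono)
    then show "((c x - lam s) * w s x)\<^sup>2 \<le> K\<^sup>2 * (w s x)\<^sup>2"
      by (simp add: power_mult_distrib mult_right_mono)
  qed (intro integrable_continuous_real continuous_intros cont_g cont_w c_cont assms)+
  also have "\<dots> = K\<^sup>2" using mass_w[OF assms] by simp
  finally show ?thesis .
qed

text \<open>Makes \<open>K^2\<close> a common bound for the L2 integrals of w, of g and of the
  source.\<close>

lemma K_square: "K \<le> K\<^sup>2" "1 \<le> K\<^sup>2"
  using K1 mult_left_mono[of 1 K K] by (auto simp: power2_eq_square)
    (use K1 mult_left_mono[of 1 K K] in linarith)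

lemma sub_L2:
  assumes "s > 0" "0 \<le> x" "y \<le> 1"
  shows "integral {x..y} (\<lambda>t. (w s t)\<^sup>2) \<le> 1" "integral {x..y} (\<lambda>t. (g s t)\<^sup>2) \<le> K"
    "integral {x..y} (\<lambda>t. ((c t - lam s) * w s t)\<^sup>2) \<le> K\<^sup>2"
proof -
  have "continuous_on {0..1} (\<lambda>t. (c t - lam s) * w s t)"
    by (intro continuous_intros c_cont cont_w assms)
  then show "integral {x..y} (\<lambda>t. (w s t)\<^sup>2) \<le> 1" "integral {x..y} (\<lambda>t. (g s t)\<^sup>2) \<le> K"
    "integral {x..y} (\<lambda>t. ((c t - lam s) * w s t)\<^sup>2) \<le> K\<^sup>2"
    using integral_square_mono_interval[OF cont_w[OF assms(1)] assms(2,3)] mass_w[OF assms(1)]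
      integral_square_mono_interval[OF cont_g[OF assms(1)] assms(2,3)] energy[OF assms(1)]
      integral_square_mono_interval[OF _ assms(2,3), of "\<lambda>t. (c t - lam s) * w s t"] source_L2[OF assms(1)]
    by linarith+
qed

lemma w_vanishes_rising:
  assumes "0 \<le> x" "rises_right m x"
  shows "((\<lambda>s. w s x) \<longlongrightarrow> 0) at_top"
proof -
  obtain y where y: "x < y" "y \<le> 1" "mono_on {x..y} m" "\<And>t. t \<in> {x<..y} \<Longrightarrow> m x < m t"
    using assms by (auto simp: rises_right_def)
  have sub: "{x..y} \<subseteq> {0..1}" using y assms by auto
  show ?thesis
  proof (rule transport_vanishes[OF y(1) _ _ _ _ _ _ y(3,4), where X = w and Y = g and K = "K\<^sup>2"])
    fix s :: real assume "s > 0"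
    then show "integral {x..y} (\<lambda>t. (w s t)\<^sup>2) \<le> K\<^sup>2" "integral {x..y} (\<lambda>t. (g s t)\<^sup>2) \<le> K\<^sup>2"
      using sub_L2[of s x y] y assms K_square by auto
  qed (use transport_w y assms sub in \<open>auto intro: continuous_on_subset m_cont cont_w cont_g\<close>)
qed

text \<open>Transport along \<open>- m\<close>; the source is now \<open>(c - lam) * w\<close>,
  whose L2 bound is \<open>source_L2\<close>.\<close>

lemma g_vanishes_falling:
  assumes "0 \<le> x" "rises_right (\<lambda>t. - m t) x"
  shows "((\<lambda>s. g s x) \<longlongrightarrow> 0) at_top"
proof -
  obtain y where y: "x < y" "y \<le> 1" "mono_on {x..y} (\<lambda>t. - m t)"
    "\<And>t. t \<in> {x<..y} \<Longrightarrow> - m x < - m t"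
    using assms by (auto simp: rises_right_def)
  have sub: "{x..y} \<subseteq> {0..1}" using y assms by auto
  show ?thesis
  proof (rule transport_vanishes[OF y(1) _ _ _ _ _ _ y(3,4), where X = g and K = "K\<^sup>2"
        and Y = "\<lambda>s t. (c t - lam s) * w s t"])
    fix s :: real assume "s > 0"
    then show "integral {x..y} (\<lambda>t. (g s t)\<^sup>2) \<le> K\<^sup>2"
      "integral {x..y} (\<lambda>t. ((c t - lam s) * w s t)\<^sup>2) \<le> K\<^sup>2"
      using sub_L2[of s x y] y assms K_square by auto
    show "continuous_on {x..y} (\<lambda>t. (c t - lam s) * w s t)"
      by (rule continuous_on_subset[OF _ sub]) (intro continuous_intros c_cont cont_w \<open>s > 0\<close>)
    show "((\<lambda>t. exp (- (s * - m t)) * g s t) has_real_derivative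
        exp (- (s * - m t)) * ((c t - lam s) * w s t)) (at t within {x..y})" if "t \<in> {x..y}" for t
      by (rule transport_g) (use that y assms \<open>s > 0\<close> in auto)
    show "continuous_on {x..y} (g s)"
      by (rule continuous_on_subset[OF cont_g sub]) fact
  next
    show "continuous_on {x..y} (\<lambda>t. - m t)"
      by (intro continuous_intros continuous_on_subset[OF m_cont sub])
  qed
qed

text \<open>A modulus of continuity towards higher m that does not deteriorate with s. It gives both
  the dominating bound for w and the shape of w at a peak.\<close>

lemma w_transport_bound:
  assumes "s > 0" "0 \<le> x" "x \<le> z" "z \<le> 1" "\<And>t. t \<in> {x..z} \<Longrightarrow> m x \<le> m t"
  shows "\<bar>w s x - exp (- (s * (m z - m x))) * w s z\<bar> \<le> sqrt (K * (z - x))"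
proof (rule transport_bound_mono[OF assms(3), where Y = "g s"])
  have sub: "{x..z} \<subseteq> {0..1}" using assms by auto
  show "continuous_on {x..z} m" "continuous_on {x..z} (g s)"
    using continuous_on_subset[OF m_cont sub] continuous_on_subset[OF cont_g sub] assms by auto
qed (use assms transport_w sub_L2[of s x z] in auto)

lemma w_bound:
  assumes "s > 0" "0 \<le> x" "x \<le> z" "z \<le> 1" "\<And>t. t \<in> {x..z} \<Longrightarrow> m x \<le> m t"
  shows "w s x \<le> w s z + sqrt (K * (z - x))"
proof -
  have "exp (- (s * (m z - m x))) * w s z \<le> 1 * w s z"
    using assms w_pos[of s z] by (intro mult_right_mono) auto
  then show ?thesis using w_transport_bound[OF assms] by linarith
qed

text \<open>The derivative of \<open>Q * \<psi>^2 / \<phi>\<close> is the weighted energy density of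
  \<psi> minus a perfect square. The end terms are kept because the intervals of interest end inside
  [0,1], where Q need not vanish.\<close>

lemma picone:
  assumes "s > 0" "0 \<le> p" "p \<le> q" "q \<le> 1"
    and d: "\<And>t. t \<in> {p..q} \<Longrightarrow> (\<psi> has_real_derivative \<psi>' t) (at t within {p..q})"
    and \<psi>': "continuous_on {p..q} \<psi>'"
  shows "Q s q * (\<psi> q)\<^sup>2 / \<phi> s q - Q s p * (\<psi> p)\<^sup>2 / \<phi> s p
    \<le> integral {p..q} (\<lambda>t. exp (2 * s * m t) * ((\<psi>' t)\<^sup>2 + (c t - lam s) * (\<psi> t)\<^sup>2))"
proof -
  have sub: "{p..q} \<subseteq> {0..1}" using assms by auto
  have \<psi>: "continuous_on {p..q} \<psi>" using d by (rule DERIV_continuous_on)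
  let ?D = "\<lambda>t. (c t - lam s) * exp (2 * s * m t) * (\<psi> t)\<^sup>2
    + Q s t * (2 * \<psi> t * \<psi>' t) / \<phi> s t - Q s t * (\<psi> t)\<^sup>2 * (exp (- (2 * s * m t)) * Q s t) / (\<phi> s t)\<^sup>2"
  have hi: "(?D has_integral Q s q * (\<psi> q)\<^sup>2 / \<phi> s q - Q s p * (\<psi> p)\<^sup>2 / \<phi> s p) {p..q}"
  proof (rule fundamental_theorem_of_calculus[OF \<open>p \<le> q\<close>])
    fix t assume t: "t \<in> {p..q}"
    have d1: "(\<phi> s has_real_derivative exp (- (2 * s * m t)) * Q s t) (at t within {p..q})"
      and d2: "(Q s has_real_derivative (c t - lam s) * exp (2 * s * m t) * \<phi> s t) (at t within {p..q})"
      using deriv_\<phi>[OF assms(1), of t] deriv_Q[OF assms(1), of t] t sub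
      by (auto intro: has_field_derivative_subset)
    have nz: "\<phi> s t \<noteq> 0" using pos[OF assms(1), of t] t sub by force
    have "((\<lambda>t. Q s t * (\<psi> t)\<^sup>2 / \<phi> s t) has_real_derivative ?D t) (at t within {p..q})"
      using nz by (auto intro!: derivative_eq_intros d1 d2 d[OF t] simp: field_simps power2_eq_square)
    then show "((\<lambda>t. Q s t * (\<psi> t)\<^sup>2 / \<phi> s t) has_vector_derivative ?D t) (at t within {p..q})"
      by (simp add: has_real_derivative_iff_has_vector_derivative)
  qed
  have "integral {p..q} ?D
    \<le> integral {p..q} (\<lambda>t. exp (2 * s * m t) * ((\<psi>' t)\<^sup>2 + (c t - lam s) * (\<psi> t)\<^sup>2))"
  proof (rule integral_le)
    show "?D integrable_on {p..q}" using hi by blast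
    show "(\<lambda>t. exp (2 * s * m t) * ((\<psi>' t)\<^sup>2 + (c t - lam s) * (\<psi> t)\<^sup>2)) integrable_on {p..q}"
      by (intro integrable_continuous_real continuous_intros continuous_on_subset[OF m_cont sub]
          continuous_on_subset[OF c_cont sub] \<psi> \<psi>')
  next
    fix t assume t: "t \<in> {p..q}"
    have nz: "\<phi> s t \<noteq> 0" using pos[OF assms(1), of t] t sub by force
    define E where "E = exp (2 * s * m t)"
    have E: "E > 0" "exp (- (2 * s * m t)) = 1 / E" by (auto simp: E_def exp_minus divide_inverse)
    \<comment> \<open>The deficit is E times the square of \<psi>' - \<psi> \<phi>' / \<phi>, since
      \<phi>' = Q / E.\<close>
    have "E * ((\<psi>' t)\<^sup>2 + (c t - lam s) * (\<psi> t)\<^sup>2) - ?D t = E * (\<psi>' t - \<psi> t * Q s t / (E * \<phi> s t))\<^sup>2"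
    proof -
      have "?D t = (c t - lam s) * E * (\<psi> t)\<^sup>2 + Q s t * (2 * \<psi> t * \<psi>' t) / \<phi> s t
          - Q s t * (\<psi> t)\<^sup>2 * (1 / E * Q s t) / (\<phi> s t)\<^sup>2"
        by (simp only: E(2) E_def[symmetric])
      then show ?thesis
        using nz E(1) by (simp only: E_def[symmetric]) (simp add: field_simps power2_eq_square)
    qed
    also have "\<dots> \<ge> 0" using E by simp
    finally show "?D t \<le> exp (2 * s * m t) * ((\<psi>' t)\<^sup>2 + (c t - lam s) * (\<psi> t)\<^sup>2)"
      by (simp add: E_def)
  qed
  then show ?thesis using integral_unique[OF hi] by simp
qed

text \<open>Picone with the affine cutoff that is 1 at b and 0 at y. The term at y disappears, and
  relative to the weight at b the energy of the cutoff tends to 0 because m drops.\<close>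

lemma flux_falling:
  assumes "0 \<le> b" "rises_right (\<lambda>t. - m t) b"
  shows "\<exists>\<rho>. (\<rho> \<longlongrightarrow> 0) at_top \<and> (\<forall>s>0. - \<rho> s \<le> Q s b / (exp (2 * s * m b) * \<phi> s b))"
proof -
  obtain y where y: "b < y" "y \<le> 1" "mono_on {b..y} (\<lambda>t. - m t)"
    "\<And>t. t \<in> {b<..y} \<Longrightarrow> - m b < - m t"
    using assms by (auto simp: rises_right_def)
  have sub: "{b..y} \<subseteq> {0..1}" using y assms by auto
  \<comment> \<open>The first summand is the squared slope of the cutoff; K bounds
    \<open>(c - lam) * \<psi>^2\<close>.\<close>
  define M where "M = 1 / (y - b)\<^sup>2 + K"
  let ?I = "\<lambda>s. integral {b..y} (\<lambda>t. exp (- (2 * s * (- m t - - m b))))"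
  have mc: "continuous_on {b..y} m" by (rule continuous_on_subset[OF m_cont sub])
  have "((\<lambda>s. M * ?I s) \<longlongrightarrow> M * 0) at_top"
    by (intro tendsto_intros exp_integral_vanishes y(4) continuous_intros mc)
  moreover have "- (M * ?I s) \<le> Q s b / (exp (2 * s * m b) * \<phi> s b)" if "s > 0" for s
  proof -
    define \<psi> where "\<psi> t = (y - t) / (y - b)" for t
    have "(\<psi> has_real_derivative - 1 / (y - b)) (at t within {b..y})" for t
    proof -
      have "((\<lambda>t. (y - t) * (1 / (y - b))) has_real_derivative (0 - 1) * (1 / (y - b)))
          (at t within {b..y})"
        by (rule DERIV_cmult_right) (auto intro!: derivative_eq_intros)
      then show ?thesis by (simp add: \<psi>_def[abs_def])
    qed
    then have "Q s y * (\<psi> y)\<^sup>2 / \<phi> s y - Q s b * (\<psi> b)\<^sup>2 / \<phi> s b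
      \<le> integral {b..y} (\<lambda>t. exp (2 * s * m t) * ((- 1 / (y - b))\<^sup>2 + (c t - lam s) * (\<psi> t)\<^sup>2))"
      by (intro picone) (use that assms y in auto)
    also have "\<dots> \<le> integral {b..y} (\<lambda>t. exp (2 * s * m b) * (M * exp (- (2 * s * (- m t - - m b)))))"
    proof (rule integral_le)
      fix t assume t: "t \<in> {b..y}"
      have "\<psi> t \<ge> 0" "\<psi> t \<le> 1" using t y by (auto simp: \<psi>_def)
      then have "(\<psi> t)\<^sup>2 \<le> 1" by (simp add: power_le_one)
      moreover have "\<bar>c t - lam s\<bar> \<le> K" using cK[OF that, of t] t sub by auto
      ultimately have "(c t - lam s) * (\<psi> t)\<^sup>2 \<le> K * 1"
        by (intro mult_mono) (use K1 in auto)
      then have "(- 1 / (y - b))\<^sup>2 + (c t - lam s) * (\<psi> t)\<^sup>2 \<le> M"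
        by (simp add: M_def power_divide)
      then have "exp (2 * s * m t) * ((- 1 / (y - b))\<^sup>2 + (c t - lam s) * (\<psi> t)\<^sup>2) \<le> exp (2 * s * m t) * M"
        by simp
      also have "\<dots> = exp (2 * s * m b) * (M * exp (- (2 * s * (- m t - - m b))))"
        by (simp add: algebra_simps flip: exp_add)
      finally show "exp (2 * s * m t) * ((- 1 / (y - b))\<^sup>2 + (c t - lam s) * (\<psi> t)\<^sup>2)
          \<le> exp (2 * s * m b) * (M * exp (- (2 * s * (- m t - - m b))))" .
    next
      have c2: "continuous_on {b..y} c" by (rule continuous_on_subset[OF c_cont sub])
      show "(\<lambda>t. exp (2 * s * m t) * ((- 1 / (y - b))\<^sup>2 + (c t - lam s) * (\<psi> t)\<^sup>2)) integrable_on {b..y}"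
        unfolding \<psi>_def using y by (intro integrable_continuous_real continuous_intros mc c2) auto
      show "(\<lambda>t. exp (2 * s * m b) * (M * exp (- (2 * s * (- m t - - m b))))) integrable_on {b..y}"
        by (intro integrable_continuous_real continuous_intros mc)
    qed
    also have "\<dots> = exp (2 * s * m b) * (M * ?I s)" by simp
    finally have "- (exp (2 * s * m b) * (M * ?I s)) \<le> Q s b / \<phi> s b"
      using y by (simp add: \<psi>_def)
    then have "- (exp (2 * s * m b) * (M * ?I s)) / exp (2 * s * m b) \<le> Q s b / \<phi> s b / exp (2 * s * m b)"
      by (rule divide_right_mono) simp
    then show ?thesis by (simp add: field_simps)
  qed
  ultimately show ?thesis by (intro exI[of _ "\<lambda>s. M * ?I s"]) auto
qed

text \<open>Three ways for the end term to be harmless: no flux at 1, a test function that vanishes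
  at b, or a potential that falls beyond b.\<close>

lemma flux_right_end:
  assumes "0 \<le> b" "right_end m b i" "bc i u v"
  shows "\<exists>\<rho>. (\<rho> \<longlongrightarrow> 0) at_top \<and> (\<forall>s>0. - \<rho> s \<le> Q s b * u\<^sup>2 / (exp (2 * s * m b) * \<phi> s b))"
proof -
  consider "b = 1" | "u = 0" | "rises_right (\<lambda>t. - m t) b"
    using assms(2,3) by (auto simp: right_end_def bc_def)
  then show ?thesis
  proof cases
    case 3
    then obtain \<rho> where \<rho>: "(\<rho> \<longlongrightarrow> 0) at_top" "\<forall>s>0. - \<rho> s \<le> Q s b / (exp (2 * s * m b) * \<phi> s b)"
      using flux_falling assms(1) by blast
    have "((\<lambda>s. \<rho> s * u\<^sup>2) \<longlongrightarrow> 0 * u\<^sup>2) at_top" by (intro tendsto_intros \<rho>)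
    moreover have "- (\<rho> s * u\<^sup>2) \<le> Q s b * u\<^sup>2 / (exp (2 * s * m b) * \<phi> s b)" if "s > 0" for s
      using mult_right_mono[of "- \<rho> s" "Q s b / (exp (2 * s * m b) * \<phi> s b)" "u\<^sup>2"] \<rho>(2) that by simp
    ultimately show ?thesis by (intro exI[of _ "\<lambda>s. \<rho> s * u\<^sup>2"]) simp
  qed (use Q1 in \<open>auto intro!: exI[of _ "\<lambda>_. 0"]\<close>)
qed

text \<open>The solution u is its own test function: the weight is constant on the segment, and the
  energy of u at level L integrates to 0 because \<open>u * v\<close> vanishes at both ends. Picone
  then leaves \<open>(lam s - L)\<close> times the mass of u against end fluxes that tend to
  0.\<close>

lemma lam_le_segment_value:
  assumes ab: "0 \<le> a" "a < b" "b \<le> 1" and flat: "\<And>t. t \<in> {a..b} \<Longrightarrow> m t = m a"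
    and du: "\<And>t. t \<in> {a..b} \<Longrightarrow> (u has_real_derivative v t) (at t within {a..b})"
    and dv: "\<And>t. t \<in> {a..b} \<Longrightarrow> (v has_real_derivative (c t - L) * u t) (at t within {a..b})"
    and ends: "right_end (\<lambda>x. m (1 - x)) (1 - a) i" "right_end m b j"
    and bcs: "bc i (u a) (v a)" "bc j (u b) (v b)"
    and nz: "integral {a..b} (\<lambda>x. (u x)\<^sup>2) > 0" and "\<epsilon> > 0"
  shows "\<forall>\<^sub>F s in at_top. lam s < L + \<epsilon>"
proof -
  interpret mir: neumann_family "\<lambda>x. m (1 - x)" "\<lambda>x. c (1 - x)" lam
    "\<lambda>s x. \<phi> s (1 - x)" "\<lambda>s x. - Q s (1 - x)" K by (rule mirror)
  let ?N = "integral {a..b} (\<lambda>x. (u x)\<^sup>2)"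
  have sub: "{a..b} \<subseteq> {0..1}" using ab by auto
  have cu: "continuous_on {a..b} u" and cv: "continuous_on {a..b} v"
    by (rule DERIV_continuous_on, erule du) (rule DERIV_continuous_on, erule dv)
  have cc: "continuous_on {a..b} c" by (rule continuous_on_subset[OF c_cont sub])
  obtain \<rho> where \<rho>: "(\<rho> \<longlongrightarrow> 0) at_top"
    "\<And>s. s > 0 \<Longrightarrow> - \<rho> s \<le> Q s b * (u b)\<^sup>2 / (exp (2 * s * m b) * \<phi> s b)"
    using flux_right_end[OF _ ends(2) bcs(2)] ab by auto
  have bci: "bc i (u a) (- v a)" using bcs(1) by (auto simp: bc_def split: bdry.splits)
  obtain \<rho>' where \<rho>': "(\<rho>' \<longlongrightarrow> 0) at_top"
    "\<And>s. s > 0 \<Longrightarrow> - \<rho>' s \<le> - Q s a * (u a)\<^sup>2 / (exp (2 * s * m a) * \<phi> s a)"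
    using mir.flux_right_end[OF _ ends(1) bci] ab by auto
  have zero: "((\<lambda>t. (v t)\<^sup>2 + (c t - L) * (u t)\<^sup>2) has_integral 0) {a..b}"
  proof -
    have "((\<lambda>t. (v t)\<^sup>2 + (c t - L) * (u t)\<^sup>2) has_integral u b * v b - u a * v a) {a..b}"
    proof (rule fundamental_theorem_of_calculus)
      fix t assume t: "t \<in> {a..b}"
      show "((\<lambda>t. u t * v t) has_vector_derivative (v t)\<^sup>2 + (c t - L) * (u t)\<^sup>2) (at t within {a..b})"
        using DERIV_mult[OF du[OF t] dv[OF t]]
        by (simp add: has_real_derivative_iff_has_vector_derivative power2_eq_square algebra_simps)
    qed (use ab in simp)
    moreover have "u b * v b = 0" "u a * v a = 0" using bcs by (auto simp: bc_def split: bdry.splits)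
    ultimately show ?thesis by simp
  qed
  have key: "(lam s - L) * ?N \<le> \<rho> s + \<rho>' s" if "s > 0" for s
  proof -
    have "Q s b * (u b)\<^sup>2 / \<phi> s b - Q s a * (u a)\<^sup>2 / \<phi> s a
      \<le> integral {a..b} (\<lambda>t. exp (2 * s * m t) * ((v t)\<^sup>2 + (c t - lam s) * (u t)\<^sup>2))"
      by (rule picone) (use that ab du cv in auto)
    also have "\<dots> = integral {a..b} (\<lambda>t. exp (2 * s * m a) * (((v t)\<^sup>2 + (c t - L) * (u t)\<^sup>2) - (lam s - L) * (u t)\<^sup>2))"
    proof (rule integral_cong)
      fix t assume "t \<in> {a..b}"
      then have "m t = m a" by (rule flat)
      then show "exp (2 * s * m t) * ((v t)\<^sup>2 + (c t - lam s) * (u t)\<^sup>2)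
          = exp (2 * s * m a) * (((v t)\<^sup>2 + (c t - L) * (u t)\<^sup>2) - (lam s - L) * (u t)\<^sup>2)"
        by (simp add: algebra_simps)
    qed
    also have "\<dots> = exp (2 * s * m a) * (0 - (lam s - L) * ?N)"
    proof -
      have "((\<lambda>t. (lam s - L) * (u t)\<^sup>2) has_integral (lam s - L) * ?N) {a..b}"
        by (intro has_integral_mult_right integrable_integral integrable_continuous_real continuous_intros cu)
      from has_integral_mult_right[OF has_integral_diff[OF zero this]] show ?thesis
        by (rule integral_unique)
    qed
    finally have "(Q s b * (u b)\<^sup>2 / \<phi> s b - Q s a * (u a)\<^sup>2 / \<phi> s a) / exp (2 * s * m a)
        \<le> exp (2 * s * m a) * (0 - (lam s - L) * ?N) / exp (2 * s * m a)"
      by (rule divide_right_mono) simp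
    then have "Q s b * (u b)\<^sup>2 / (exp (2 * s * m b) * \<phi> s b) - Q s a * (u a)\<^sup>2 / (exp (2 * s * m a) * \<phi> s a)
        \<le> - ((lam s - L) * ?N)"
      using flat[of b] ab by (simp add: diff_divide_distrib mult.commute)
    then show ?thesis using \<rho>(2)[OF that] \<rho>'(2)[OF that] by simp
  qed
  have "((\<lambda>s. \<rho> s + \<rho>' s) \<longlongrightarrow> 0 + 0) at_top" by (intro tendsto_intros \<rho> \<rho>')
  then have "\<forall>\<^sub>F s in at_top. \<rho> s + \<rho>' s < \<epsilon> * ?N"
    using nz \<open>\<epsilon> > 0\<close> by (intro order_tendstoD(2)) auto
  then show ?thesis using eventually_gt_at_top[of 0]
  proof eventually_elim
    case (elim s)
    then have "(lam s - L) * ?N < \<epsilon> * ?N" using key[of s] by linarith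
    then show ?case using nz by simp
  qed
qed

end

section \<open>Linear equations on a segment\<close>

lemma derivative_nonneg_imp_le:
  fixes f :: "real \<Rightarrow> real"
  assumes "a \<le> b" and d: "\<And>t. t \<in> {a..b} \<Longrightarrow> (f has_real_derivative f' t) (at t within {a..b})"
    and nonneg: "\<And>t. t \<in> {a<..<b} \<Longrightarrow> f' t \<ge> 0"
  shows "f a \<le> f b"
proof (rule DERIV_nonneg_imp_increasing_open[OF \<open>a \<le> b\<close>])
  fix x assume "a < x" "x < b"
  then show "\<exists>y. (f has_real_derivative y) (at x) \<and> y \<ge> 0"
    using d[of x] nonneg[of x] by (auto simp: at_within_Icc_at)
qed (rule DERIV_continuous_on, erule d)

lemma derivative_pos_imp_less:
  fixes f :: "real \<Rightarrow> real"
  assumes "a < b" and d: "\<And>t. t \<in> {a..b} \<Longrightarrow> (f has_real_derivative f' t) (at t within {a..b})"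
    and pos: "\<And>t. t \<in> {a<..<b} \<Longrightarrow> f' t > 0"
  shows "f a < f b"
proof (rule DERIV_pos_imp_increasing_open[OF \<open>a < b\<close>])
  fix x assume "a < x" "x < b"
  then show "\<exists>y. (f has_real_derivative y) (at x) \<and> y > 0"
    using d[of x] pos[of x] by (auto simp: at_within_Icc_at)
qed (rule DERIV_continuous_on, erule d)

text \<open>Gronwall for the squared norm, with \<open>\<eta>^2\<close> added so that the source is
  absorbed. In the rate 2K + 1, the 2K pays for the cross terms
  \<open>(\<alpha> + \<beta>) * D * E\<close> and the 1 for \<open>2 * E * h\<close>.\<close>

lemma linear_system_growth:
  fixes D E \<alpha> \<beta> h :: "real \<Rightarrow> real"
  assumes dD: "\<And>t. t \<in> {a..b} \<Longrightarrow> (D has_real_derivative \<alpha> t * E t) (at t within {a..b})"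
    and dE: "\<And>t. t \<in> {a..b} \<Longrightarrow> (E has_real_derivative \<beta> t * D t + h t) (at t within {a..b})"
    and bd: "\<And>t. t \<in> {a..b} \<Longrightarrow> \<bar>\<alpha> t\<bar> \<le> K" "\<And>t. t \<in> {a..b} \<Longrightarrow> \<bar>\<beta> t\<bar> \<le> K"
      "\<And>t. t \<in> {a..b} \<Longrightarrow> \<bar>h t\<bar> \<le> \<eta>"
    and x: "x \<in> {a..b}"
  shows "(D x)\<^sup>2 + (E x)\<^sup>2 \<le> exp ((2 * K + 1) * (x - a)) * ((D a)\<^sup>2 + (E a)\<^sup>2 + \<eta>\<^sup>2)"
proof -
  define k where "k = 2 * K + 1"
  have K0: "K \<ge> 0" using bd(1)[OF x] by linarith
  define G where "G t = - (exp (- (k * t)) * ((D t)\<^sup>2 + (E t)\<^sup>2 + \<eta>\<^sup>2))" for t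
  define G' where "G' t = exp (- (k * t)) * (k * ((D t)\<^sup>2 + (E t)\<^sup>2 + \<eta>\<^sup>2)
    - (2 * (\<alpha> t + \<beta> t) * (D t * E t) + 2 * E t * h t))" for t
  have sub: "{a..x} \<subseteq> {a..b}" using x by auto
  have "G a \<le> G x"
  proof (rule derivative_nonneg_imp_le[where f = G and f' = G'])
    fix t assume t: "t \<in> {a..x}"
    have "(D has_real_derivative \<alpha> t * E t) (at t within {a..x})"
      "(E has_real_derivative \<beta> t * D t + h t) (at t within {a..x})"
      using dD[of t] dE[of t] t sub by (auto intro: has_field_derivative_subset)
    then show "(G has_real_derivative G' t) (at t within {a..x})"
      unfolding G_def[abs_def] G'_def
      by (auto intro!: derivative_eq_intros simp: algebra_simps power2_eq_square)
  next
    fix t assume "t \<in> {a<..<x}"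
    then have t: "t \<in> {a..b}" using sub by auto
    have DE: "2 * \<bar>D t * E t\<bar> \<le> (D t)\<^sup>2 + (E t)\<^sup>2"
      using sum_squares_bound[of "\<bar>D t\<bar>" "\<bar>E t\<bar>"] by (simp add: abs_mult)
    have "2 * (\<alpha> t + \<beta> t) * (D t * E t) \<le> \<bar>\<alpha> t + \<beta> t\<bar> * (2 * \<bar>D t * E t\<bar>)"
    proof -
      have "(\<alpha> t + \<beta> t) * (D t * E t) \<le> \<bar>\<alpha> t + \<beta> t\<bar> * \<bar>D t * E t\<bar>"
        by (metis abs_ge_self abs_mult)
      then show ?thesis by linarith
    qed
    also have "\<dots> \<le> (2 * K) * ((D t)\<^sup>2 + (E t)\<^sup>2)"
      using bd(1)[OF t] bd(2)[OF t] K0 DE by (intro mult_mono) auto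
    finally have 1: "2 * (\<alpha> t + \<beta> t) * (D t * E t) \<le> (2 * K) * ((D t)\<^sup>2 + (E t)\<^sup>2)" .
    have "(h t)\<^sup>2 \<le> \<eta>\<^sup>2" using bd(3)[OF t] by (metis abs_ge_zero power2_abs power_mono)
    then have 2: "2 * E t * h t \<le> (E t)\<^sup>2 + \<eta>\<^sup>2"
      using sum_squares_bound[of "E t" "h t"] by linarith
    have "0 \<le> (2 * K) * \<eta>\<^sup>2" using K0 by simp
    moreover have "k * ((D t)\<^sup>2 + (E t)\<^sup>2 + \<eta>\<^sup>2) = 2 * K * ((D t)\<^sup>2 + (E t)\<^sup>2) + 2 * K * \<eta>\<^sup>2
        + ((D t)\<^sup>2 + (E t)\<^sup>2 + \<eta>\<^sup>2)"
      by (simp add: k_def algebra_simps)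
    ultimately have "0 \<le> k * ((D t)\<^sup>2 + (E t)\<^sup>2 + \<eta>\<^sup>2)
        - (2 * (\<alpha> t + \<beta> t) * (D t * E t) + 2 * E t * h t)"
      using 1 2 zero_le_power2[of "D t"] by linarith
    then show "G' t \<ge> 0" by (simp add: G'_def)
  qed (use x in auto)
  then have "exp (- (k * x)) * ((D x)\<^sup>2 + (E x)\<^sup>2 + \<eta>\<^sup>2) \<le> exp (- (k * a)) * ((D a)\<^sup>2 + (E a)\<^sup>2 + \<eta>\<^sup>2)"
    by (simp add: G_def)
  then have "exp (k * x) * (exp (- (k * x)) * ((D x)\<^sup>2 + (E x)\<^sup>2 + \<eta>\<^sup>2))
      \<le> exp (k * x) * (exp (- (k * a)) * ((D a)\<^sup>2 + (E a)\<^sup>2 + \<eta>\<^sup>2))"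
    by (rule mult_left_mono) simp
  then have "(D x)\<^sup>2 + (E x)\<^sup>2 + \<eta>\<^sup>2 \<le> exp (k * (x - a)) * ((D a)\<^sup>2 + (E a)\<^sup>2 + \<eta>\<^sup>2)"
    by (simp only: mult.assoc[symmetric] exp_add[symmetric]) (simp add: right_diff_distrib)
  then show ?thesis using zero_le_power2[of \<eta>] unfolding k_def by linarith
qed

text \<open>With zero data and no source the growth bound is 0. To the left of \<open>x0\<close>
  time is reversed, and replacing E by - E restores the form of the system.\<close>

lemma linear_system_unique:
  fixes D E \<alpha> \<beta> :: "real \<Rightarrow> real"
  assumes dD: "\<And>t. t \<in> {a..b} \<Longrightarrow> (D has_real_derivative \<alpha> t * E t) (at t within {a..b})"
    and dE: "\<And>t. t \<in> {a..b} \<Longrightarrow> (E has_real_derivative \<beta> t * D t) (at t within {a..b})"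
    and bd: "\<And>t. t \<in> {a..b} \<Longrightarrow> \<bar>\<alpha> t\<bar> \<le> K" "\<And>t. t \<in> {a..b} \<Longrightarrow> \<bar>\<beta> t\<bar> \<le> K"
    and x0: "x0 \<in> {a..b}" "D x0 = 0" "E x0 = 0" and x: "x \<in> {a..b}"
  shows "D x = 0 \<and> E x = 0"
proof (cases "x0 \<le> x")
  case True
  have "(D x)\<^sup>2 + (E x)\<^sup>2 \<le> exp ((2 * K + 1) * (x - x0)) * ((D x0)\<^sup>2 + (E x0)\<^sup>2 + 0\<^sup>2)"
  proof (rule linear_system_growth[where h = "\<lambda>_. 0" and \<alpha> = \<alpha> and \<beta> = \<beta> and b = b])
    fix t assume "t \<in> {x0..b}"
    then show "(D has_real_derivative \<alpha> t * E t) (at t within {x0..b})"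
      "(E has_real_derivative \<beta> t * D t + 0) (at t within {x0..b})"
      using dD[of t] dE[of t] x0 by (auto intro: has_field_derivative_subset)
  qed (use bd x x0 True in auto)
  then show ?thesis using x0 by (simp add: sum_power2_le_zero_iff)
next
  case False
  have refl: "((\<lambda>t. f (- t)) has_real_derivative - d) (at t within {- x0..- a})"
    if "(f has_real_derivative d) (at (- t) within {a..b})" for f d t
  proof -
    have "(f has_real_derivative d) (at (- t) within uminus ` {- x0..- a})"
      by (rule has_field_derivative_subset[OF that]) (use x0 in auto)
    then have "((f \<circ> uminus) has_real_derivative d * (-1)) (at t within {- x0..- a})"
      by (intro DERIV_image_chain) (auto intro!: derivative_eq_intros)
    then show ?thesis by (simp add: o_def)
  qed
  have "(D (- (- x)))\<^sup>2 + (- E (- (- x)))\<^sup>2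
      \<le> exp ((2 * K + 1) * (- x - (- x0))) * ((D (- (- x0)))\<^sup>2 + (- E (- (- x0)))\<^sup>2 + 0\<^sup>2)"
  proof (rule linear_system_growth[where h = "\<lambda>_. 0" and \<alpha> = "\<lambda>t. \<alpha> (- t)" and \<beta> = "\<lambda>t. \<beta> (- t)"
        and b = "- a" and D = "\<lambda>t. D (- t)" and E = "\<lambda>t. - E (- t)"])
    fix t assume "t \<in> {- x0..- a}"
    then have t: "- t \<in> {a..b}" using x0 by auto
    show "((\<lambda>t. D (- t)) has_real_derivative \<alpha> (- t) * - E (- t)) (at t within {- x0..- a})"
      using refl[OF dD[OF t]] by simp
    show "((\<lambda>t. - E (- t)) has_real_derivative \<beta> (- t) * D (- t) + 0) (at t within {- x0..- a})"
      using DERIV_minus[OF refl[OF dE[OF t]]] by simp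
  qed (use bd x x0 False in auto)
  then show ?thesis using x0 by (simp add: sum_power2_le_zero_iff)
qed

section \<open>Solutions of \<open>u'' = (c - L) u\<close>: uniqueness, positivity, limits\<close>

definition solves :: "(real \<Rightarrow> real) \<Rightarrow> real \<Rightarrow> real \<Rightarrow> real \<Rightarrow> (real \<Rightarrow> real) \<Rightarrow> (real \<Rightarrow> real) \<Rightarrow> bool" where
  "solves c L a b u v \<longleftrightarrow> (\<forall>t\<in>{a..b}. (u has_real_derivative v t) (at t within {a..b}) \<and>
     (v has_real_derivative (c t - L) * u t) (at t within {a..b}))"

lemma solvesD:
  assumes "solves c L a b u v" "t \<in> {a..b}"
  shows "(u has_real_derivative v t) (at t within {a..b})"
    "(v has_real_derivative (c t - L) * u t) (at t within {a..b})"
  using assms by (auto simp: solves_def)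

lemma solves_continuous:
  assumes "solves c L a b u v" shows "continuous_on {a..b} u" "continuous_on {a..b} v"
  by (rule DERIV_continuous_on, erule solvesD[OF assms])+

lemma coefficient_bound:
  fixes c :: "real \<Rightarrow> real"
  assumes "continuous_on {a..b} c"
  obtains K where "K \<ge> 1" "\<And>t. t \<in> {a..b} \<Longrightarrow> \<bar>c t\<bar> \<le> K"
proof -
  have "bounded (c ` {a..b})"
    using assms by (intro compact_imp_bounded compact_continuous_image) auto
  then obtain B where "\<forall>t\<in>{a..b}. \<bar>c t\<bar> \<le> B" by (auto simp: bounded_iff)
  then show ?thesis by (intro that[of "max B 1"]) force+
qed

lemma solves_unique:
  assumes c: "continuous_on {a..b} c" and s: "solves c L a b u v"
    and x0: "x0 \<in> {a..b}" "u x0 = 0" "v x0 = 0" and x: "x \<in> {a..b}"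
  shows "u x = 0 \<and> v x = 0"
proof -
  have "continuous_on {a..b} (\<lambda>t. c t - L)" by (intro continuous_intros c)
  then obtain K where K: "K \<ge> 1" "\<And>t. t \<in> {a..b} \<Longrightarrow> \<bar>c t - L\<bar> \<le> K"
    using coefficient_bound by metis
  show ?thesis
    by (rule linear_system_unique[where \<alpha> = "\<lambda>_. 1" and \<beta> = "\<lambda>t. c t - L" and K = K])
      (use K s x0 x in \<open>auto simp: solves_def\<close>)
qed

lemma solves_lincomb:
  assumes "solves c L a b u1 v1" "solves c L a b u2 v2"
  shows "solves c L a b (\<lambda>x. p * u1 x + q * u2 x) (\<lambda>x. p * v1 x + q * v2 x)"
  using assms unfolding solves_def
  by (auto intro!: derivative_eq_intros simp: algebra_simps)

text \<open>An interior zero of a nonnegative solution is a minimum, so u and v vanish there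
  together and uniqueness makes u trivial.\<close>

lemma solves_pos:
  assumes c: "continuous_on {a..b} c" and s: "solves c L a b u v"
    and nonneg: "\<And>x. x \<in> {a..b} \<Longrightarrow> u x \<ge> 0" and nz: "x1 \<in> {a..b}" "u x1 \<noteq> 0"
    and x: "x \<in> {a<..<b}"
  shows "u x > 0"
proof (rule ccontr)
  assume "\<not> u x > 0"
  then have u0: "u x = 0" using nonneg[of x] x by force
  have "(u has_real_derivative v x) (at x)"
    using solvesD(1)[OF s, of x] x by (simp add: at_within_Icc_at)
  then have "v x = 0"
  proof (rule DERIV_local_min)
    show "0 < min (x - a) (b - x)" using x by simp
    show "\<forall>y. \<bar>x - y\<bar> < min (x - a) (b - x) \<longrightarrow> u x \<le> u y"
      using u0 by (auto intro!: nonneg)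
  qed
  then show False using solves_unique[OF c s _ u0 _ nz(1)] x nz(2) by auto
qed

text \<open>The Wronskian has derivative \<open>(L2 - L1) * u1 * u2\<close>, of one strict sign if
  the values differ, while the common boundary conditions make it 0 at both ends.\<close>

lemma solves_principal_value_unique:
  assumes "a < b" and s1: "solves c L1 a b u1 v1" and s2: "solves c L2 a b u2 v2"
    and pos: "\<And>x. x \<in> {a<..<b} \<Longrightarrow> u1 x > 0" "\<And>x. x \<in> {a<..<b} \<Longrightarrow> u2 x > 0"
    and bcs: "bc i (u1 a) (v1 a)" "bc i (u2 a) (v2 a)" "bc j (u1 b) (v1 b)" "bc j (u2 b) (v2 b)"
  shows "L1 = L2"
proof -
  have le: "L2 \<le> L1" if s1: "solves c L1 a b u1 v1" and s2: "solves c L2 a b u2 v2"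
    and pos: "\<And>x. x \<in> {a<..<b} \<Longrightarrow> u1 x > 0" "\<And>x. x \<in> {a<..<b} \<Longrightarrow> u2 x > 0"
    and bcs: "bc i (u1 a) (v1 a)" "bc i (u2 a) (v2 a)" "bc j (u1 b) (v1 b)" "bc j (u2 b) (v2 b)"
    for L1 L2 u1 v1 u2 v2
  proof (rule ccontr)
    assume "\<not> L2 \<le> L1"
    define W where "W t = v1 t * u2 t - u1 t * v2 t" for t
    have "W a < W b"
    proof (rule derivative_pos_imp_less[OF \<open>a < b\<close>, where f' = "\<lambda>t. (L2 - L1) * (u1 t * u2 t)"])
      fix t assume "t \<in> {a..b}"
      then show "(W has_real_derivative (L2 - L1) * (u1 t * u2 t)) (at t within {a..b})"
        unfolding W_def[abs_def] using solvesD[OF s1] solvesD[OF s2]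
        by (auto intro!: derivative_eq_intros simp: algebra_simps)
    qed (use pos \<open>\<not> L2 \<le> L1\<close> in simp)
    moreover have "W a = 0" "W b = 0"
      using bcs by (auto simp: W_def bc_def split: bdry.splits)
    ultimately show False by simp
  qed
  show ?thesis
    using le[OF s1 s2 pos bcs] le[OF s2 s1 pos(2,1) bcs(2,1,4,3)] by simp
qed

text \<open>The condition at a leaves a one-dimensional space of initial data; the mass fixes the
  factor up to sign, nonnegativity fixes the sign. This identifies all subsequential limits of w on
  a segment.\<close>

lemma solves_normalized_unique:
  assumes "a < b" and c: "continuous_on {a..b} c"
    and s1: "solves c L a b u1 v1" and s2: "solves c L a b u2 v2"
    and nonneg: "\<And>x. x \<in> {a..b} \<Longrightarrow> u1 x \<ge> 0" "\<And>x. x \<in> {a..b} \<Longrightarrow> u2 x \<ge> 0"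
    and bcs: "bc i (u1 a) (v1 a)" "bc i (u2 a) (v2 a)"
    and mass: "integral {a..b} (\<lambda>x. (u1 x)\<^sup>2) = N" "integral {a..b} (\<lambda>x. (u2 x)\<^sup>2) = N" "N > 0"
    and x: "x \<in> {a..b}"
  shows "u1 x = u2 x \<and> v1 x = v2 x"
proof -
  have nz: "\<exists>z\<in>{a..b}. u z \<noteq> 0" if "integral {a..b} (\<lambda>x. (u x)\<^sup>2) = N" for u :: "real \<Rightarrow> real"
  proof (rule ccontr)
    assume "\<not> ?thesis"
    then have "integral {a..b} (\<lambda>x. (u x)\<^sup>2) = integral {a..b} (\<lambda>x. 0)"
      by (intro integral_cong) auto
    then show False using that \<open>N > 0\<close> by simp
  qed
  obtain z1 z2 where z: "z1 \<in> {a..b}" "u1 z1 \<noteq> 0" "z2 \<in> {a..b}" "u2 z2 \<noteq> 0"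
    using nz[OF mass(1)] nz[OF mass(2)] by blast
  have a: "a \<in> {a..b}" using \<open>a < b\<close> by simp
  have nz2: "u2 a \<noteq> 0 \<or> v2 a \<noteq> 0" using solves_unique[OF c s2 a _ _ z(3)] z(4) by blast
  have "\<exists>k. u1 a = k * u2 a \<and> v1 a = k * v2 a"
  proof (cases i)
    case Neumann
    then show ?thesis using bcs nz2 by (intro exI[of _ "u1 a / u2 a"]) (auto simp: bc_def)
  next
    case Dirichlet
    then show ?thesis using bcs nz2 by (intro exI[of _ "v1 a / v2 a"]) (auto simp: bc_def)
  qed
  then obtain k where k: "u1 a = k * u2 a" and k': "v1 a = k * v2 a" by blast
  have proportional: "u1 y = k * u2 y \<and> v1 y = k * v2 y" if "y \<in> {a..b}" for y
    using solves_unique[OF c solves_lincomb[OF s1 s2, of 1 "- k"] a _ _ that] k k' by simp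
  have "N = integral {a..b} (\<lambda>x. k\<^sup>2 * (u2 x)\<^sup>2)"
    unfolding mass(1)[symmetric] by (rule integral_cong) (simp add: proportional power_mult_distrib)
  also have "\<dots> = k\<^sup>2 * N" using mass(2) by simp
  finally have "k\<^sup>2 = 1" using \<open>N > 0\<close> by simp
  moreover have "k \<ge> 0"
  proof (rule ccontr)
    assume "\<not> k \<ge> 0"
    then have "k * u2 z2 < 0" using nonneg(2)[OF z(3)] z(4) by (simp add: mult_neg_pos)
    then show False using proportional[OF z(3)] nonneg(1)[OF z(3)] by simp
  qed
  ultimately have "k = 1" by (simp add: power2_eq_1_iff)
  then show ?thesis using proportional[OF x] by simp
qed

text \<open>Passes to the limit in the integrated form of the derivative and differentiates the
  resulting integral.\<close>

lemma uniform_limit_imp_derivative: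
  fixes f f' :: "nat \<Rightarrow> real \<Rightarrow> real"
  assumes d: "\<And>n t. t \<in> {a..b} \<Longrightarrow> (f n has_real_derivative f' n t) (at t within {a..b})"
    and c: "\<And>n. continuous_on {a..b} (f' n)"
    and lim: "\<And>t. t \<in> {a..b} \<Longrightarrow> (\<lambda>n. f n t) \<longlonglongrightarrow> h t" and lim': "uniform_limit {a..b} f' h' sequentially"
    and t: "t \<in> {a..b}"
  shows "(h has_real_derivative h' t) (at t within {a..b})"
proof -
  have ch': "continuous_on {a..b} h'"
    by (rule uniform_limit_theorem[OF _ lim']) (use c in auto)
  have h: "h x = h a + integral {a..x} h'" if x: "x \<in> {a..b}" for x
  proof -
    have sub: "{a..x} \<subseteq> {a..b}" using x by auto
    obtain I J where IJ: "\<And>n. (f' n has_integral I n) {a..x}" "(h' has_integral J) {a..x}" "I \<longlonglongrightarrow> J"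
      using uniform_limit_integral[OF uniform_limit_on_subset[OF lim' sub] continuous_on_subset[OF c sub]]
      by (auto simp: trivial_limit_sequentially)
    have "(f' n has_integral f n x - f n a) {a..x}" for n
      using x has_field_derivative_subset[OF d sub]
      by (intro fundamental_theorem_of_calculus)
        (auto simp: has_real_derivative_iff_has_vector_derivative[symmetric])
    then have "I = (\<lambda>n. f n x - f n a)" using IJ(1) has_integral_unique by blast
    then have "(\<lambda>n. f n x - f n a) \<longlonglongrightarrow> J" using IJ(3) by simp
    moreover have "(\<lambda>n. f n x - f n a) \<longlonglongrightarrow> h x - h a"
      using x by (intro tendsto_diff lim) auto
    ultimately have "J = h x - h a" by (rule LIMSEQ_unique)
    then show ?thesis using integral_unique[OF IJ(2)] by simp
  qed
  have "((\<lambda>x. h a + integral {a..x} h') has_real_derivative 0 + h' t) (at t within {a..b})"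
    by (intro DERIV_add DERIV_const integral_has_real_derivative ch' t)
  then have "((\<lambda>x. h a + integral {a..x} h') has_real_derivative h' t) (at t within {a..b})"
    by simp
  then show ?thesis
    by (rule has_field_derivative_transform_within[OF _ zero_less_one t]) (rule h[symmetric])
qed

lemma uniform_limit_Cauchy_bound:
  fixes f :: "nat \<Rightarrow> 'a \<Rightarrow> real" and B :: "nat \<Rightarrow> nat \<Rightarrow> real"
  assumes le: "\<And>i j x. x \<in> S \<Longrightarrow> (f i x - f j x)\<^sup>2 \<le> B i j"
    and B: "\<And>e. e > 0 \<Longrightarrow> \<exists>N. \<forall>i\<ge>N. \<forall>j\<ge>N. B i j < e"
  shows "\<exists>h. uniform_limit S f h sequentially"
proof -
  have "uniformly_Cauchy_on S f"
  proof (rule uniformly_Cauchy_onI)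
    fix e :: real assume "e > 0"
    then obtain N where N: "\<forall>i\<ge>N. \<forall>j\<ge>N. B i j < e\<^sup>2" using B[of "e\<^sup>2"] by auto
    show "\<exists>M. \<forall>x\<in>S. \<forall>m\<ge>M. \<forall>n\<ge>M. dist (f m x) (f n x) < e"
    proof (intro exI[of _ N] ballI allI impI)
      fix x m n assume "x \<in> S" "m \<ge> N" "n \<ge> N"
      then have "(f m x - f n x)\<^sup>2 < e\<^sup>2" using le[of x m n] N by (meson order.strict_trans1)
      then show "dist (f m x) (f n x) < e"
        using \<open>e > 0\<close> unfolding dist_real_def by (intro power2_less_imp_less[of _ e]) auto
    qed
  qed
  then show ?thesis
    using Cauchy_uniformly_convergent uniformly_convergent_uniform_limit_iff by blast
qed

text \<open>Continuous dependence on data: two members differ by a solution with source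
  \<open>(L j - L i) * u j\<close>, so the growth lemma makes u and v uniformly Cauchy once the data
  at a and the values L converge.\<close>

lemma solves_limit:
  assumes "a < b" and c: "continuous_on {a..b} c"
    and s: "\<And>n. solves c (L n) a b (u n) (v n)"
    and L: "L \<longlonglongrightarrow> l" and ua: "(\<lambda>n. u n a) \<longlonglongrightarrow> \<alpha>" and va: "(\<lambda>n. v n a) \<longlonglongrightarrow> \<beta>"
  shows "\<exists>U V. solves c l a b U V \<and> uniform_limit {a..b} u U sequentially \<and>
    uniform_limit {a..b} v V sequentially"
proof -
  obtain Kc where Kc: "Kc \<ge> 1" "\<And>t. t \<in> {a..b} \<Longrightarrow> \<bar>c t\<bar> \<le> Kc" using coefficient_bound[OF c] by metis
  obtain KL where KL: "\<And>n. \<bar>L n\<bar> \<le> KL"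
    using convergent_imp_Bseq[of L] L by (auto simp: convergent_def Bseq_def)
  define K where "K = Kc + KL"
  have K: "\<bar>c t - L n\<bar> \<le> K" "1 \<le> K" if "t \<in> {a..b}" for t n
    using Kc(1) Kc(2)[OF that] KL[of n] unfolding K_def by linarith+
  have K': "\<bar>1 :: real\<bar> \<le> K" using Kc(1) KL[of 0] unfolding K_def by linarith
  define X where "X = exp ((2 * K + 1) * (b - a))"
  have X: "exp ((2 * K + 1) * (x - a)) \<le> X" if "x \<in> {a..b}" for x
    unfolding X_def using that K' by (auto intro!: mult_left_mono)
  have X0: "X > 0" by (simp add: X_def)
  obtain M where M: "\<And>n. (u n a)\<^sup>2 + (v n a)\<^sup>2 \<le> M"
  proof -
    have "convergent (\<lambda>n. (u n a)\<^sup>2 + (v n a)\<^sup>2)"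
      unfolding convergent_def using tendsto_add[OF tendsto_power[OF ua] tendsto_power[OF va]] by blast
    then obtain M where "\<forall>n. norm ((u n a)\<^sup>2 + (v n a)\<^sup>2) \<le> M"
      by (blast dest: convergent_imp_Bseq BseqD)
    then show ?thesis by (intro that[of M]) (metis abs_ge_self order_trans real_norm_def)
  qed
  have bound: "(u n x)\<^sup>2 + (v n x)\<^sup>2 \<le> X * M" if x: "x \<in> {a..b}" for n x
  proof -
    have "(u n x)\<^sup>2 + (v n x)\<^sup>2 \<le> exp ((2 * K + 1) * (x - a)) * ((u n a)\<^sup>2 + (v n a)\<^sup>2 + 0\<^sup>2)"
      by (rule linear_system_growth[where h = "\<lambda>_. 0" and \<alpha> = "\<lambda>_. 1" and \<beta> = "\<lambda>t. c t - L n" and b = b])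
        (use s[of n] K K' x in \<open>auto simp: solves_def\<close>)
    also have "\<dots> \<le> X * M"
      using X[OF x] M[of n] X0 by (intro mult_mono) auto
    finally show ?thesis .
  qed
  have ub: "\<bar>u n x\<bar> \<le> sqrt (X * M)" if "x \<in> {a..b}" for n x
  proof (rule real_le_rsqrt)
    show "\<bar>u n x\<bar>\<^sup>2 \<le> X * M"
      using bound[OF that, of n] zero_le_power2[of "v n x"] unfolding power2_abs by linarith
  qed
  \<comment> \<open>The growth bound for a difference; the last square is the size of the source,
    \<open>sqrt (X * M)\<close> being a bound for every u.\<close>
  define B where "B i j = X * ((u i a - u j a)\<^sup>2 + (v i a - v j a)\<^sup>2 + (\<bar>L j - L i\<bar> * sqrt (X * M))\<^sup>2)" for i j
  have diff: "(u i x - u j x)\<^sup>2 + (v i x - v j x)\<^sup>2 \<le> B i j" if x: "x \<in> {a..b}" for i j x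
  proof -
    have "(u i x - u j x)\<^sup>2 + (v i x - v j x)\<^sup>2 \<le> exp ((2 * K + 1) * (x - a)) *
      ((u i a - u j a)\<^sup>2 + (v i a - v j a)\<^sup>2 + (\<bar>L j - L i\<bar> * sqrt (X * M))\<^sup>2)"
    proof (rule linear_system_growth[where h = "\<lambda>t. (L j - L i) * u j t" and \<alpha> = "\<lambda>_. 1"
          and \<beta> = "\<lambda>t. c t - L i" and b = b])
      fix t assume t: "t \<in> {a..b}"
      show "((\<lambda>x. u i x - u j x) has_real_derivative 1 * (v i t - v j t)) (at t within {a..b})"
        using DERIV_diff[OF solvesD(1)[OF s t] solvesD(1)[OF s t]] by simp
      show "((\<lambda>x. v i x - v j x) has_real_derivative
          (c t - L i) * (u i t - u j t) + (L j - L i) * u j t) (at t within {a..b})"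
        using DERIV_diff[OF solvesD(2)[OF s t] solvesD(2)[OF s t], of i j] by (simp add: algebra_simps)
      show "\<bar>(L j - L i) * u j t\<bar> \<le> \<bar>L j - L i\<bar> * sqrt (X * M)"
        using ub[OF t] by (simp add: abs_mult mult_left_mono)
    qed (use K K' x in auto)
    also have "\<dots> \<le> B i j" unfolding B_def using X[OF x] by (intro mult_right_mono) auto
    finally show ?thesis .
  qed
  have Bsmall: "\<exists>N. \<forall>i\<ge>N. \<forall>j\<ge>N. B i j < e" if "e > 0" for e
  proof -
    have "((\<lambda>(i, j). B i j) \<longlongrightarrow> X * ((\<alpha> - \<alpha>)\<^sup>2 + (\<beta> - \<beta>)\<^sup>2 + (\<bar>l - l\<bar> * sqrt (X * M))\<^sup>2)) (sequentially \<times>\<^sub>F sequentially)"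
      unfolding B_def split_def
      by (intro tendsto_intros filterlim_compose[OF ua] filterlim_compose[OF va] filterlim_compose[OF L]
          filterlim_fst filterlim_snd)
    then have "\<forall>\<^sub>F p in sequentially \<times>\<^sub>F sequentially. (\<lambda>(i, j). B i j) p < e"
      using that by (intro order_tendstoD(2)) auto
    then show ?thesis
      unfolding eventually_prod_sequentially by auto
  qed
  have "(u i x - u j x)\<^sup>2 \<le> B i j" "(v i x - v j x)\<^sup>2 \<le> B i j" if "x \<in> {a..b}" for i j x
    using diff[OF that, of i j] zero_le_power2[of "u i x - u j x"] zero_le_power2[of "v i x - v j x"]
    by linarith+
  then obtain U V where U: "uniform_limit {a..b} u U sequentially" and V: "uniform_limit {a..b} v V sequentially"
    using uniform_limit_Cauchy_bound[of "{a..b}" u B] uniform_limit_Cauchy_bound[of "{a..b}" v B] Bsmall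
    by blast
  have W: "uniform_limit {a..b} (\<lambda>n t. (c t - L n) * u n t) (\<lambda>t. (c t - l) * U t) sequentially"
  proof (rule uniform_lim_mult)
    show "uniform_limit {a..b} (\<lambda>n t. c t - L n) (\<lambda>t. c t - l) sequentially"
      using L by (auto simp: uniform_limit_iff dist_real_def tendsto_iff abs_minus_commute)
    have "continuous_on {a..b} U"
      by (rule uniform_limit_theorem[OF _ U]) (use solves_continuous[OF s] in auto)
    then show "bounded (U ` {a..b})"
      by (intro compact_imp_bounded compact_continuous_image) auto
    have "continuous_on {a..b} (\<lambda>t. c t - l)" by (intro continuous_intros c)
    then show "bounded ((\<lambda>t. c t - l) ` {a..b})"
      by (intro compact_imp_bounded compact_continuous_image) auto
  qed (rule U)
  have "solves c l a b U V"
    unfolding solves_def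
  proof (intro ballI conjI)
    fix t assume t: "t \<in> {a..b}"
    show "(U has_real_derivative V t) (at t within {a..b})"
      by (rule uniform_limit_imp_derivative[where f = u and f' = v, OF _ _ _ V t])
        (use solvesD(1)[OF s] solves_continuous[OF s] tendsto_uniform_limitI[OF U] in auto)
    show "(V has_real_derivative (c t - l) * U t) (at t within {a..b})"
      by (rule uniform_limit_imp_derivative[where f = v, OF _ _ _ W t])
        (use solvesD(2)[OF s] solves_continuous[OF s] tendsto_uniform_limitI[OF V] c
          in \<open>auto intro!: continuous_intros\<close>)
  qed
  then show ?thesis using U V by blast
qed

section \<open>The eigenvalue near isolated local maxima\<close>

lemma tendsto_via_subsequences:
  fixes X :: "nat \<Rightarrow> 'a::metric_space"
  assumes "\<And>r :: nat \<Rightarrow> nat. strict_mono r \<Longrightarrow>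
    \<exists>r' :: nat \<Rightarrow> nat. strict_mono r' \<and> (\<lambda>n. X (r (r' n))) \<longlonglongrightarrow> l"
  shows "X \<longlonglongrightarrow> l"
proof (rule ccontr)
  assume "\<not> X \<longlonglongrightarrow> l"
  then obtain e where e: "e > 0" "\<not> (\<forall>\<^sub>F n in sequentially. dist (X n) l < e)"
    by (auto simp: tendsto_iff)
  obtain r :: "nat \<Rightarrow> nat" where r: "strict_mono r" "\<And>n. \<not> dist (X (r n)) l < e"
    using not_eventually_sequentiallyD[OF e(2)] by blast
  obtain r' where "(\<lambda>n. X (r (r' n))) \<longlonglongrightarrow> l" using assms[OF r(1)] by blast
  then have "\<forall>\<^sub>F n in sequentially. dist (X (r (r' n))) l < e" using e(1) by (auto simp: tendsto_iff)
  then show False using r(2) by (auto dest: eventually_happens)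
qed

lemma M1_mirror: "x \<in> M1 m \<Longrightarrow> 1 - x \<in> M1 (\<lambda>t. m (1 - t))"
proof -
  assume x: "x \<in> M1 m"
  then obtain e where e: "e > 0" "\<And>y. y \<in> ({x - e<..<x + e} \<inter> {0..1}) - {x} \<Longrightarrow> m y < m x"
    by (auto simp: M1_def)
  have "m (1 - y) < m (1 - (1 - x))" if "y \<in> ({1 - x - e<..<1 - x + e} \<inter> {0..1}) - {1 - x}" for y
    using e(2)[of "1 - y"] that by auto
  moreover have "1 - x \<in> {0..1}" using x by (auto simp: M1_def)
  ultimately show ?thesis using e(1) unfolding M1_def by blast
qed

text \<open>Separates a zone where m is nearly maximal, in which the flux builds up, from a zone
  well below the peak, in which it is amplified, all inside a range where c is almost
  constant.\<close>

lemma M1_right_neighbourhood: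
  fixes m c :: "real \<Rightarrow> real"
  assumes m: "continuous_on {0..1} m" and c: "continuous_on {0..1} c"
    and x0: "x0 \<in> M1 m" "x0 < 1" and "k > 0"
  obtains \<theta> p q \<eta> where "0 < \<theta>" "x0 + \<theta> \<le> p" "p < q" "q \<le> 1" "\<eta> > 0"
    "\<And>t. t \<in> {x0..x0 + \<theta>} \<Longrightarrow> m x0 - \<eta> \<le> m t"
    "\<And>t. t \<in> {p..q} \<Longrightarrow> m t \<le> m x0 - 3 * \<eta>"
    "\<And>t. t \<in> {x0..q} \<Longrightarrow> \<bar>c t - c x0\<bar> \<le> k"
proof -
  have x01: "x0 \<in> {0..1}" using x0 by (auto simp: M1_def)
  obtain e where e: "e > 0" "\<And>y. y \<in> ({x0 - e<..<x0 + e} \<inter> {0..1}) - {x0} \<Longrightarrow> m y < m x0"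
    using x0 by (auto simp: M1_def)
  obtain d1 where d1: "d1 > 0" "\<And>y. y \<in> {0..1} \<Longrightarrow> dist y x0 < d1 \<Longrightarrow> dist (c y) (c x0) < k"
    using c x01 \<open>k > 0\<close> unfolding continuous_on_iff by metis
  define q where "q = x0 + min (min (e / 2) (d1 / 2)) (1 - x0)"
  define p where "p = (x0 + q) / 2"
  have pq: "x0 < p" "p < q" "q \<le> 1" "q < x0 + e" "q < x0 + d1"
    using e(1) d1(1) x0(2) by (auto simp: q_def p_def min_def)
  have "continuous_on {p..q} m"
    by (rule continuous_on_subset[OF m]) (use pq x01 in auto)
  then obtain z where z: "z \<in> {p..q}" "\<And>t. t \<in> {p..q} \<Longrightarrow> m t \<le> m z"
    using continuous_attains_sup[of "{p..q}" m] pq by auto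
  \<comment> \<open>A third of the drop puts the two zones at levels - \<eta> and - 3 \<eta>. The
    passage gains \<open>exp (4 * s * \<eta>)\<close> for \<phi>', and
    \<open>exp (s * \<eta>)\<close> for g relative to w at the peak; a lower level - 2 \<eta> would
    gain nothing in the second case.\<close>
  define \<eta> where "\<eta> = (m x0 - m z) / 3"
  have "m z < m x0" using z(1) pq x01 e(1) by (intro e(2)) auto
  then have \<eta>: "\<eta> > 0" by (simp add: \<eta>_def)
  obtain d2 where d2: "d2 > 0" "\<And>y. y \<in> {0..1} \<Longrightarrow> dist y x0 < d2 \<Longrightarrow> dist (m y) (m x0) < \<eta>"
    using m x01 \<eta> unfolding continuous_on_iff by metis
  define \<theta> where "\<theta> = min (d2 / 2) (p - x0)"
  show ?thesis
  proof (rule that[of \<theta> p q \<eta>])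
    show "0 < \<theta>" "x0 + \<theta> \<le> p" using d2(1) pq by (auto simp: \<theta>_def)
    show "m t \<le> m x0 - 3 * \<eta>" if "t \<in> {p..q}" for t using z(2)[OF that] by (simp add: \<eta>_def field_simps)
    show "m x0 - \<eta> \<le> m t" if "t \<in> {x0..x0 + \<theta>}" for t
      using d2(2)[of t] that d2(1) pq x01 by (auto simp: \<theta>_def dist_real_def min_def split: if_splits)
    show "\<bar>c t - c x0\<bar> \<le> k" if "t \<in> {x0..q}" for t
      using d1(2)[of t] that pq x01 by (auto simp: dist_real_def)
  qed (use pq \<eta> in auto)
qed

text \<open>Takes the longest flat stretch to the right of x, possibly x alone. Since there are
  finitely many monotone pieces, m leaves its level monotonically beyond the end of the
  stretch.\<close>

lemma right_end_extension:
  fixes m :: "real \<Rightarrow> real"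
  assumes m: "continuous_on {0..1} m" and x: "x \<in> {0..1}"
    and pieces: "finite P" "(\<Union>(a, b)\<in>P. {a..b}) = {0..1}"
      "\<forall>(a, b)\<in>P. mono_on {a..b} m \<or> mono_on {a..b} (\<lambda>x. - m x)"
  shows "\<exists>b j. x \<le> b \<and> b \<le> 1 \<and> (\<forall>t\<in>{x..b}. m t = m x) \<and> right_end m b j"
proof -
  define F where "F = {y\<in>{x..1}. \<forall>t\<in>{x..y}. m t = m x}"
  have xF: "x \<in> F" using x by (auto simp: F_def)
  have bF: "bdd_above F" by (auto simp: F_def intro: bdd_aboveI[of _ 1])
  define b where "b = Sup F"
  have xb: "x \<le> b" unfolding b_def by (rule cSup_upper[OF xF bF])
  have F1: "F \<subseteq> {x..1}" by (auto simp only: F_def)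
  have b1: "b \<le> 1" unfolding b_def by (rule cSup_least) (use xF F1 in auto)
  have below: "m t = m x" if "x \<le> t" "t < b" for t
  proof -
    have "F \<noteq> {}" using xF by blast
    have "\<exists>y\<in>F. t < y" by (rule less_cSupD[OF \<open>F \<noteq> {}\<close> that(2)[unfolded b_def]])
    then obtain y where y: "y \<in> F" "t < y" by (elim bexE)
    have "\<forall>t\<in>{x..y}. m t = m x" using y(1) unfolding F_def mem_Collect_eq by (rule conjunct2)
    moreover have "t \<in> {x..y}" using that(1) y(2) by simp
    ultimately show ?thesis by (rule bspec)
  qed
  have mb: "m b = m x"
  proof (cases "x = b")
    case False
    then have lt: "x < b" using xb by simp
    have "{x..b} \<subseteq> {0..1}" using x b1 by auto
    then have "continuous_on {x..b} m" using m continuous_on_subset by blast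
    then have "(m \<longlongrightarrow> m b) (at b within {x..b})" using lt by (auto simp: continuous_on_def)
    then have "(m \<longlongrightarrow> m b) (at_left b)" using lt by (simp add: at_within_Icc_at_left)
    moreover have "\<forall>\<^sub>F t in at_left b. m t = m x"
      using eventually_at_left_real[OF lt] by eventually_elim (rule below, auto)
    ultimately have "((\<lambda>_. m x) \<longlongrightarrow> m b) (at_left b)" using tendsto_cong by fast
    then show ?thesis by (simp add: tendsto_const_iff)
  qed simp
  have flat: "\<forall>t\<in>{x..b}. m t = m x"
  proof (intro ballI)
    fix t assume t: "t \<in> {x..b}"
    show "m t = m x"
    proof (cases "t = b")
      case False
      then show ?thesis using t by (intro below) auto
    qed (simp only: mb)
  qed
  have "\<exists>j. right_end m b j"
  proof (cases "b = 1")
    case False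
    then have b1': "b < 1" using b1 by simp
    \<comment> \<open>Up to the first break point beyond b only one piece is involved, so m is
      monotone on {b..y}; the 1 keeps the set of break points nonempty.\<close>
    define E where "E = {e \<in> fst ` P \<union> snd ` P \<union> {1}. b < e}"
    have E: "finite E" "1 \<in> E" using pieces(1) b1' by (auto simp: E_def)
    define y where "y = (b + Min E) / 2"
    have "Min E \<in> E" using E by (intro Min_in) auto
    then have ME: "b < Min E" "Min E \<le> 1" using E by (simp_all add: E_def)
    have y: "b < y" "y < Min E" "y \<le> 1" using ME by (auto simp: y_def)
    have "y \<in> {0..1}" using y x xb by auto
    then obtain a' b' where ab': "(a', b') \<in> P" "y \<in> {a'..b'}" using pieces(2) by blast
    have "a' \<le> b"
    proof (rule ccontr)
      assume "\<not> a' \<le> b"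
      then have "a' \<in> E" using ab' by (force simp: E_def)
      then have "Min E \<le> a'" using E(1) by simp
      then show False using y ab'(2) by simp
    qed
    then have sub: "{b..y} \<subseteq> {a'..b'}" using ab'(2) by auto
    have mono: "mono_on {b..y} m \<or> mono_on {b..y} (\<lambda>x. - m x)"
      using pieces(3) ab'(1) mono_on_subset[OF _ sub] by fast
    have ne: "m t \<noteq> m b" if t: "t \<in> {b<..y}" for t
    proof
      assume eq: "m t = m b"
      \<comment> \<open>A monotone function that returns to its level is constant in between, which
        would extend the flat stretch beyond its supremum.\<close>
      have "m r = m b" if "r \<in> {b..t}" for r
      proof -
        have "r \<in> {b..y}" "t \<in> {b..y}" "b \<in> {b..y}" "b \<le> r" "r \<le> t" using that t by auto
        then have "m b \<le> m r \<and> m r \<le> m t \<or> - m b \<le> - m r \<and> - m r \<le> - m t"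
          using mono unfolding mono_on_def by blast
        then show ?thesis using eq by linarith
      qed
      note const = this
      have "m r = m x" if "r \<in> {x..t}" for r
      proof (cases "r \<le> b")
        case True
        show ?thesis by (rule bspec[OF flat]) (use that True in simp)
      next
        case False
        show ?thesis by (rule trans[OF const mb]) (use that False in simp)
      qed
      moreover have "t \<in> {x..1}" using t y xb by auto
      ultimately have "t \<in> F" unfolding F_def by blast
      then have "t \<le> b" unfolding b_def by (rule cSup_upper[OF _ bF])
      then show False using t by simp
    qed
    show ?thesis using mono
    proof
      assume mo: "mono_on {b..y} m"
      have "m b < m t" if "t \<in> {b<..y}" for t
        using ne[OF that] mono_onD[OF mo, of b t] that y by auto
      then have "rises_right m b" using mo y unfolding rises_right_def by blast
      then show ?thesis by (auto simp: right_end_def)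
    next
      assume mo: "mono_on {b..y} (\<lambda>x. - m x)"
      have "- m b < - m t" if "t \<in> {b<..y}" for t
        using ne[OF that] mono_onD[OF mo, of b t] that y by auto
      then have "rises_right (\<lambda>t. - m t) b" using mo y unfolding rises_right_def by blast
      then show ?thesis by (auto simp: right_end_def)
    qed
  qed (auto simp: right_end_def)
  then show ?thesis using xb b1 flat by blast
qed

context neumann_family
begin

lemma mirror_w: "neumann_family.w (\<lambda>x. m (1 - x)) (\<lambda>s x. \<phi> s (1 - x)) s x = w s (1 - x)"
proof -
  interpret mir: neumann_family "\<lambda>x. m (1 - x)" "\<lambda>x. c (1 - x)" lam
    "\<lambda>s x. \<phi> s (1 - x)" "\<lambda>s x. - Q s (1 - x)" K by (rule mirror)
  show ?thesis by (simp add: mir.w_def w_def)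
qed

lemma mirror_g: "neumann_family.g (\<lambda>x. m (1 - x)) (\<lambda>s x. - Q s (1 - x)) s x = - g s (1 - x)"
proof -
  interpret mir: neumann_family "\<lambda>x. m (1 - x)" "\<lambda>x. c (1 - x)" lam
    "\<lambda>s x. \<phi> s (1 - x)" "\<lambda>s x. - Q s (1 - x)" K by (rule mirror)
  show ?thesis by (simp add: mir.g_def g_def)
qed

lemma deriv_sub:
  assumes "s > 0" "t \<in> {x..y}" "0 \<le> x" "y \<le> 1"
  shows "(\<phi> s has_real_derivative exp (- (2 * s * m t)) * Q s t) (at t within {x..y})"
    "(Q s has_real_derivative (c t - lam s) * exp (2 * s * m t) * \<phi> s t) (at t within {x..y})"
  by (rule has_field_derivative_subset[OF deriv_\<phi>] has_field_derivative_subset[OF deriv_Q];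
      use assms in auto)+

text \<open>
  If \<open>Q \<le> 0\<close> at the maximum and \<open>\<lambda>\<close> exceeds \<open>c\<close>, then \<open>\<phi>' = e\<^sup>-\<^sup>2\<^sup>s\<^sup>m Q\<close> becomes so negative beyond \<open>p\<close> that the
  positive function \<open>\<phi>\<close> would change sign.
\<close>

lemma no_high_value_right:
  assumes x0: "x0 \<in> M1 m" "x0 < 1" and "k > 0"
  shows "\<exists>S>0. \<forall>s\<ge>S. c x0 + 2 * k \<le> lam s \<longrightarrow> Q s x0 > 0"
proof -
  obtain \<theta> p q \<eta> where *: "0 < \<theta>" "x0 + \<theta> \<le> p" "p < q" "q \<le> 1" "\<eta> > 0"
    and m_top: "\<And>t. t \<in> {x0..x0 + \<theta>} \<Longrightarrow> m x0 - \<eta> \<le> m t"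
    and m_low: "\<And>t. t \<in> {p..q} \<Longrightarrow> m t \<le> m x0 - 3 * \<eta>"
    and c_near: "\<And>t. t \<in> {x0..q} \<Longrightarrow> \<bar>c t - c x0\<bar> \<le> k"
    using M1_right_neighbourhood[OF m_cont c_cont x0 \<open>k > 0\<close>] by metis
  have x00: "0 \<le> x0" using x0 by (auto simp: M1_def)
  \<comment> \<open>Chosen so that \<open>R * (q - p)\<close> reaches \<open>\<phi> s p\<close>
    below by means of \<open>4 * s * \<eta> \<le> exp (4 * s * \<eta>)\<close>.\<close>
  define S where "S = 1 / ((q - p) * k * \<theta> * (4 * \<eta>))"
  have S: "S > 0" using * \<open>k > 0\<close> by (simp add: S_def)
  have "Q s x0 > 0" if s: "s \<ge> S" and lam: "c x0 + 2 * k \<le> lam s" for s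
  proof (rule ccontr)
    assume neg: "\<not> Q s x0 > 0"
    have s0: "s > 0" using S s by simp
    have \<phi>pos: "\<phi> s t > 0" if "t \<in> {x0..q}" for t using pos[OF s0, of t] that x00 * by auto
    have coef: "c t - lam s \<le> - k" if "t \<in> {x0..q}" for t using c_near[OF that] lam by linarith
    have Q_dec: "Q s y \<le> Q s x" if "x0 \<le> x" "x \<le> y" "y \<le> q" for x y
    proof -
      have "- Q s x \<le> - Q s y"
      proof (rule derivative_nonneg_imp_le[OF that(2)])
        fix t assume t: "t \<in> {x..y}"
        show "((\<lambda>t. - Q s t) has_real_derivative - ((c t - lam s) * exp (2 * s * m t) * \<phi> s t))
            (at t within {x..y})"
          by (intro DERIV_minus deriv_sub) (use s0 t that x00 * in auto)
      next
        fix t assume "t \<in> {x<..<y}"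
        then have t: "t \<in> {x0..q}" using that by auto
        show "0 \<le> - ((c t - lam s) * exp (2 * s * m t) * \<phi> s t)"
          using coef[OF t] \<phi>pos[OF t] \<open>k > 0\<close> by (auto simp: mult_le_0_iff)
      qed
      then show ?thesis by simp
    qed
    have \<phi>_dec: "\<phi> s y \<le> \<phi> s x" if "x0 \<le> x" "x \<le> y" "y \<le> q" for x y
    proof -
      have "- \<phi> s x \<le> - \<phi> s y"
      proof (rule derivative_nonneg_imp_le[OF that(2)])
        fix t assume t: "t \<in> {x..y}"
        show "((\<lambda>t. - \<phi> s t) has_real_derivative - (exp (- (2 * s * m t)) * Q s t)) (at t within {x..y})"
          by (intro DERIV_minus deriv_sub) (use s0 t that x00 * in auto)
      next
        fix t assume "t \<in> {x<..<y}"
        then have "Q s t \<le> Q s x0" using that by (intro Q_dec) auto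
        then show "0 \<le> - (exp (- (2 * s * m t)) * Q s t)" using neg by (simp add: mult_le_0_iff)
      qed
      then show ?thesis by simp
    qed
    \<comment> \<open>A lower bound for - Q' near the peak: m is at least
      \<open>m x0 - \<eta>\<close> there, and \<phi>, being decreasing, is at least its value at
      p.\<close>
    define A where "A = k * exp (2 * s * (m x0 - \<eta>)) * \<phi> s p"
    have A: "A > 0" using \<open>k > 0\<close> \<phi>pos[of p] * by (simp add: A_def)
    have "- Q s x0 - A * x0 \<le> - Q s (x0 + \<theta>) - A * (x0 + \<theta>)"
    proof (rule derivative_nonneg_imp_le[where f = "\<lambda>t. - Q s t - A * t"])
      fix t assume t: "t \<in> {x0..x0 + \<theta>}"
      show "((\<lambda>t. - Q s t - A * t) has_real_derivative
          - ((c t - lam s) * exp (2 * s * m t) * \<phi> s t) - A) (at t within {x0..x0 + \<theta>})"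
        using deriv_sub(2)[OF s0 t] x00 * by (auto intro!: derivative_eq_intros)
    next
      fix t assume "t \<in> {x0<..<x0 + \<theta>}"
      then have t: "t \<in> {x0..x0 + \<theta>}" "t \<in> {x0..q}" "t \<le> p" using * by auto
      have "A \<le> (lam s - c t) * exp (2 * s * m t) * \<phi> s t"
        unfolding A_def
        using m_top[OF t(1)] coef[OF t(2)] \<phi>_dec[of t p] t * \<phi>pos[of p] \<open>k > 0\<close> s0
        by (intro mult_mono) auto
      then show "0 \<le> - ((c t - lam s) * exp (2 * s * m t) * \<phi> s t) - A"
        by (simp add: algebra_simps)
    qed (use * in simp)
    then have Qtheta: "Q s (x0 + \<theta>) \<le> - (A * \<theta>)" using neg by (simp add: algebra_simps)
    \<comment> \<open>A lower bound for - \<phi>' on {p..q}; the exponent is twice the gap 2 \<eta>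
      between the two levels of m.\<close>
    define R where "R = k * \<theta> * exp (4 * s * \<eta>) * \<phi> s p"
    have "- \<phi> s p - R * p \<le> - \<phi> s q - R * q"
    proof (rule derivative_nonneg_imp_le[where f = "\<lambda>t. - \<phi> s t - R * t"])
      fix t assume t: "t \<in> {p..q}"
      show "((\<lambda>t. - \<phi> s t - R * t) has_real_derivative - (exp (- (2 * s * m t)) * Q s t) - R)
          (at t within {p..q})"
        using deriv_sub(1)[OF s0 t] x00 * by (auto intro!: derivative_eq_intros)
    next
      fix t assume "t \<in> {p<..<q}"
      then have t: "t \<in> {p..q}" by auto
      have "Q s t \<le> Q s (x0 + \<theta>)" using t * by (intro Q_dec) auto
      then have Qt: "A * \<theta> \<le> - Q s t" using Qtheta by linarith
      have "R = exp (- (2 * s * (m x0 - 3 * \<eta>))) * (A * \<theta>)"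
        unfolding R_def A_def by (simp add: algebra_simps flip: exp_add)
      also have "\<dots> \<le> exp (- (2 * s * m t)) * - Q s t"
        using m_low[OF t] Qt s0 A * by (intro mult_mono) auto
      finally show "0 \<le> - (exp (- (2 * s * m t)) * Q s t) - R" by simp
    qed (use * in simp)
    moreover have "R * (q - p) \<ge> \<phi> s p"
    proof -
      have "1 \<le> (q - p) * k * \<theta> * (4 * \<eta>) * s"
        using s * \<open>k > 0\<close> by (simp add: S_def field_simps)
      also have "\<dots> \<le> (q - p) * k * \<theta> * exp (4 * s * \<eta>)"
      proof -
        have "4 * \<eta> * s \<le> exp (4 * s * \<eta>)" using exp_ge_add_one_self[of "4 * s * \<eta>"] by (simp only: mult_ac)
        then have "((q - p) * k * \<theta>) * (4 * \<eta> * s) \<le> ((q - p) * k * \<theta>) * exp (4 * s * \<eta>)"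
          using * \<open>k > 0\<close> by (intro mult_left_mono) auto
        then show ?thesis by (simp add: mult_ac)
      qed
      finally have "1 * \<phi> s p \<le> ((q - p) * k * \<theta> * exp (4 * s * \<eta>)) * \<phi> s p"
        using \<phi>pos[of p] * by (intro mult_right_mono) auto
      then show ?thesis by (simp add: R_def mult_ac)
    qed
    ultimately have "\<phi> s q \<le> 0" by (simp add: algebra_simps)
    then show False using \<phi>pos[of q] * by auto
  qed
  then show ?thesis using S by blast
qed

text \<open>If lam were too large, the flux at \<open>x0\<close> would be positive on account of the
  right side and negative on account of the left side; at an endpoint the one remaining side
  contradicts the Neumann condition.\<close>

lemma lam_le_M1_value:
  assumes x0: "x0 \<in> M1 m" and "\<epsilon> > 0"
  shows "\<forall>\<^sub>F s in at_top. lam s < c x0 + \<epsilon>"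
proof -
  interpret mir: neumann_family "\<lambda>x. m (1 - x)" "\<lambda>x. c (1 - x)" lam
    "\<lambda>s x. \<phi> s (1 - x)" "\<lambda>s x. - Q s (1 - x)" K by (rule mirror)
  define k where "k = \<epsilon> / 2"
  have k: "k > 0" using \<open>\<epsilon> > 0\<close> by (simp add: k_def)
  have x01: "x0 \<in> {0..1}" using x0 by (auto simp: M1_def)
  have r: "\<forall>\<^sub>F s in at_top. c x0 + 2 * k \<le> lam s \<longrightarrow> x0 < 1 \<longrightarrow> Q s x0 > 0"
    using no_high_value_right[OF x0 _ k] by (cases "x0 < 1") (auto simp: eventually_at_top_linorder)
  have l: "\<forall>\<^sub>F s in at_top. c x0 + 2 * k \<le> lam s \<longrightarrow> 0 < x0 \<longrightarrow> - Q s x0 > 0"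
    using mir.no_high_value_right[OF M1_mirror[OF x0] _ k]
    by (cases "0 < x0") (auto simp: eventually_at_top_linorder)
  show ?thesis using r l eventually_gt_at_top[of 0]
  proof eventually_elim
    case (elim s)
    show ?case
    proof (rule ccontr)
      assume "\<not> lam s < c x0 + \<epsilon>"
      then have "c x0 + 2 * k \<le> lam s" by (simp add: k_def)
      then have "x0 < 1 \<longrightarrow> Q s x0 > 0" "0 < x0 \<longrightarrow> - Q s x0 > 0" using elim by auto
      then show False using x01 Q0[OF elim(3)] Q1[OF elim(3)]
        by (cases "x0 = 0"; cases "x0 = 1") auto
    qed
  qed
qed

text \<open>Counterpart of \<open>no_high_value_right\<close>: with lam below c a nonnegative flux
  grows away from \<open>x0\<close>, and amplification makes g on {p..q} exponentially larger than
  \<open>w s x0\<close>. The L2 bound on g then forces \<open>w s x0\<close> to be exponentially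
  small.\<close>

lemma w_small_right:
  assumes x0: "x0 \<in> M1 m" "x0 < 1" and "k > 0"
  shows "\<exists>B \<eta>. \<eta> > 0 \<and> (\<forall>s>0. lam s \<le> c x0 - 2 * k \<longrightarrow> Q s x0 \<ge> 0 \<longrightarrow> w s x0 \<le> B * exp (- (s * \<eta>)))"
proof -
  obtain \<theta> p q \<eta> where *: "0 < \<theta>" "x0 + \<theta> \<le> p" "p < q" "q \<le> 1" "\<eta> > 0"
    and m_top: "\<And>t. t \<in> {x0..x0 + \<theta>} \<Longrightarrow> m x0 - \<eta> \<le> m t"
    and m_low: "\<And>t. t \<in> {p..q} \<Longrightarrow> m t \<le> m x0 - 3 * \<eta>"
    and c_near: "\<And>t. t \<in> {x0..q} \<Longrightarrow> \<bar>c t - c x0\<bar> \<le> k"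
    using M1_right_neighbourhood[OF m_cont c_cont x0 \<open>k > 0\<close>] by metis
  have x00: "0 \<le> x0" using x0 by (auto simp: M1_def)
  define B where "B = sqrt (K / (q - p)) / (k * \<theta>)"
  have "w s x0 \<le> B * exp (- (s * \<eta>))" if s0: "s > 0" and lam: "lam s \<le> c x0 - 2 * k" and Qx0: "Q s x0 \<ge> 0" for s
  proof -
    have \<phi>pos: "\<phi> s t > 0" if "t \<in> {x0..q}" for t using pos[OF s0, of t] that x00 * by auto
    have coef: "k \<le> c t - lam s" if "t \<in> {x0..q}" for t using c_near[OF that] lam by linarith
    have Q_inc: "Q s x \<le> Q s y" if "x0 \<le> x" "x \<le> y" "y \<le> q" for x y
    proof (rule derivative_nonneg_imp_le[OF that(2)])
      fix t assume t: "t \<in> {x..y}"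
      show "(Q s has_real_derivative (c t - lam s) * exp (2 * s * m t) * \<phi> s t) (at t within {x..y})"
        by (intro deriv_sub) (use s0 t that x00 * in auto)
    next
      fix t assume "t \<in> {x<..<y}"
      then have t: "t \<in> {x0..q}" using that by auto
      show "0 \<le> (c t - lam s) * exp (2 * s * m t) * \<phi> s t"
        using coef[OF t] \<phi>pos[OF t] \<open>k > 0\<close> by simp
    qed
    have \<phi>_inc: "\<phi> s x \<le> \<phi> s y" if "x0 \<le> x" "x \<le> y" "y \<le> q" for x y
    proof (rule derivative_nonneg_imp_le[OF that(2)])
      fix t assume t: "t \<in> {x..y}"
      show "(\<phi> s has_real_derivative exp (- (2 * s * m t)) * Q s t) (at t within {x..y})"
        by (intro deriv_sub) (use s0 t that x00 * in auto)
    next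
      fix t assume "t \<in> {x<..<y}"
      then have "Q s x0 \<le> Q s t" using that by (intro Q_inc) auto
      then show "0 \<le> exp (- (2 * s * m t)) * Q s t" using Qx0 by simp
    qed
    define A where "A = k * exp (2 * s * (m x0 - \<eta>)) * \<phi> s x0"
    have A: "A > 0" using \<open>k > 0\<close> \<phi>pos[of x0] * by (simp add: A_def)
    have "Q s x0 - A * x0 \<le> Q s (x0 + \<theta>) - A * (x0 + \<theta>)"
    proof (rule derivative_nonneg_imp_le[where f = "\<lambda>t. Q s t - A * t"])
      fix t assume t: "t \<in> {x0..x0 + \<theta>}"
      show "((\<lambda>t. Q s t - A * t) has_real_derivative
          (c t - lam s) * exp (2 * s * m t) * \<phi> s t - A) (at t within {x0..x0 + \<theta>})"
        using deriv_sub(2)[OF s0 t] x00 * by (auto intro!: derivative_eq_intros)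
    next
      fix t assume "t \<in> {x0<..<x0 + \<theta>}"
      then have t: "t \<in> {x0..x0 + \<theta>}" "t \<in> {x0..q}" using * by auto
      have "A \<le> (c t - lam s) * exp (2 * s * m t) * \<phi> s t"
        unfolding A_def
        using m_top[OF t(1)] coef[OF t(2)] \<phi>_inc[of x0 t] t * \<phi>pos[of x0] \<open>k > 0\<close> s0
        by (intro mult_mono) auto
      then show "0 \<le> (c t - lam s) * exp (2 * s * m t) * \<phi> s t - A" by simp
    qed (use * in simp)
    then have Qtheta: "A * \<theta> \<le> Q s (x0 + \<theta>)" using Qx0 by (simp add: algebra_simps)
    have g_large: "k * \<theta> * exp (s * \<eta>) * w s x0 \<le> g s t" if t: "t \<in> {p..q}" for t
    proof -
      have "Q s (x0 + \<theta>) \<le> Q s t" using t * by (intro Q_inc) auto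
      then have Qt: "A * \<theta> \<le> Q s t" using Qtheta by linarith
      have "k * \<theta> * exp (s * \<eta>) * w s x0 = exp (- (s * (m x0 - 3 * \<eta>))) * (A * \<theta>)"
        unfolding w_def A_def by (simp add: algebra_simps flip: exp_add)
      also have "\<dots> \<le> exp (- (s * m t)) * Q s t"
        using m_low[OF t] Qt s0 A * by (intro mult_mono) auto
      finally show ?thesis by (simp add: g_def)
    qed
    have "continuous_on {p..q} (g s)"
      by (rule continuous_on_subset[OF cont_g[OF s0]]) (use x00 * in auto)
    then obtain z where "z \<in> {p..q}" "\<bar>g s z\<bar> \<le> sqrt (K / (q - p))"
      using exists_small_value[of p q "g s" K] sub_L2(2)[OF s0, of p q] x00 * by auto
    then have "k * \<theta> * exp (s * \<eta>) * w s x0 \<le> sqrt (K / (q - p))"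
      using g_large[of z] by linarith
    then have "exp (s * \<eta>) * w s x0 \<le> B"
      using * \<open>k > 0\<close> by (simp add: B_def field_simps)
    then show ?thesis by (simp add: exp_minus field_simps)
  qed
  then show ?thesis using *(5) by blast
qed

text \<open>The sign of Q at \<open>x0\<close> selects the side on which the exponential bound
  applies; at an endpoint Q is 0 and the inner side serves.\<close>

lemma w_vanishes_below_M1_value:
  assumes x0: "x0 \<in> M1 m" and t: "\<And>n. t n > 0" "filterlim t at_top sequentially"
    and lam: "(\<lambda>n. lam (t n)) \<longlonglongrightarrow> L" and "L < c x0"
  shows "(\<lambda>n. w (t n) x0) \<longlonglongrightarrow> 0"
proof -
  interpret mir: neumann_family "\<lambda>x. m (1 - x)" "\<lambda>x. c (1 - x)" lam
    "\<lambda>s x. \<phi> s (1 - x)" "\<lambda>s x. - Q s (1 - x)" K by (rule mirror)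
  \<comment> \<open>Then \<open>c x0 - 2 * k\<close> is the midpoint of L and \<open>c x0\<close>,
    hence eventually above lam.\<close>
  define k where "k = (c x0 - L) / 4"
  have k: "k > 0" using \<open>L < c x0\<close> by (simp add: k_def)
  have x01: "x0 \<in> {0..1}" using x0 by (auto simp: M1_def)
  have "\<exists>B \<eta>. \<eta> > 0 \<and> (\<forall>s>0. lam s \<le> c x0 - 2 * k \<longrightarrow> x0 < 1 \<longrightarrow> Q s x0 \<ge> 0 \<longrightarrow>
      w s x0 \<le> B * exp (- (s * \<eta>)))"
    using w_small_right[OF x0 _ k] by (cases "x0 < 1") (auto intro: exI[of _ 1])
  then obtain B1 \<eta>1 where r: "\<eta>1 > 0" "\<And>s. s > 0 \<Longrightarrow> lam s \<le> c x0 - 2 * k \<Longrightarrow> x0 < 1 \<Longrightarrow> Q s x0 \<ge> 0 \<Longrightarrow>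
      w s x0 \<le> B1 * exp (- (s * \<eta>1))" by blast
  have "\<exists>B \<eta>. \<eta> > 0 \<and> (\<forall>s>0. lam s \<le> c x0 - 2 * k \<longrightarrow> 0 < x0 \<longrightarrow> Q s x0 \<le> 0 \<longrightarrow>
      w s x0 \<le> B * exp (- (s * \<eta>)))"
    using mir.w_small_right[OF M1_mirror[OF x0] _ k]
    by (cases "0 < x0") (auto simp: mirror_w intro: exI[of _ 1])
  then obtain B2 \<eta>2 where l: "\<eta>2 > 0" "\<And>s. s > 0 \<Longrightarrow> lam s \<le> c x0 - 2 * k \<Longrightarrow> 0 < x0 \<Longrightarrow> Q s x0 \<le> 0 \<Longrightarrow>
      w s x0 \<le> B2 * exp (- (s * \<eta>2))" by blast
  \<comment> \<open>For a given s possibly only one of the two bounds is available; the absolute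
    values let their sum cover both cases.\<close>
  have bound: "w s x0 \<le> \<bar>B1\<bar> * exp (- (s * \<eta>1)) + \<bar>B2\<bar> * exp (- (s * \<eta>2))"
    if "s > 0" "lam s \<le> c x0 - 2 * k" for s
  proof -
    have "B1 * exp (- (s * \<eta>1)) \<le> \<bar>B1\<bar> * exp (- (s * \<eta>1))" "B2 * exp (- (s * \<eta>2)) \<le> \<bar>B2\<bar> * exp (- (s * \<eta>2))"
      "0 \<le> \<bar>B1\<bar> * exp (- (s * \<eta>1))" "0 \<le> \<bar>B2\<bar> * exp (- (s * \<eta>2))"
      by auto
    moreover have "(x0 < 1 \<and> Q s x0 \<ge> 0) \<or> (0 < x0 \<and> Q s x0 \<le> 0)"
      using x01 Q0[OF that(1)] Q1[OF that(1)] by (cases "x0 = 0"; cases "x0 = 1") auto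
    ultimately show ?thesis using r(2)[OF that] l(2)[OF that] by linarith
  qed
  have "((\<lambda>s. exp (- (s * \<eta>1))) \<longlongrightarrow> 0) at_top" "((\<lambda>s. exp (- (s * \<eta>2))) \<longlongrightarrow> 0) at_top"
    using r(1) l(1) by real_asymp+
  then have "((\<lambda>s. \<bar>B1\<bar> * exp (- (s * \<eta>1)) + \<bar>B2\<bar> * exp (- (s * \<eta>2))) \<longlongrightarrow> \<bar>B1\<bar> * 0 + \<bar>B2\<bar> * 0) at_top"
    by (intro tendsto_intros)
  then have "((\<lambda>s. \<bar>B1\<bar> * exp (- (s * \<eta>1)) + \<bar>B2\<bar> * exp (- (s * \<eta>2))) \<longlongrightarrow> 0) at_top"
    by simp
  then have lim: "(\<lambda>n. \<bar>B1\<bar> * exp (- (t n * \<eta>1)) + \<bar>B2\<bar> * exp (- (t n * \<eta>2))) \<longlonglongrightarrow> 0"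
    using t(2) by (rule filterlim_compose)
  have "\<forall>\<^sub>F n in sequentially. lam (t n) < c x0 - 2 * k"
    using lam \<open>L < c x0\<close> by (intro order_tendstoD(2)) (auto simp: k_def field_simps)
  then have "\<forall>\<^sub>F n in sequentially. norm (w (t n) x0) \<le> \<bar>B1\<bar> * exp (- (t n * \<eta>1)) + \<bar>B2\<bar> * exp (- (t n * \<eta>2))"
    by eventually_elim (use bound t(1) w_pos[OF t(1) x01] in \<open>auto simp: less_imp_le\<close>)
  then show ?thesis using lim by (rule Lim_null_comparison)
qed

end

section \<open>Convergence of the eigenvalue\<close>

context neumann_family
begin

text \<open>On a flat stretch the weights are constants, so for each s the functions w and g are
  constant multiples of \<phi> and Q.\<close>

lemma segment_solves:
  assumes s: "s > 0" and ab: "0 \<le> a" "a < b" "b \<le> 1" and flat: "\<And>t. t \<in> {a..b} \<Longrightarrow> m t = m a"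
  shows "solves c (lam s) a b (w s) (g s)"
  unfolding solves_def
proof (intro ballI conjI)
  fix t assume t: "t \<in> {a..b}"
  define E where "E = exp (s * m a)"
  have E: "exp (- (s * m a)) = 1 / E" "exp (2 * s * m a) = E * E" "exp (- (2 * s * m a)) = 1 / (E * E)" "E > 0"
    using exp_double[of "s * m a"] by (simp_all add: E_def exp_minus divide_inverse power2_eq_square mult.assoc)
  have "((\<lambda>t. E * \<phi> s t) has_real_derivative E * (exp (- (2 * s * m t)) * Q s t)) (at t within {a..b})"
    by (intro DERIV_cmult deriv_sub s t ab)
  then have d1: "((\<lambda>t. E * \<phi> s t) has_real_derivative g s t) (at t within {a..b})"
    using E by (simp add: g_def flat[OF t])
  show "(w s has_real_derivative g s t) (at t within {a..b})"
  proof (rule has_field_derivative_transform_within[OF d1 zero_less_one t])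
    fix x assume "x \<in> {a..b}"
    then have "m x = m a" by (rule flat)
    then show "E * \<phi> s x = w s x" by (simp add: w_def E_def)
  qed
  have "((\<lambda>t. 1 / E * Q s t) has_real_derivative 1 / E * ((c t - lam s) * exp (2 * s * m t) * \<phi> s t))
      (at t within {a..b})"
    by (intro DERIV_cmult deriv_sub s t ab)
  then have d2: "((\<lambda>t. 1 / E * Q s t) has_real_derivative (c t - lam s) * w s t) (at t within {a..b})"
    using E by (simp add: w_def flat[OF t] E_def[symmetric] mult_ac)
  show "(g s has_real_derivative (c t - lam s) * w s t) (at t within {a..b})"
  proof (rule has_field_derivative_transform_within[OF d2 zero_less_one t])
    fix x assume "x \<in> {a..b}"
    then have "m x = m a" by (rule flat)
    then show "1 / E * Q s x = g s x" using E(1) by (simp add: g_def)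
  qed
qed

text \<open>The L2 bounds become bounds on the data at a, from which compactness of the whole family
  on the segment follows.\<close>

lemma segment_bounded:
  assumes ab: "0 \<le> a" "a < b" "b \<le> 1" and flat: "\<And>t. t \<in> {a..b} \<Longrightarrow> m t = m a"
  shows "\<exists>B. \<forall>s>0. \<bar>w s a\<bar> \<le> B \<and> \<bar>g s a\<bar> \<le> B"
proof -
  define B where "B = sqrt (K\<^sup>2 / (b - a)) + sqrt (K\<^sup>2 * (b - a))"
  have aux: "\<bar>X a\<bar> \<le> B"
    if d: "\<And>t. t \<in> {a..b} \<Longrightarrow> (X has_real_derivative Y t) (at t within {a..b})"
      and cX: "continuous_on {a..b} X" and cY: "continuous_on {a..b} Y"
      and KX: "integral {a..b} (\<lambda>t. (X t)\<^sup>2) \<le> K\<^sup>2" and KY: "integral {a..b} (\<lambda>t. (Y t)\<^sup>2) \<le> K\<^sup>2"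
    for X Y :: "real \<Rightarrow> real"
  proof -
    obtain z where z: "z \<in> {a..b}" "\<bar>X z\<bar> \<le> sqrt (K\<^sup>2 / (b - a))"
      using exists_small_value[OF cX ab(2) KX] by blast
    have sub: "{a..z} \<subseteq> {a..b}" using z by auto
    \<comment> \<open>With s = 0 and n = 0 transport reduces to the Cauchy-Schwarz estimate of X a -
      X z by the L2 norm of the derivative.\<close>
    have "\<bar>X a - exp (- (0 * (0 - 0))) * X z\<bar> \<le> sqrt (K\<^sup>2 * (z - a))"
    proof (rule transport_bound_mono[where n = "\<lambda>_. 0" and Y = Y])
      show "((\<lambda>t. exp (- (0 * 0)) * X t) has_real_derivative exp (- (0 * 0)) * Y t) (at t within {a..z})"
        if "t \<in> {a..z}" for t
        using has_field_derivative_subset[OF d sub, of t] that sub by auto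
      show "continuous_on {a..z} Y" by (rule continuous_on_subset[OF cY sub])
      show "integral {a..z} (\<lambda>t. (Y t)\<^sup>2) \<le> K\<^sup>2"
        using integral_square_mono_interval[OF cY, of a z] KY z by auto
    qed (use z in auto)
    also have "\<dots> \<le> sqrt (K\<^sup>2 * (b - a))" using z by (intro real_sqrt_le_mono mult_left_mono) auto
    finally show ?thesis using z(2) by (simp add: B_def)
  qed
  have "\<bar>w s a\<bar> \<le> B \<and> \<bar>g s a\<bar> \<le> B" if s: "s > 0" for s
  proof -
    note sol = segment_solves[OF s ab flat]
    have cc: "continuous_on {a..b} c" by (rule continuous_on_subset[OF c_cont]) (use ab in auto)
    note L2 = sub_L2[OF s ab(1,3)]
    have "continuous_on {a..b} (\<lambda>t. (c t - lam s) * w s t)"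
      by (intro continuous_intros cc solves_continuous[OF sol])
    then show ?thesis
      using aux[OF solvesD(1)[OF sol] solves_continuous[OF sol]]
        aux[OF solvesD(2)[OF sol] solves_continuous(2)[OF sol]] L2 K_square by auto
  qed
  then show ?thesis by blast
qed

lemma right_bc:
  assumes b: "0 \<le> b" and "right_end m b j" and t: "\<And>n. t n > 0" "filterlim t at_top sequentially"
    and lim: "(\<lambda>n. w (t n) b) \<longlonglongrightarrow> U" "(\<lambda>n. g (t n) b) \<longlonglongrightarrow> V"
  shows "bc j U V"
proof -
  consider "b = 1" "j = Neumann" | "rises_right m b" "j = Dirichlet" | "rises_right (\<lambda>t. - m t) b" "j = Neumann"
    using assms(2) by (auto simp: right_end_def)
  then show ?thesis
  proof cases
    case 1
    then have "V = 0" using lim(2) Q1[OF t(1)] by (simp add: g_def LIMSEQ_const_iff)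
    then show ?thesis using 1 by (simp add: bc_def)
  next
    case 2
    have "(\<lambda>n. w (t n) b) \<longlonglongrightarrow> 0" using w_vanishes_rising[OF b 2(1)] t(2) by (rule filterlim_compose)
    then show ?thesis using 2 LIMSEQ_unique[OF lim(1)] by (simp add: bc_def)
  next
    case 3
    have "(\<lambda>n. g (t n) b) \<longlonglongrightarrow> 0" using g_vanishes_falling[OF b 3(1)] t(2) by (rule filterlim_compose)
    then show ?thesis using 3 LIMSEQ_unique[OF lim(2)] by (simp add: bc_def)
  qed
qed

text \<open>Compactness is two-dimensional: a solution is determined by its data at a, a bounded
  sequence in the plane. The limit may still be zero; mass enters later.\<close>

lemma segment_limit:
  assumes ab: "0 \<le> a" "a < b" "b \<le> 1" and flat: "\<And>t. t \<in> {a..b} \<Longrightarrow> m t = m a"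
    and ends: "right_end (\<lambda>x. m (1 - x)) (1 - a) i" "right_end m b j"
    and t: "\<And>n. t n > 0" "filterlim t at_top sequentially"
    and lam: "(\<lambda>n. lam (t n)) \<longlonglongrightarrow> L"
  shows "\<exists>r U V. strict_mono (r :: nat \<Rightarrow> nat) \<and> solves c L a b U V \<and>
    uniform_limit {a..b} (\<lambda>n. w (t (r n))) U sequentially \<and>
    uniform_limit {a..b} (\<lambda>n. g (t (r n))) V sequentially \<and>
    bc i (U a) (V a) \<and> bc j (U b) (V b) \<and> (\<forall>x\<in>{a..b}. U x \<ge> 0)"
proof -
  interpret mir: neumann_family "\<lambda>x. m (1 - x)" "\<lambda>x. c (1 - x)" lam
    "\<lambda>s x. \<phi> s (1 - x)" "\<lambda>s x. - Q s (1 - x)" K by (rule mirror)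
  obtain B where B: "\<And>s. s > 0 \<Longrightarrow> \<bar>w s a\<bar> \<le> B" "\<And>s. s > 0 \<Longrightarrow> \<bar>g s a\<bar> \<le> B"
    using segment_bounded[OF ab flat] by blast
  have "bounded (range (\<lambda>n. (w (t n) a, g (t n) a)))"
  proof (rule boundedI)
    fix p assume "p \<in> range (\<lambda>n. (w (t n) a, g (t n) a))"
    then obtain n where "p = (w (t n) a, g (t n) a)" by auto
    then show "norm p \<le> B + B"
      using norm_Pair_le[of "w (t n) a" "g (t n) a"] B[OF t(1)[of n]] by simp
  qed
  then obtain l r where r: "strict_mono (r :: nat \<Rightarrow> nat)"
    and l: "((\<lambda>n. (w (t n) a, g (t n) a)) \<circ> r) \<longlonglongrightarrow> l"
    using bounded_imp_convergent_subsequence by blast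
  have tr: "t (r n) > 0" for n using t(1) .
  have trlim: "filterlim (\<lambda>n. t (r n)) at_top sequentially"
    using t(2) filterlim_subseq[OF r] by (rule filterlim_compose)
  have lamr: "(\<lambda>n. lam (t (r n))) \<longlonglongrightarrow> L"
    using LIMSEQ_subseq_LIMSEQ[OF lam r] by (simp add: o_def)
  have wa: "(\<lambda>n. w (t (r n)) a) \<longlonglongrightarrow> fst l" and ga: "(\<lambda>n. g (t (r n)) a) \<longlonglongrightarrow> snd l"
    using tendsto_fst[OF l] tendsto_snd[OF l] by (simp_all add: o_def)
  have cc: "continuous_on {a..b} c" by (rule continuous_on_subset[OF c_cont]) (use ab in auto)
  obtain U V where UV: "solves c L a b U V"
    and U: "uniform_limit {a..b} (\<lambda>n. w (t (r n))) U sequentially"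
    and V: "uniform_limit {a..b} (\<lambda>n. g (t (r n))) V sequentially"
    using solves_limit[OF ab(2) cc segment_solves[OF tr ab flat] lamr wa ga] by blast
  note pw = tendsto_uniform_limitI[OF U] tendsto_uniform_limitI[OF V]
  have "bc j (U b) (V b)"
    by (rule right_bc[OF _ ends(2) tr trlim]) (use pw ab in auto)
  \<comment> \<open>The left condition is the right condition of the reflected family, where g
    changes sign; \<open>bc\<close> is insensitive to that sign.\<close>
  moreover have "bc i (U a) (- V a)"
  proof (rule mir.right_bc[OF _ ends(1) tr trlim])
    show "(\<lambda>n. mir.w (t (r n)) (1 - a)) \<longlonglongrightarrow> U a" using pw(1)[of a] ab by (simp add: mirror_w)
    show "(\<lambda>n. mir.g (t (r n)) (1 - a)) \<longlonglongrightarrow> - V a"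
      using tendsto_minus[OF pw(2)[of a]] ab by (simp add: mirror_g)
  qed (use ab in simp)
  then have "bc i (U a) (V a)" by (auto simp: bc_def split: bdry.splits)
  moreover have "U x \<ge> 0" if x: "x \<in> {a..b}" for x
    by (rule LIMSEQ_le_const[OF pw(1)[OF x]])
      (use w_pos[OF tr, of x] x ab in \<open>auto intro!: exI[of _ 0] less_imp_le\<close>)
  ultimately show ?thesis using UV U V r by blast
qed

lemma lam_bounded: "s > 0 \<Longrightarrow> \<bar>lam s\<bar> \<le> K + \<bar>c 0\<bar>"
  using cK[of s 0] by auto

text \<open>The flat stretch through x is extended both ways. If it is x alone, then either m rises
  on some side, or on each side it falls or the interval ends, which is an isolated maximum.\<close>

lemma point_cases:
  assumes x: "x \<in> {0..1}"
  obtains (segment) a b i j where "0 \<le> a" "a < b" "b \<le> 1" "x \<in> {a..b}" "\<And>t. t \<in> {a..b} \<Longrightarrow> m t = m a"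
      "right_end (\<lambda>x. m (1 - x)) (1 - a) i" "right_end m b j"
  | (right) "rises_right m x" | (left) "rises_right (\<lambda>x. m (1 - x)) (1 - x)" | (peak) "x \<in> M1 m"
proof -
  interpret mir: neumann_family "\<lambda>x. m (1 - x)" "\<lambda>x. c (1 - x)" lam
    "\<lambda>s x. \<phi> s (1 - x)" "\<lambda>s x. - Q s (1 - x)" K by (rule mirror)
  obtain P where P: "finite P" "(\<Union>(a, b)\<in>P. {a..b}) = {0..1}"
    "\<forall>(a, b)\<in>P. mono_on {a..b} m \<or> mono_on {a..b} (\<lambda>x. - m x)"
    using pieces by blast
  obtain b j where b: "x \<le> b" "b \<le> 1" "\<And>t. t \<in> {x..b} \<Longrightarrow> m t = m x" "right_end m b j"
    using right_end_extension[OF m_cont x P] by blast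
  obtain P' where P': "finite P'" "(\<Union>(a, b)\<in>P'. {a..b}) = {0..1}"
    "\<forall>(a, b)\<in>P'. mono_on {a..b} (\<lambda>x. m (1 - x)) \<or> mono_on {a..b} (\<lambda>x. - m (1 - x))"
    using mir.pieces by blast
  have x': "1 - x \<in> {0..1}" using x by auto
  obtain a' i where a': "1 - x \<le> a'" "a' \<le> 1" "\<And>t. t \<in> {1 - x..a'} \<Longrightarrow> m (1 - t) = m (1 - (1 - x))"
      "right_end (\<lambda>x. m (1 - x)) a' i"
    using right_end_extension[OF mir.m_cont x' P'] by blast
  define a where "a = 1 - a'"
  have a: "0 \<le> a" "a \<le> x" "right_end (\<lambda>x. m (1 - x)) (1 - a) i" using a' by (auto simp: a_def)
  have flat: "m t = m x" if "t \<in> {a..b}" for t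
    using b(3)[of t] a'(3)[of "1 - t"] that by (cases "t \<le> x") (auto simp: a_def)
  show ?thesis
  proof (cases "a < b")
    case True
    have "m a = m x" by (rule flat) (use True in simp)
    then have "m t = m a" if "t \<in> {a..b}" for t using flat[OF that] by simp
    moreover have "x \<in> {a..b}" using a(2) b(1) by simp
    ultimately show ?thesis using segment[OF a(1) True b(2) _ _ a(3) b(4)] by blast
  next
    case False
    then have eq: "a = x" "b = x" using a(2) b(1) by auto
    consider "rises_right m x" | "rises_right (\<lambda>x. m (1 - x)) (1 - x)"
      | "x = 1 \<or> rises_right (\<lambda>t. - m t) x" "x = 0 \<or> rises_right (\<lambda>x. - m (1 - x)) (1 - x)"
      using a(3) b(4) eq by (auto simp: right_end_def)
    then show ?thesis
    proof cases
      case 3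
      have "\<exists>e>0. \<forall>y\<in>{x<..<x + e} \<inter> {0..1}. m y < m x"
        using 3(1)
      proof
        assume "rises_right (\<lambda>t. - m t) x"
        then obtain y where y: "y > x" "\<forall>t\<in>{x<..y}. - m x < - m t" by (auto simp: rises_right_def)
        then show ?thesis by (intro exI[of _ "y - x"]) auto
      qed (auto intro: exI[of _ 1])
      then obtain e1 where e1: "e1 > 0" "\<forall>y\<in>{x<..<x + e1} \<inter> {0..1}. m y < m x" by blast
      have "\<exists>e>0. \<forall>y\<in>{x - e<..<x} \<inter> {0..1}. m y < m x"
        using 3(2)
      proof
        assume "rises_right (\<lambda>x. - m (1 - x)) (1 - x)"
        then obtain y where y: "y > 1 - x" "\<forall>t\<in>{1 - x<..y}. - m (1 - (1 - x)) < - m (1 - t)"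
          by (auto simp: rises_right_def)
        have "m t < m x" if "t \<in> {x - (y - (1 - x))<..<x}" for t
          using bspec[OF y(2), of "1 - t"] that by auto
        then show ?thesis using y(1) by (intro exI[of _ "y - (1 - x)"]) auto
      qed (auto intro: exI[of _ 1])
      then obtain e2 where e2: "e2 > 0" "\<forall>y\<in>{x - e2<..<x} \<inter> {0..1}. m y < m x" by blast
      have "\<forall>y\<in>({x - min e1 e2<..<x + min e1 e2} \<inter> {0..1}) - {x}. m y < m x"
      proof
        fix y assume "y \<in> ({x - min e1 e2<..<x + min e1 e2} \<inter> {0..1}) - {x}"
        then have "y \<in> {x<..<x + e1} \<inter> {0..1} \<or> y \<in> {x - e2<..<x} \<inter> {0..1}" by auto
        then show "m y < m x" using e1(2) e2(2) by blast
      qed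
      moreover have "min e1 e2 > 0" using e1 e2 by simp
      ultimately have "x \<in> M1 m" using x unfolding M1_def by blast
      then show ?thesis by (rule peak)
    qed (use right left in blast)+
  qed
qed

text \<open>Pointwise decay of w does not by itself contradict the normalization. A dominating
  constant is supplied on each monotone piece by the value at its higher end plus sqrt K.\<close>

lemma lam_le_subsequential_limit:
  assumes t: "\<And>n. t n > 0" "filterlim t at_top sequentially"
    and lam: "(\<lambda>n. lam (t n)) \<longlonglongrightarrow> L" and "\<epsilon> > 0"
  shows "\<forall>\<^sub>F s in at_top. lam s < L + \<epsilon>"
proof (rule ccontr)
  assume contra: "\<not> ?thesis"
  interpret mir: neumann_family "\<lambda>x. m (1 - x)" "\<lambda>x. c (1 - x)" lam
    "\<lambda>s x. \<phi> s (1 - x)" "\<lambda>s x. - Q s (1 - x)" K by (rule mirror)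
  have lim0: "(\<lambda>n. w (t n) x) \<longlonglongrightarrow> 0" if x: "x \<in> {0..1}" for x
    using x
  proof (cases rule: point_cases)
    case (segment a b i j)
    have sub: "{a..b} \<subseteq> {0..1}" using segment by auto
    show ?thesis
    proof (rule tendsto_via_subsequences)
      fix r :: "nat \<Rightarrow> nat" assume r: "strict_mono r"
      have "filterlim (\<lambda>n. t (r n)) at_top sequentially"
        using t(2) filterlim_subseq[OF r] by (rule filterlim_compose)
      moreover have "(\<lambda>n. lam (t (r n))) \<longlonglongrightarrow> L"
        using LIMSEQ_subseq_LIMSEQ[OF lam r] by (simp add: o_def)
      ultimately obtain r' U V where r': "strict_mono (r' :: nat \<Rightarrow> nat)" and UV: "solves c L a b U V"
        and U: "uniform_limit {a..b} (\<lambda>n. w (t (r (r' n)))) U sequentially"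
        and bcs: "bc i (U a) (V a)" "bc j (U b) (V b)"
        using segment_limit[OF segment(1-3,5-7), of "\<lambda>n. t (r n)" L] t(1) by blast
      have cU: "continuous_on {a..b} (\<lambda>x. (U x)\<^sup>2)"
        by (intro continuous_intros solves_continuous[OF UV])
      have nn: "integral {a..b} (\<lambda>x. (U x)\<^sup>2) \<ge> 0"
        by (rule integral_nonneg) (auto intro: integrable_continuous_real cU)
      \<comment> \<open>A nontrivial limit would serve as test function and give the very bound that
        is being denied.\<close>
      have "\<not> integral {a..b} (\<lambda>x. (U x)\<^sup>2) > 0"
        using lam_le_segment_value[OF segment(1-3,5) solvesD[OF UV] segment(6,7) bcs _ \<open>\<epsilon> > 0\<close>] contra by blast
      then have "integral {a..b} (\<lambda>x. (U x)\<^sup>2) = 0" using nn by simp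
      then have "(U x)\<^sup>2 = 0"
        using integral_eq_0_iff[of a b "\<lambda>x. (U x)\<^sup>2"] cU segment(2,4) by auto
      then have "(\<lambda>n. w (t (r (r' n))) x) \<longlonglongrightarrow> 0"
        using tendsto_uniform_limitI[OF U segment(4)] by simp
      then show "\<exists>r'. strict_mono (r' :: nat \<Rightarrow> nat) \<and> (\<lambda>n. w (t (r (r' n))) x) \<longlonglongrightarrow> 0"
        using r' by blast
    qed
  next
    case right
    show ?thesis
      by (rule filterlim_compose[OF w_vanishes_rising[OF _ right] t(2)]) (use x in simp)
  next
    case left
    have "((\<lambda>s. mir.w s (1 - x)) \<longlongrightarrow> 0) at_top"
      by (rule mir.w_vanishes_rising[OF _ left]) (use x in simp)
    then have "((\<lambda>s. w s x) \<longlongrightarrow> 0) at_top" by (simp add: mirror_w)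
    then show ?thesis using t(2) by (rule filterlim_compose)
  next
    case peak
    \<comment> \<open>Otherwise the peak value bounds limsup lam by L, again the denied
      bound.\<close>
    have "L < c x"
    proof (rule ccontr)
      assume "\<not> L < c x"
      then have "\<forall>\<^sub>F s in at_top. lam s < L + \<epsilon>"
        using lam_le_M1_value[OF peak \<open>\<epsilon> > 0\<close>] by (auto elim!: eventually_mono)
      then show False using contra by contradiction
    qed
    then show ?thesis by (rule w_vanishes_below_M1_value[OF peak t lam])
  qed
  obtain P where P: "finite P" "(\<Union>(a, b)\<in>P. {a..b}) = {0..1}"
    "\<forall>(a, b)\<in>P. mono_on {a..b} m \<or> mono_on {a..b} (\<lambda>x. - m x)"
    using pieces by blast
  have piece_bound: "\<exists>C. \<forall>n. \<forall>x\<in>{fst p..snd p}. w (t n) x \<le> C" if p: "p \<in> P" for p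
  proof (cases "fst p \<le> snd p")
    case True
    have sub: "{fst p..snd p} \<subseteq> {0..1}" using P(2) p by force
    then have in01: "fst p \<in> {0..1}" "snd p \<in> {0..1}" using True by auto
    have bdd: "\<exists>C. \<forall>n. w (t n) y \<le> C" if "y \<in> {0..1}" for y
    proof -
      have "Bseq (\<lambda>n. w (t n) y)" using lim0[OF that] convergent_imp_Bseq convergent_def by blast
      then show ?thesis by (auto simp: Bseq_def dest!: abs_le_D1)
    qed
    obtain C1 C2 where C: "\<And>n. w (t n) (fst p) \<le> C1" "\<And>n. w (t n) (snd p) \<le> C2"
      using bdd[OF in01(1)] bdd[OF in01(2)] by blast
    have sq: "sqrt (K * z) \<le> sqrt K" if "z \<le> 1" for z
      using K1 that mult_left_mono[of z 1 K] by simp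
    have "w (t n) x \<le> max C1 C2 + sqrt K" if x: "x \<in> {fst p..snd p}" for n x
    proof -
      consider "mono_on {fst p..snd p} m" | "mono_on {fst p..snd p} (\<lambda>x. - m x)" using P(3) p by force
      then show ?thesis
      proof cases
        case 1
        have "w (t n) x \<le> w (t n) (snd p) + sqrt (K * (snd p - x))"
          by (rule w_bound) (use t(1) x in01 mono_onD[OF 1] in auto)
        also have "sqrt (K * (snd p - x)) \<le> sqrt K" by (rule sq) (use x sub in01 in auto)
        finally show ?thesis using C(2)[of n] by linarith
      next
        case 2
        \<comment> \<open>On a falling piece the higher end is the left one, reached through the
          reflected family.\<close>
        have "mir.w (t n) (1 - x) \<le> mir.w (t n) (1 - fst p) + sqrt (K * ((1 - fst p) - (1 - x)))"
        proof (rule mir.w_bound)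
          fix r assume "r \<in> {1 - x..1 - fst p}"
          then show "m (1 - (1 - x)) \<le> m (1 - r)" using mono_onD[OF 2, of "1 - r" x] x by auto
        qed (use t(1) x in01 in auto)
        also have "sqrt (K * ((1 - fst p) - (1 - x))) \<le> sqrt K" by (rule sq) (use x sub in01 in auto)
        finally show ?thesis using C(1)[of n] by (simp add: mirror_w)
      qed
    qed
    then show ?thesis by blast
  qed auto
  have "\<forall>p\<in>P. \<exists>C. \<forall>n. \<forall>x\<in>{fst p..snd p}. w (t n) x \<le> C" using piece_bound by blast
  then obtain Cf where Cf: "\<forall>p\<in>P. \<forall>n. \<forall>x\<in>{fst p..snd p}. w (t n) x \<le> Cf p" by metis
  define C where "C = (\<Sum>p\<in>P. \<bar>Cf p\<bar>)"
  have bound: "w (t n) x \<le> C" if x: "x \<in> {0..1}" for n x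
  proof -
    obtain p where p: "p \<in> P" "x \<in> {fst p..snd p}" using P(2) x by force
    then have "w (t n) x \<le> \<bar>Cf p\<bar>" using Cf by (meson abs_ge_self order_trans)
    also have "\<dots> \<le> C" unfolding C_def by (rule member_le_sum) (use p P(1) in auto)
    finally show ?thesis .
  qed
  have "(\<lambda>n. integral {0..1} (\<lambda>x. (w (t n) x)\<^sup>2)) \<longlonglongrightarrow> integral {0..1 :: real} (\<lambda>x. 0 :: real)"
  proof (rule dominated_convergence(2)[where h = "\<lambda>_. C\<^sup>2" and f = "\<lambda>n x. (w (t n) x)\<^sup>2" and g = "\<lambda>_. 0"])
    show "(\<lambda>x. (w (t n) x)\<^sup>2) integrable_on {0..1}" for n
      by (intro integrable_continuous_real continuous_intros cont_w t)
    show "norm ((w (t n) x)\<^sup>2) \<le> C\<^sup>2" if "x \<in> {0..1}" for n x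
      using bound[OF that, of n] w_pos[OF t(1)[of n] that] by (simp add: power_mono)
    show "(\<lambda>n. (w (t n) x)\<^sup>2) \<longlonglongrightarrow> 0" if "x \<in> {0..1}" for x
      using tendsto_power[OF lim0[OF that], of 2] by simp
  qed auto
  then show False using mass_w[OF t(1)] by (simp add: LIMSEQ_const_iff)
qed

text \<open>The bound on limsup applies to every subsequential limit. One obtained from parameters
  with \<open>lam \<le> a < L\<close> would, applied back to the given sequence, force
  \<open>L \<le> (L + a) / 2\<close>.\<close>

lemma lam_tendsto_of_subsequence:
  assumes t: "\<And>n. t n > 0" "filterlim t at_top sequentially"
    and lam: "(\<lambda>n. lam (t n)) \<longlonglongrightarrow> L"
  shows "(lam \<longlongrightarrow> L) at_top"
proof (rule order_tendstoI)
  fix a assume "L < a"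
  then show "\<forall>\<^sub>F s in at_top. lam s < a"
    using lam_le_subsequential_limit[OF t lam, of "a - L"] by simp
next
  fix a assume "a < L"
  show "\<forall>\<^sub>F s in at_top. a < lam s"
  proof (rule ccontr)
    assume "\<not> (\<forall>\<^sub>F s in at_top. a < lam s)"
    then have "\<exists>s. s \<ge> real n + 1 \<and> lam s \<le> a" for n
      unfolding eventually_at_top_linorder by (meson not_le)
    then obtain X where X: "\<And>n. X n \<ge> real n + 1" "\<And>n. lam (X n) \<le> a" by metis
    have Xpos: "X n > 0" for n using X(1)[of n] by linarith
    have Xlim: "filterlim X at_top sequentially"
      by (rule filterlim_at_top_mono[OF filterlim_real_sequentially])
        (use X(1) in \<open>auto intro!: always_eventually simp: add_increasing2 order_trans[OF _ X(1)]\<close>)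
    have "bounded (range (\<lambda>n. lam (X n)))"
      using lam_bounded[OF Xpos] by (auto intro!: boundedI)
    then obtain l r where r: "strict_mono (r :: nat \<Rightarrow> nat)" and l: "((\<lambda>n. lam (X n)) \<circ> r) \<longlonglongrightarrow> l"
      using bounded_imp_convergent_subsequence by blast
    have la: "l \<le> a" by (rule LIMSEQ_le_const2[OF l]) (use X(2) in auto)
    have "filterlim (\<lambda>n. X (r n)) at_top sequentially"
      using Xlim filterlim_subseq[OF r] by (rule filterlim_compose)
    then have "\<forall>\<^sub>F s in at_top. lam s < l + (L - a) / 2"
      using lam_le_subsequential_limit[of "\<lambda>n. X (r n)" l "(L - a) / 2"] Xpos l \<open>a < L\<close> by (simp add: o_def)
    then have "\<forall>\<^sub>F n in sequentially. lam (t n) < l + (L - a) / 2"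
      using t(2) by (rule eventually_compose_filterlim)
    then have "L \<le> l + (L - a) / 2"
      by (intro tendsto_upperbound[OF lam]) (auto elim: eventually_mono)
    then show False using la \<open>a < L\<close> by (simp add: field_simps)
  qed
qed

end

section \<open>Segments charged by the limit measure\<close>

lemma integral_uniform_limit:
  fixes f :: "nat \<Rightarrow> real \<Rightarrow> real"
  assumes "uniform_limit {a..b} f g sequentially" "\<And>n. continuous_on {a..b} (f n)"
  shows "(\<lambda>n. integral {a..b} (f n)) \<longlonglongrightarrow> integral {a..b} g"
proof -
  obtain I J where IJ: "\<And>n. (f n has_integral I n) {a..b}" "(g has_integral J) {a..b}" "I \<longlonglongrightarrow> J"
    using uniform_limit_integral[OF assms] by (auto simp: trivial_limit_sequentially)
  have "I = (\<lambda>n. integral {a..b} (f n))" using integral_unique[OF IJ(1)] by (simp add: fun_eq_iff)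
  then show ?thesis using IJ(3) integral_unique[OF IJ(2)] by simp
qed

locale neumann_limit_measure = neumann_family +
  fixes t :: "nat \<Rightarrow> real" and \<mu> :: "real measure"
  assumes t_pos: "\<And>n. t n > 0"
    and t_lim: "filterlim t at_top sequentially"
    and \<mu>_prob: "prob_space \<mu>"
    and \<mu>_sets: "sets \<mu> = sets (restrict_space borel {0..1})"
    and \<mu>_lim: "\<And>\<zeta> :: real \<Rightarrow> real. continuous_on {0..1} \<zeta> \<Longrightarrow>
      (\<lambda>n. integral {0..1} (\<lambda>x. (w (t n) x)\<^sup>2 * \<zeta> x)) \<longlonglongrightarrow> (\<integral>x. \<zeta> x \<partial>\<mu>)"
begin

lemma space_\<mu>: "space \<mu> = {0..1}"
  using sets_eq_imp_space_eq[OF \<mu>_sets] by simp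

lemma borel_measurable_\<mu>: "continuous_on {0..1} f \<Longrightarrow> f \<in> borel_measurable \<mu>" for f :: "real \<Rightarrow> real"
  using borel_measurable_continuous_on_restrict measurable_cong_sets[OF \<mu>_sets refl] by blast

text \<open>Weak convergence tests continuous functions only. These vanish on F and increase to the
  indicator of its complement, so they localize without seeing F.\<close>

lemma indicator_approximation:
  fixes F :: "real set"
  assumes F: "closed F" "F \<noteq> {}"
  shows "(\<lambda>n. min 1 (real n * infdist x F)) \<longlonglongrightarrow> indicator (- F) x"
proof (cases "x \<in> F")
  case False
  then have pos: "infdist x F > 0"
    using F by (metis in_closed_iff_infdist_zero infdist_nonneg order_le_less)
  then have "filterlim (\<lambda>n. infdist x F * real n) at_top sequentially"
    by (intro filterlim_tendsto_pos_mult_at_top[OF tendsto_const]) (auto simp: filterlim_real_sequentially)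
  then have "\<forall>\<^sub>F n in sequentially. 1 \<le> infdist x F * real n" by (simp add: filterlim_at_top)
  then have "\<forall>\<^sub>F n in sequentially. min 1 (real n * infdist x F) = indicator (- F) x"
    by eventually_elim (use False in \<open>simp add: mult.commute\<close>)
  then show ?thesis by (rule tendsto_eventually)
qed simp

lemma measure_via_limits:
  fixes F :: "real set"
  assumes F: "closed F" "F \<noteq> {}"
  shows "(\<lambda>n. \<integral>x. min 1 (real n * infdist x F) \<partial>\<mu>) \<longlonglongrightarrow> measure \<mu> ({0..1} - F)"
proof -
  interpret prob_space \<mu> by (rule \<mu>_prob)
  have "{0..1} - F \<in> sets \<mu>"
    using F(1) by (auto simp: \<mu>_sets sets_restrict_space Diff_eq intro!: image_eqI[of _ _ "- F"])
  moreover have "(\<lambda>n. \<integral>x. min 1 (real n * infdist x F) \<partial>\<mu>) \<longlonglongrightarrow> (\<integral>x. indicator ({0..1} - F) x \<partial>\<mu>)"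
  proof (rule integral_dominated_convergence[where w = "\<lambda>_. 1"])
    show "(\<lambda>x. indicator ({0..1} - F) x :: real) \<in> borel_measurable \<mu>"
      using calculation by simp
    show "(\<lambda>x. min 1 (real n * infdist x F)) \<in> borel_measurable \<mu>" for n
      by (intro borel_measurable_\<mu> continuous_intros)
    show "AE x in \<mu>. (\<lambda>n. min 1 (real n * infdist x F)) \<longlonglongrightarrow> indicator ({0..1} - F) x"
    proof (rule AE_I2)
      fix x assume "x \<in> space \<mu>"
      then have "indicator ({0..1} - F) x = (indicator (- F) x :: real)"
        by (auto simp: space_\<mu> indicator_def)
      then show "(\<lambda>n. min 1 (real n * infdist x F)) \<longlonglongrightarrow> indicator ({0..1} - F) x"
        using indicator_approximation[OF F, of x] by simp
    qed
    show "AE x in \<mu>. norm (min 1 (real n * infdist x F)) \<le> 1" for n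
      by (auto simp: infdist_nonneg min_def)
  qed simp
  ultimately show ?thesis by simp
qed

text \<open>F is the complement of the set whose mass is measured, so open and half-open segments
  are treated at once. The cutoffs vanish off the segment, where w need not converge, and the
  endpoints that may lie in F are a null set for the integral of U^2.\<close>

lemma segment_mass:
  assumes ab: "0 \<le> a" "a < b" "b \<le> 1" and F: "closed F" "F \<noteq> {}"
    and O: "{0..1} - F \<subseteq> {a..b}" "{a..b} \<inter> F \<subseteq> {a, b}"
    and r: "strict_mono (r :: nat \<Rightarrow> nat)"
    and cU: "continuous_on {a..b} U" and U: "uniform_limit {a..b} (\<lambda>n. w (t (r n))) U sequentially"
  shows "integral {a..b} (\<lambda>x. (U x)\<^sup>2) = measure \<mu> ({0..1} - F)"
proof -
  let ?z = "\<lambda>k x. min 1 (real k * infdist x F)"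
  have sub: "{a..b} \<subseteq> {0..1}" using ab by auto
  have cz: "continuous_on A (?z k)" for A k by (intro continuous_intros)
  have eq: "integral {a..b} (\<lambda>x. (U x)\<^sup>2 * ?z k x) = (\<integral>x. ?z k x \<partial>\<mu>)" for k
  proof (rule LIMSEQ_unique)
    have "(\<lambda>n. integral {0..1} (\<lambda>x. (w (t (r n)) x)\<^sup>2 * ?z k x)) \<longlonglongrightarrow> (\<integral>x. ?z k x \<partial>\<mu>)"
      using LIMSEQ_subseq_LIMSEQ[OF \<mu>_lim[OF cz] r] by (simp add: o_def)
    also have "(\<lambda>n. integral {0..1} (\<lambda>x. (w (t (r n)) x)\<^sup>2 * ?z k x))
        = (\<lambda>n. integral {a..b} (\<lambda>x. (w (t (r n)) x)\<^sup>2 * ?z k x))"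
    proof
      fix n
      have "integral {0..1} (\<lambda>x. (w (t (r n)) x)\<^sup>2 * ?z k x)
          = integral {0..1} (\<lambda>x. if x \<in> {a..b} then (w (t (r n)) x)\<^sup>2 * ?z k x else 0)"
        using O(1) F by (intro integral_cong) (auto simp: in_closed_iff_infdist_zero)
      also have "\<dots> = integral ({a..b} \<inter> {0..1}) (\<lambda>x. (w (t (r n)) x)\<^sup>2 * ?z k x)"
        by (rule integral_restrict_Int)
      finally show "integral {0..1} (\<lambda>x. (w (t (r n)) x)\<^sup>2 * ?z k x)
          = integral {a..b} (\<lambda>x. (w (t (r n)) x)\<^sup>2 * ?z k x)"
        using ab by (simp add: max_def min_def)
    qed
    finally show "(\<lambda>n. integral {a..b} (\<lambda>x. (w (t (r n)) x)\<^sup>2 * ?z k x)) \<longlonglongrightarrow> (\<integral>x. ?z k x \<partial>\<mu>)" .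
    have bU: "bounded (U ` {a..b})" and bz: "bounded (?z k ` {a..b})" and bU2: "bounded ((\<lambda>x. (U x)\<^sup>2) ` {a..b})"
      by (intro compact_imp_bounded compact_continuous_image cz continuous_intros cU; simp)+
    have "uniform_limit {a..b} (\<lambda>n x. (w (t (r n)) x)\<^sup>2 * ?z k x) (\<lambda>x. (U x)\<^sup>2 * ?z k x) sequentially"
      unfolding power2_eq_square
      by (intro uniform_lim_mult U bU bz uniform_limit_const bU2[unfolded power2_eq_square])
    moreover have "continuous_on {a..b} (\<lambda>x. (w (t (r n)) x)\<^sup>2 * ?z k x)" for n
      by (intro continuous_intros continuous_on_subset[OF cont_w sub] t_pos)
    ultimately show "(\<lambda>n. integral {a..b} (\<lambda>x. (w (t (r n)) x)\<^sup>2 * ?z k x))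
        \<longlonglongrightarrow> integral {a..b} (\<lambda>x. (U x)\<^sup>2 * ?z k x)"
      by (rule integral_uniform_limit)
  qed
  have "(\<lambda>k. integral {a..b} (\<lambda>x. (U x)\<^sup>2 * ?z k x))
      \<longlonglongrightarrow> integral {a..b} (\<lambda>x. (U x)\<^sup>2 * indicator (- F) x)"
  proof (rule dominated_convergence(2)[where h = "\<lambda>x. (U x)\<^sup>2" and f = "\<lambda>k x. (U x)\<^sup>2 * ?z k x"
        and g = "\<lambda>x. (U x)\<^sup>2 * indicator (- F) x"])
    show "(\<lambda>x. (U x)\<^sup>2 * ?z k x) integrable_on {a..b}" for k
      by (intro integrable_continuous_real continuous_intros cU)
    show "(\<lambda>x. (U x)\<^sup>2) integrable_on {a..b}"
      by (intro integrable_continuous_real continuous_intros cU)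
    show "norm ((U x)\<^sup>2 * ?z k x) \<le> (U x)\<^sup>2" for k x
      using mult_left_mono[of "?z k x" 1 "(U x)\<^sup>2"] infdist_nonneg[of x F] by (simp add: abs_mult)
    show "(\<lambda>k. (U x)\<^sup>2 * ?z k x) \<longlonglongrightarrow> (U x)\<^sup>2 * indicator (- F) x" for x
      by (intro tendsto_intros indicator_approximation F)
  qed
  moreover have "integral {a..b} (\<lambda>x. (U x)\<^sup>2 * indicator (- F) x) = integral {a..b} (\<lambda>x. (U x)\<^sup>2)"
    by (rule integral_spike[of "{a, b}"]) (use O(2) in \<open>auto simp: indicator_def\<close>)
  ultimately show ?thesis
    using measure_via_limits[OF F] LIMSEQ_unique unfolding eq by fastforce
qed

text \<open>All subsequential limits solve one problem with one mass, hence agree. So the data at a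
  converge along the whole sequence, and this upgrades to uniform convergence of w and g.\<close>

lemma segment_convergence:
  assumes ab: "0 \<le> a" "a < b" "b \<le> 1" and flat: "\<And>t. t \<in> {a..b} \<Longrightarrow> m t = m a"
    and ends: "right_end (\<lambda>x. m (1 - x)) (1 - a) i" "right_end m b j"
    and F: "closed F" "F \<noteq> {}" and O: "{0..1} - F \<subseteq> {a..b}" "{a..b} \<inter> F \<subseteq> {a, b}"
    and mass: "measure \<mu> ({0..1} - F) > 0"
  shows "\<exists>L U V. solves c L a b U V \<and> (\<forall>x\<in>{a<..<b}. U x > 0) \<and> bc i (U a) (V a) \<and> bc j (U b) (V b) \<and>
    (lam \<longlongrightarrow> L) at_top \<and> uniform_limit {a..b} (\<lambda>n. w (t n)) U sequentially \<and>
    uniform_limit {a..b} (\<lambda>n. g (t n)) V sequentially"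
proof -
  have cc: "continuous_on {a..b} c" by (rule continuous_on_subset[OF c_cont]) (use ab in auto)
  have "bounded (range (\<lambda>n. lam (t n)))"
    using lam_bounded[OF t_pos] by (auto intro!: boundedI)
  then obtain L r0 where r0: "strict_mono (r0 :: nat \<Rightarrow> nat)" and L: "((\<lambda>n. lam (t n)) \<circ> r0) \<longlonglongrightarrow> L"
    using bounded_imp_convergent_subsequence by blast
  have sub_lim: "filterlim (\<lambda>n. t (r n)) at_top sequentially" if "strict_mono r" for r :: "nat \<Rightarrow> nat"
    using t_lim filterlim_subseq[OF that] by (rule filterlim_compose)
  have lam: "(lam \<longlongrightarrow> L) at_top"
    by (rule lam_tendsto_of_subsequence[OF t_pos sub_lim[OF r0]]) (use L in \<open>simp add: o_def\<close>)
  have lamt: "(\<lambda>n. lam (t (r n))) \<longlonglongrightarrow> L" if "strict_mono r" for r :: "nat \<Rightarrow> nat"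
    by (rule filterlim_compose[OF lam sub_lim[OF that]])
  obtain r1 U V where r1: "strict_mono (r1 :: nat \<Rightarrow> nat)" and UV: "solves c L a b U V"
    and U: "uniform_limit {a..b} (\<lambda>n. w (t (r0 (r1 n)))) U sequentially"
    and bcs: "bc i (U a) (V a)" "bc j (U b) (V b)" and U0: "\<forall>x\<in>{a..b}. U x \<ge> 0"
    using segment_limit[OF ab flat ends t_pos sub_lim[OF r0] lamt[OF r0]] by blast
  have r01: "strict_mono (\<lambda>n. r0 (r1 n))" using strict_mono_o[OF r0 r1] by (simp add: o_def)
  have massU: "integral {a..b} (\<lambda>x. (U x)\<^sup>2) = measure \<mu> ({0..1} - F)"
    by (rule segment_mass[OF ab F O r01 solves_continuous(1)[OF UV] U])
  have "\<exists>z\<in>{a..b}. U z \<noteq> 0"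
  proof (rule ccontr)
    assume "\<not> ?thesis"
    then have "integral {a..b} (\<lambda>x. (U x)\<^sup>2) = integral {a..b} (\<lambda>x. 0)" by (intro integral_cong) auto
    then show False using massU mass by simp
  qed
  then obtain z where z: "z \<in> {a..b}" "U z \<noteq> 0" by blast
  have Upos: "\<forall>x\<in>{a<..<b}. U x > 0" using solves_pos[OF cc UV _ z] U0 by blast
  have lim: "(\<lambda>n. (w (t n) a, g (t n) a)) \<longlonglongrightarrow> (U a, V a)"
  proof (rule tendsto_via_subsequences)
    fix r :: "nat \<Rightarrow> nat" assume r: "strict_mono r"
    obtain r' U' V' where r': "strict_mono (r' :: nat \<Rightarrow> nat)" and UV': "solves c L a b U' V'"
      and U': "uniform_limit {a..b} (\<lambda>n. w (t (r (r' n)))) U' sequentially"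
      and V': "uniform_limit {a..b} (\<lambda>n. g (t (r (r' n)))) V' sequentially"
      and bcs': "bc i (U' a) (V' a)" and U0': "\<forall>x\<in>{a..b}. U' x \<ge> 0"
      using segment_limit[OF ab flat ends t_pos sub_lim[OF r] lamt[OF r]] by blast
    have rr': "strict_mono (\<lambda>n. r (r' n))" using strict_mono_o[OF r r'] by (simp add: o_def)
    have massU': "integral {a..b} (\<lambda>x. (U' x)\<^sup>2) = measure \<mu> ({0..1} - F)"
      by (rule segment_mass[OF ab F O rr' solves_continuous(1)[OF UV'] U'])
    have a: "a \<in> {a..b}" using ab by simp
    have "U' a = U a \<and> V' a = V a"
      by (rule solves_normalized_unique[OF ab(2) cc UV' UV _ _ bcs' bcs(1) massU' massU mass a])
        (use U0 U0' in auto)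
    then have "(\<lambda>n. (w (t (r (r' n))) a, g (t (r (r' n))) a)) \<longlonglongrightarrow> (U a, V a)"
      using tendsto_Pair[OF tendsto_uniform_limitI[OF U' a] tendsto_uniform_limitI[OF V' a]] by simp
    then show "\<exists>r'. strict_mono (r' :: nat \<Rightarrow> nat) \<and>
        (\<lambda>n. (w (t (r (r' n))) a, g (t (r (r' n))) a)) \<longlonglongrightarrow> (U a, V a)"
      using r' by blast
  qed
  have lam_t: "(\<lambda>n. lam (t n)) \<longlonglongrightarrow> L" by (rule filterlim_compose[OF lam t_lim])
  obtain U2 V2 where UV2: "solves c L a b U2 V2"
    and U2: "uniform_limit {a..b} (\<lambda>n. w (t n)) U2 sequentially"
    and V2: "uniform_limit {a..b} (\<lambda>n. g (t n)) V2 sequentially"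
    using solves_limit[OF ab(2) cc segment_solves[OF t_pos ab flat] lam_t] tendsto_fst[OF lim] tendsto_snd[OF lim]
    by force
  have "U2 a = U a" "V2 a = V a"
    using LIMSEQ_unique[OF tendsto_uniform_limitI[OF U2] tendsto_fst[OF lim, simplified]]
      LIMSEQ_unique[OF tendsto_uniform_limitI[OF V2] tendsto_snd[OF lim, simplified]] ab by auto
  then have eq: "U2 x = U x \<and> V2 x = V x" if "x \<in> {a..b}" for x
    using solves_unique[OF cc solves_lincomb[OF UV2 UV, of 1 "-1"] _ _ _ that, of a] ab by auto
  have "uniform_limit {a..b} (\<lambda>n. w (t n)) U sequentially" "uniform_limit {a..b} (\<lambda>n. g (t n)) V sequentially"
    using U2 V2 eq by (auto simp: uniform_limit_iff)
  then show ?thesis using UV Upos bcs lam by blast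
qed

end

section \<open>Concentration at isolated local maxima\<close>

lemma abs_exp_diff_le:
  fixes a b :: real
  assumes "a \<le> 0" "b \<le> 0"
  shows "\<bar>exp a - exp b\<bar> \<le> \<bar>a - b\<bar>"
proof -
  have *: "exp b - exp a \<le> b - a" if "a \<le> b" "b \<le> 0" for a b :: real
  proof -
    have "exp b - exp a = exp b * (1 - exp (a - b))" by (simp add: right_diff_distrib flip: exp_add)
    also have "\<dots> \<le> 1 * (b - a)"
    proof (rule mult_mono)
      show "1 - exp (a - b) \<le> b - a" using exp_ge_add_one_self[of "a - b"] by linarith
    qed (use that in auto)
    finally show ?thesis by simp
  qed
  show ?thesis using *[of a b] *[of b a] assms by (cases "a \<le> b") auto
qed

lemma L2_norm_diff_le:
  fixes f g :: "real \<Rightarrow> real"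
  assumes f: "continuous_on {a..b} f" and g: "continuous_on {a..b} g"
    and le: "integral {a..b} (\<lambda>x. (f x - g x)\<^sup>2) \<le> B"
  shows "\<bar>sqrt (integral {a..b} (\<lambda>x. (f x)\<^sup>2)) - sqrt (integral {a..b} (\<lambda>x. (g x)\<^sup>2))\<bar> \<le> sqrt B"
proof -
  let ?F = "integral {a..b} (\<lambda>x. (f x)\<^sup>2)" and ?G = "integral {a..b} (\<lambda>x. (g x)\<^sup>2)"
    and ?H = "integral {a..b} (\<lambda>x. f x * g x)"
  have i: "(\<lambda>x. (f x)\<^sup>2) integrable_on {a..b}" "(\<lambda>x. (g x)\<^sup>2) integrable_on {a..b}"
    "(\<lambda>x. f x * g x) integrable_on {a..b}"
    by (intro integrable_continuous_real continuous_intros f g)+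
  have F0: "?F \<ge> 0" and G0: "?G \<ge> 0" using i by (auto intro!: integral_nonneg)
  have "(\<lambda>x. (f x - g x)\<^sup>2) = (\<lambda>x. (f x)\<^sup>2 - 2 * (f x * g x) + (g x)\<^sup>2)"
    by (auto simp: power2_eq_square algebra_simps)
  then have "integral {a..b} (\<lambda>x. (f x - g x)\<^sup>2) = ?F - 2 * ?H + ?G"
    using i by (simp add: integral_add integral_diff integrable_on_mult_right integrable_diff)
  moreover have "?H \<le> sqrt ?F * sqrt ?G"
    using integral_Cauchy_Schwarz[OF f g] by (simp add: real_le_rsqrt flip: real_sqrt_mult)
  ultimately have "(sqrt ?F - sqrt ?G)\<^sup>2 \<le> B"
    using le F0 G0 by (simp add: power2_diff)
  then show ?thesis using real_sqrt_le_mono by fastforce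
qed

text \<open>Integrates a leading-order expansion of f' into one of f, one-sidedly if need be, by a
  mean value estimate on the segment from \<open>x0\<close> to x.\<close>

lemma derivative_remainder:
  fixes f f' :: "real \<Rightarrow> real"
  assumes S: "convex S" "x0 \<in> S"
    and d: "\<forall>\<^sub>F x in at x0 within S. (f has_real_derivative f' x) (at x within S)"
    and d0: "(f has_real_derivative f' x0) (at x0 within S)" "f' x0 = 0"
    and lim: "((\<lambda>x. f' x / (x - x0) ^ n) \<longlongrightarrow> B) (at x0 within S)" and "n \<ge> 1"
  shows "((\<lambda>x. (f x - f x0) / (x - x0) ^ Suc n) \<longlongrightarrow> B / real (Suc n)) (at x0 within S)"
proof (rule tendstoI)
  fix e :: real assume "e > 0"
  have "\<forall>\<^sub>F x in at x0 within S. dist (f' x / (x - x0) ^ n) B < e / 2"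
    using lim \<open>e > 0\<close> by (intro tendstoD) auto
  then have "\<forall>\<^sub>F x in at x0 within S. (f has_real_derivative f' x) (at x within S) \<and>
      dist (f' x / (x - x0) ^ n) B < e / 2"
    using d by (rule eventually_conj[rotated])
  then obtain r where r: "r > 0" "\<And>x. x \<in> S \<Longrightarrow> x \<noteq> x0 \<Longrightarrow> dist x x0 < r \<Longrightarrow>
      (f has_real_derivative f' x) (at x within S) \<and> dist (f' x / (x - x0) ^ n) B < e / 2"
    unfolding eventually_at by blast
  \<comment> \<open>Subtracting the candidate leading term leaves a derivative that is small
    compared with the n-th power of the distance.\<close>
  define h where "h x = f x - B * (x - x0) ^ Suc n / real (Suc n)" for x
  have dh: "(h has_real_derivative f' x - B * (x - x0) ^ n) (at x within S)"
    if "x \<in> S" "dist x x0 < r" for x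
  proof -
    have "(f has_real_derivative f' x) (at x within S)"
      using r(2)[OF that(1) _ that(2)] d0(1) by (cases "x = x0") auto
    then show ?thesis
      unfolding h_def[abs_def] by (auto intro!: derivative_eq_intros simp del: power_Suc)
  qed
  have "dist ((f x - f x0) / (x - x0) ^ Suc n) (B / real (Suc n)) < e"
    if x: "x \<in> S" "x \<noteq> x0" "dist x x0 < r" for x
  proof -
    let ?I = "closed_segment x0 x"
    have sub: "?I \<subseteq> S" using S x by (simp add: closed_segment_subset)
    have near: "dist z x0 \<le> dist x x0" if "z \<in> ?I" for z
      using that by (metis dist_commute dist_in_closed_segment)
    have bd: "norm (f' z - B * (z - x0) ^ n) \<le> e / 2 * \<bar>x - x0\<bar> ^ n" if z: "z \<in> ?I" for z
    proof (cases "z = x0")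
      case True
      moreover have "(0::real) ^ n = 0" using \<open>n \<ge> 1\<close> by simp
      ultimately have "f' z - B * (z - x0) ^ n = 0" using d0(2) by (simp only: diff_self)
      then show ?thesis using \<open>e > 0\<close> by simp
    next
      case False
      have "\<bar>f' z / (z - x0) ^ n - B\<bar> < e / 2"
        using r(2)[of z] z sub near[OF z] x False by (auto simp: dist_real_def)
      then have "\<bar>f' z / (z - x0) ^ n - B\<bar> * \<bar>z - x0\<bar> ^ n \<le> e / 2 * \<bar>x - x0\<bar> ^ n"
        using near[OF z] \<open>e > 0\<close> by (intro mult_mono power_mono) (auto simp: dist_real_def)
      moreover have "f' z - B * (z - x0) ^ n = (f' z / (z - x0) ^ n - B) * (z - x0) ^ n"
        using False by (simp add: field_simps)
      ultimately show ?thesis by (simp add: abs_mult power_abs)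
    qed
    have "norm (h x - h x0) \<le> e / 2 * \<bar>x - x0\<bar> ^ n * norm (x - x0)"
    proof (rule field_differentiable_bound[where S = ?I and f' = "\<lambda>z. f' z - B * (z - x0) ^ n"])
      fix z assume z: "z \<in> ?I"
      show "(h has_real_derivative f' z - B * (z - x0) ^ n) (at z within ?I)"
        by (rule has_field_derivative_subset[OF dh sub]) (use z sub near[OF z] x in auto)
    qed (use bd in auto)
    then have "\<bar>h x - h x0\<bar> \<le> e / 2 * \<bar>x - x0\<bar> ^ Suc n" by (simp add: mult_ac)
    moreover have "(f x - f x0) / (x - x0) ^ Suc n - B / real (Suc n) = (h x - h x0) / (x - x0) ^ Suc n"
      using x by (simp add: h_def field_simps)
    ultimately have "\<bar>(f x - f x0) / (x - x0) ^ Suc n - B / real (Suc n)\<bar> \<le> e / 2"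
      using x by (simp add: abs_divide power_abs divide_le_eq abs_mult mult_ac)
    then show ?thesis using \<open>e > 0\<close> by (simp add: dist_real_def)
  qed
  then show "\<forall>\<^sub>F x in at x0 within S. dist ((f x - f x0) / (x - x0) ^ Suc n) (B / real (Suc n)) < e"
    unfolding eventually_at using r(1) by blast
qed

text \<open>Descends from order k - 1, where the claim is the definition of the derivative at
  \<open>x0\<close>, to order 0. The k-th derivative enters in the first step alone, at the single
  point \<open>x0\<close>.\<close>

lemma Peano_remainder:
  fixes f :: "real \<Rightarrow> real"
  assumes S: "S = {a..b}" "a < b" "x0 \<in> S"
    and d: "differentiable_times_at k S f x0" and "k \<ge> 1"
    and z: "\<forall>i\<in>{1..k - 1}. nderiv S i f x0 = 0"
  shows "((\<lambda>x. (f x - f x0) / (x - x0) ^ k) \<longlongrightarrow> nderiv S k f x0 / fact k) (at x0 within S)"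
proof -
  have vd: "(nderiv S i f has_real_derivative nderiv S (Suc i) f x) (at x within S)"
    if "nderiv S i f differentiable (at x within S)" for i x
    using that by (simp add: has_real_derivative_iff_has_vector_derivative vector_derivative_works)
  have "j < k \<Longrightarrow> ((\<lambda>x. (nderiv S (k - Suc j) f x - nderiv S (k - Suc j) f x0) / (x - x0) ^ Suc j)
      \<longlongrightarrow> nderiv S k f x0 / fact (Suc j)) (at x0 within S)" for j
  proof (induction j)
    case 0
    have "nderiv S (k - 1) f differentiable (at x0 within S)"
      using d \<open>k \<ge> 1\<close> by (auto simp: differentiable_times_at_def)
    from vd[OF this] show ?case
      using \<open>k \<ge> 1\<close> by (simp add: has_field_derivative_iff del: nderiv.simps)
  next
    case (Suc j)
    define i where "i = k - Suc (Suc j)"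
    have i: "Suc i = k - Suc j" "Suc i < k" using Suc.prems by (auto simp: i_def)
    have "((\<lambda>x. (nderiv S i f x - nderiv S i f x0) / (x - x0) ^ Suc (Suc j))
      \<longlongrightarrow> nderiv S k f x0 / fact (Suc j) / real (Suc (Suc j))) (at x0 within S)"
    proof (rule derivative_remainder[where f' = "nderiv S (Suc i) f"])
      show "\<forall>\<^sub>F x in at x0 within S. (nderiv S i f has_real_derivative nderiv S (Suc i) f x) (at x within S)"
      proof -
        have "\<forall>\<^sub>F x in at x0 within S. nderiv S i f differentiable (at x within S)"
          using d i(2) unfolding differentiable_times_at_def by blast
        then show ?thesis by eventually_elim (rule vd)
      qed
      show "(nderiv S i f has_real_derivative nderiv S (Suc i) f x0) (at x0 within S)"
      proof (rule vd)
        show "nderiv S i f differentiable (at x0 within S)"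
          using d i(2) unfolding differentiable_times_at_def by (meson Suc_lessD)
      qed
      show z': "nderiv S (Suc i) f x0 = 0"
        using z i by auto
      show "((\<lambda>x. nderiv S (Suc i) f x / (x - x0) ^ Suc j) \<longlongrightarrow> nderiv S k f x0 / fact (Suc j)) (at x0 within S)"
        using Suc.IH Suc.prems z' unfolding i(1)[symmetric] by (simp del: nderiv.simps)
    qed (use S in auto)
    then show ?case unfolding i_def[symmetric] by (simp add: mult.commute)
  qed
  from this[of "k - 1"] show ?thesis using \<open>k \<ge> 1\<close> by (simp del: power_Suc)
qed

text \<open>Dominating functions on the three possible rescaled domains.\<close>

lemma exp_abs_integrable:
  fixes a :: real
  assumes "a > 0"
  shows "(\<lambda>y. exp (- (a * \<bar>y\<bar>))) integrable_on {0..}" "(\<lambda>y. exp (- (a * \<bar>y\<bar>))) integrable_on {..0}"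
    "(\<lambda>y. exp (- (a * \<bar>y\<bar>))) integrable_on UNIV"
proof -
  have "(\<lambda>y. exp (- a * y)) integrable_on {0..}" using assms by (rule integrable_on_exp_minus_to_infinity)
  then show 1: "(\<lambda>y. exp (- (a * \<bar>y\<bar>))) integrable_on {0..}"
    by (rule integrable_eq) auto
  have "(\<lambda>y. exp (- (a * \<bar>y\<bar>))) absolutely_integrable_on {0..}"
    by (rule nonnegative_absolutely_integrable_1[OF 1]) simp
  then have "(\<lambda>y. exp (- (a * \<bar>- y\<bar>))) absolutely_integrable_on {0..} \<and>
      integral {0..} (\<lambda>y. exp (- (a * \<bar>- y\<bar>))) = integral {0..} (\<lambda>y. exp (- (a * \<bar>y\<bar>)))"
    by simp
  then have "(\<lambda>y. exp (- (a * \<bar>y\<bar>))) absolutely_integrable_on {..0}"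
    using has_absolute_integral_reflect_real[of "{0..}" "{..0}" "\<lambda>y. exp (- (a * \<bar>y\<bar>))"] by force
  then show 2: "(\<lambda>y. exp (- (a * \<bar>y\<bar>))) integrable_on {..0}"
    by (simp add: absolutely_integrable_on_def)
  have "negligible ({0..} \<inter> {..0 :: real})" by (rule negligible_subset[of "{0}"]) auto
  then have "(\<lambda>y. exp (- (a * \<bar>y\<bar>))) integrable_on {0..} \<union> {..0}"
    using has_integral_Un[OF integrable_integral[OF 1] integrable_integral[OF 2]]
    by (auto simp only: integrable_on_def)
  also have "{0..} \<union> {..0} = (UNIV :: real set)" by auto
  finally show "(\<lambda>y. exp (- (a * \<bar>y\<bar>))) integrable_on UNIV" .
qed

section \<open>Shape of w next to an isolated maximum\<close>

context neumann_family
begin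

text \<open>To the right of an isolated maximum m falls, so x is compared with the higher point
  \<open>x0\<close> on its left; the transport estimate is therefore taken from the reflected
  family.\<close>

lemma peak_transport_right:
  assumes x0: "x0 \<in> M1 m" "x0 < 1"
  shows "\<exists>\<delta>>0. \<forall>s>0. \<forall>x\<in>{x0..x0 + \<delta>}. x \<le> 1 \<longrightarrow>
    \<bar>w s x - exp (s * (m x - m x0)) * w s x0\<bar> \<le> sqrt (K * (x - x0))"
proof -
  interpret mir: neumann_family "\<lambda>x. m (1 - x)" "\<lambda>x. c (1 - x)" lam
    "\<lambda>s x. \<phi> s (1 - x)" "\<lambda>s x. - Q s (1 - x)" K by (rule mirror)
  have x01: "x0 \<in> {0..1}" using x0 by (auto simp: M1_def)
  obtain e where e: "e > 0" "\<And>y. y \<in> ({x0 - e<..<x0 + e} \<inter> {0..1}) - {x0} \<Longrightarrow> m y < m x0"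
    using x0 by (auto simp: M1_def)
  obtain P where P: "finite P" "(\<Union>(a, b)\<in>P. {a..b}) = {0..1}"
    "\<forall>(a, b)\<in>P. mono_on {a..b} m \<or> mono_on {a..b} (\<lambda>x. - m x)"
    using pieces by blast
  obtain b j where b: "x0 \<le> b" "b \<le> 1" and flat: "\<And>t. t \<in> {x0..b} \<Longrightarrow> m t = m x0" and j: "right_end m b j"
    using right_end_extension[OF m_cont x01 P] by blast
  have not_up: "m y < m x0" if "x0 < y" "y < x0 + e" "y \<le> 1" for y
    using e(2)[of y] that x01 e(1) by auto
  \<comment> \<open>There is no flat stretch beside an isolated maximum and m cannot rise there, so
    falling is the only alternative left in \<open>right_end\<close>.\<close>
  have "b = x0"
  proof (rule ccontr)
    assume "b \<noteq> x0"
    then have lt: "x0 < b" using b by simp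
    define y where "y = min b (x0 + e / 2)"
    have y: "x0 < y" "y \<le> b" "y < x0 + e" using lt e(1) by (auto simp: y_def)
    have "m y = m x0" by (rule flat) (use y in auto)
    then show False using not_up[of y] y b by auto
  qed
  moreover have "\<not> rises_right m x0"
  proof
    assume "rises_right m x0"
    then obtain y where y: "y > x0" "y \<le> 1" "\<forall>t\<in>{x0<..y}. m x0 < m t" by (auto simp: rises_right_def)
    define z where "z = min y (x0 + e / 2)"
    have z: "x0 < z" "z \<le> y" "z < x0 + e" using y e(1) by (auto simp: z_def)
    then have "m z < m x0" "m x0 < m z" using not_up[of z] y by auto
    then show False by simp
  qed
  ultimately have "rises_right (\<lambda>t. - m t) x0" using j x0 by (auto simp: right_end_def)
  then obtain y where y: "x0 < y" "y \<le> 1" "mono_on {x0..y} (\<lambda>t. - m t)" by (auto simp: rises_right_def)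
  have "\<bar>w s x - exp (s * (m x - m x0)) * w s x0\<bar> \<le> sqrt (K * (x - x0))"
    if "s > 0" "x \<in> {x0..x0 + (y - x0)}" for s x
  proof -
    have "\<bar>mir.w s (1 - x) - exp (- (s * (m (1 - (1 - x0)) - m (1 - (1 - x))))) * mir.w s (1 - x0)\<bar>
        \<le> sqrt (K * ((1 - x0) - (1 - x)))"
    proof (rule mir.w_transport_bound)
      fix r assume "r \<in> {1 - x..1 - x0}"
      then show "m (1 - (1 - x)) \<le> m (1 - r)" using mono_onD[OF y(3), of "1 - r" x] that by auto
    qed (use that x01 y in auto)
    then show ?thesis by (simp add: mirror_w algebra_simps)
  qed
  then show ?thesis using y(1) by (intro exI[of _ "y - x0"]) auto
qed

lemma peak_transport:
  assumes x0: "x0 \<in> M1 m"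
  shows "\<exists>\<delta>>0. \<forall>s>0. \<forall>x\<in>{0..1}. \<bar>x - x0\<bar> \<le> \<delta> \<longrightarrow>
    \<bar>w s x - exp (s * (m x - m x0)) * w s x0\<bar> \<le> sqrt (K * \<bar>x - x0\<bar>)"
proof -
  interpret mir: neumann_family "\<lambda>x. m (1 - x)" "\<lambda>x. c (1 - x)" lam
    "\<lambda>s x. \<phi> s (1 - x)" "\<lambda>s x. - Q s (1 - x)" K by (rule mirror)
  have x01: "x0 \<in> {0..1}" using x0 by (auto simp: M1_def)
  have "\<exists>\<delta>>0. \<forall>s>0. \<forall>x\<in>{x0..x0 + \<delta>}. x \<le> 1 \<longrightarrow>
      \<bar>w s x - exp (s * (m x - m x0)) * w s x0\<bar> \<le> sqrt (K * (x - x0))"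
  proof (cases "x0 < 1")
    case False
    then have "x0 = 1" using x01 by simp
    then show ?thesis by (intro exI[of _ 1]) auto
  qed (rule peak_transport_right[OF x0])
  then obtain d1 where d1: "d1 > 0" "\<And>s x. s > 0 \<Longrightarrow> x \<in> {x0..x0 + d1} \<Longrightarrow> x \<le> 1 \<Longrightarrow>
      \<bar>w s x - exp (s * (m x - m x0)) * w s x0\<bar> \<le> sqrt (K * (x - x0))" by blast
  have "\<exists>\<delta>>0. \<forall>s>0. \<forall>x\<in>{1 - x0..1 - x0 + \<delta>}. x \<le> 1 \<longrightarrow>
      \<bar>mir.w s x - exp (s * (m (1 - x) - m (1 - (1 - x0)))) * mir.w s (1 - x0)\<bar> \<le> sqrt (K * (x - (1 - x0)))"
  proof (cases "0 < x0")
    case False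
    then have "x0 = 0" using x01 by simp
    then show ?thesis by (intro exI[of _ 1]) auto
  qed (rule mir.peak_transport_right[OF M1_mirror[OF x0]], simp)
  then obtain d2 where d2: "d2 > 0" "\<And>s x. s > 0 \<Longrightarrow> x \<in> {1 - x0..1 - x0 + d2} \<Longrightarrow> x \<le> 1 \<Longrightarrow>
      \<bar>mir.w s x - exp (s * (m (1 - x) - m (1 - (1 - x0)))) * mir.w s (1 - x0)\<bar> \<le> sqrt (K * (x - (1 - x0)))" by blast
  have "\<bar>w s x - exp (s * (m x - m x0)) * w s x0\<bar> \<le> sqrt (K * \<bar>x - x0\<bar>)"
    if "s > 0" "x \<in> {0..1}" "\<bar>x - x0\<bar> \<le> min d1 d2" for s x
  proof (cases "x0 \<le> x")
    case True
    then show ?thesis using d1(2)[of s x] that by auto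
  next
    case False
    then show ?thesis using d2(2)[of s "1 - x"] that by (auto simp: mirror_w)
  qed
  then show ?thesis using d1(1) d2(1) by (intro exI[of _ "min d1 d2"]) auto
qed

end

text \<open>A tent: continuous substitute for the indicator of a point, which weak convergence
  cannot test.\<close>

definition bump :: "real \<Rightarrow> real \<Rightarrow> real \<Rightarrow> real" where
  "bump x0 \<delta> x = max 0 (1 - \<bar>x - x0\<bar> / \<delta>)"

lemma bump_bounds: "0 \<le> bump x0 \<delta> x" "\<delta> > 0 \<Longrightarrow> bump x0 \<delta> x \<le> 1" "bump x0 \<delta> x0 = 1"
  "\<delta> > 0 \<Longrightarrow> \<bar>x - x0\<bar> > \<delta> \<Longrightarrow> bump x0 \<delta> x = 0"
  by (auto simp: bump_def field_simps)

lemma continuous_on_bump: "\<delta> > 0 \<Longrightarrow> continuous_on A (bump x0 \<delta>)"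
  unfolding bump_def by (intro continuous_intros) auto

section \<open>Mass of the limit measure at a peak\<close>

context neumann_limit_measure
begin

lemma bump_integral_ge:
  assumes "x0 \<in> {0..1}" "\<delta> > 0"
  shows "measure \<mu> {x0} \<le> (\<integral>x. bump x0 \<delta> x \<partial>\<mu>)"
proof -
  interpret prob_space \<mu> by (rule \<mu>_prob)
  have s: "{x0} \<in> sets \<mu>" using assms(1) by (auto simp: \<mu>_sets sets_restrict_space intro!: image_eqI[of _ _ "{x0}"])
  have "measure \<mu> {x0} = (\<integral>x. indicator {x0} x \<partial>\<mu>)" using s by simp
  also have "\<dots> \<le> (\<integral>x. bump x0 \<delta> x \<partial>\<mu>)"
  proof (rule integral_mono)
    show "integrable \<mu> (indicator {x0} :: real \<Rightarrow> real)"
      using s by (intro integrable_real_indicator) (auto simp: less_top[symmetric])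
    show "integrable \<mu> (bump x0 \<delta>)"
      by (rule integrable_const_bound[where B = 1])
        (use bump_bounds(1)[of x0 \<delta>] bump_bounds(2)[of \<delta> x0] assms
          in \<open>auto intro!: borel_measurable_\<mu> continuous_on_bump\<close>)
  qed (auto simp: indicator_def bump_bounds)
  finally show ?thesis .
qed

lemma bump_integral_limit:
  assumes "x0 \<in> {0..1}"
  shows "(\<lambda>n. \<integral>x. bump x0 (1 / real (Suc n)) x \<partial>\<mu>) \<longlonglongrightarrow> measure \<mu> {x0}"
proof -
  interpret prob_space \<mu> by (rule \<mu>_prob)
  have s: "{x0} \<in> sets \<mu>" using assms(1) by (auto simp: \<mu>_sets sets_restrict_space intro!: image_eqI[of _ _ "{x0}"])
  have "(\<lambda>n. \<integral>x. bump x0 (1 / real (Suc n)) x \<partial>\<mu>) \<longlonglongrightarrow> (\<integral>x. indicator {x0} x \<partial>\<mu>)"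
  proof (rule integral_dominated_convergence[where w = "\<lambda>_. 1"])
    show "(indicator {x0} :: real \<Rightarrow> real) \<in> borel_measurable \<mu>" using s by simp
    show "bump x0 (1 / real (Suc n)) \<in> borel_measurable \<mu>" for n
      by (intro borel_measurable_\<mu> continuous_on_bump) simp
    show "AE x in \<mu>. (\<lambda>n. bump x0 (1 / real (Suc n)) x) \<longlonglongrightarrow> indicator {x0} x"
    proof (rule AE_I2)
      fix x
      show "(\<lambda>n. bump x0 (1 / real (Suc n)) x) \<longlonglongrightarrow> indicator {x0} x"
      proof (cases "x = x0")
        case False
        have "(\<lambda>n. 1 / real (Suc n)) \<longlonglongrightarrow> 0" using LIMSEQ_inverse_real_of_nat by (simp add: inverse_eq_divide)
        then have "\<forall>\<^sub>F n in sequentially. 1 / real (Suc n) < \<bar>x - x0\<bar>"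
          using False by (intro order_tendstoD(2)) auto
        then have "\<forall>\<^sub>F n in sequentially. bump x0 (1 / real (Suc n)) x = indicator {x0} x"
          by eventually_elim (use False in \<open>simp add: bump_bounds(4)\<close>)
        then show ?thesis by (rule tendsto_eventually)
      qed (simp add: bump_bounds)
    qed
    show "AE x in \<mu>. norm (bump x0 (1 / real (Suc n)) x) \<le> 1" for n
      using bump_bounds(1)[of x0 "1 / real (Suc n)"] bump_bounds(2)[of "1 / real (Suc n)" x0] by (auto intro!: AE_I2)
  qed simp
  then show ?thesis using s by simp
qed

text \<open>If the limit were below \<open>c x0\<close>, then w would vanish at \<open>x0\<close>
  and nearby be at most about sqrt (K \<delta>), leaving mass at most K \<delta>, less than \<mu>
  gives to the point.\<close>

lemma lam_limit_peak:
  assumes x0: "x0 \<in> M1 m" and mass: "measure \<mu> {x0} > 0"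
  shows "(lam \<longlongrightarrow> c x0) at_top"
proof -
  have x01: "x0 \<in> {0..1}" using x0 by (auto simp: M1_def)
  have "bounded (range (\<lambda>n. lam (t n)))"
    using lam_bounded[OF t_pos] by (auto intro!: boundedI)
  then obtain L r where r: "strict_mono (r :: nat \<Rightarrow> nat)" and L': "((\<lambda>n. lam (t n)) \<circ> r) \<longlonglongrightarrow> L"
    using bounded_imp_convergent_subsequence by blast
  have L: "(\<lambda>n. lam (t (r n))) \<longlonglongrightarrow> L" using L' by (simp add: o_def)
  have tr: "filterlim (\<lambda>n. t (r n)) at_top sequentially"
    using t_lim filterlim_subseq[OF r] by (rule filterlim_compose)
  have lam: "(lam \<longlongrightarrow> L) at_top" by (rule lam_tendsto_of_subsequence[OF t_pos tr L])
  have le: "L \<le> c x0"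
  proof (rule field_le_epsilon)
    fix e :: real assume "e > 0"
    then show "L \<le> c x0 + e"
      by (intro tendsto_upperbound[OF lam]) (auto intro: eventually_mono[OF lam_le_M1_value[OF x0]])
  qed
  have "\<not> L < c x0"
  proof
    assume "L < c x0"
    then have w0: "(\<lambda>n. w (t (r n)) x0) \<longlonglongrightarrow> 0"
      by (rule w_vanishes_below_M1_value[OF x0 t_pos tr L])
    obtain \<delta>0 where \<delta>0: "\<delta>0 > 0" "\<And>s x. s > 0 \<Longrightarrow> x \<in> {0..1} \<Longrightarrow> \<bar>x - x0\<bar> \<le> \<delta>0 \<Longrightarrow>
      \<bar>w s x - exp (s * (m x - m x0)) * w s x0\<bar> \<le> sqrt (K * \<bar>x - x0\<bar>)"
      using peak_transport[OF x0] by blast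
    obtain e where e: "e > 0" "\<And>y. y \<in> ({x0 - e<..<x0 + e} \<inter> {0..1}) - {x0} \<Longrightarrow> m y < m x0"
      using x0 by (auto simp: M1_def)
    \<comment> \<open>Within reach of the transport estimate, inside the range where
      \<open>x0\<close> is the maximum, and with \<open>K * \<delta>\<close> at most half the mass
      of the point.\<close>
    define \<delta> where "\<delta> = min (min \<delta>0 (e / 2)) (measure \<mu> {x0} / (2 * K))"
    have \<delta>: "\<delta> > 0" "\<delta> \<le> \<delta>0" "\<delta> < e" "K * \<delta> < measure \<mu> {x0}"
    proof -
      show "\<delta> > 0" "\<delta> \<le> \<delta>0" "\<delta> < e" using \<delta>0 e mass K1 by (auto simp: \<delta>_def min_def)
      have "\<delta> \<le> measure \<mu> {x0} / (2 * K)" by (simp add: \<delta>_def)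
      then have "K * \<delta> \<le> measure \<mu> {x0} / 2" using K1 by (simp add: field_simps)
      then show "K * \<delta> < measure \<mu> {x0}" using mass by linarith
    qed
    have "(\<integral>x. bump x0 \<delta> x \<partial>\<mu>) \<le> (0 + sqrt (K * \<delta>))\<^sup>2"
    proof (rule LIMSEQ_le)
      show "(\<lambda>n. integral {0..1} (\<lambda>x. (w (t (r n)) x)\<^sup>2 * bump x0 \<delta> x)) \<longlonglongrightarrow> (\<integral>x. bump x0 \<delta> x \<partial>\<mu>)"
        using LIMSEQ_subseq_LIMSEQ[OF \<mu>_lim[OF continuous_on_bump[OF \<delta>(1)]] r] by (simp add: o_def)
      show "(\<lambda>n. (w (t (r n)) x0 + sqrt (K * \<delta>))\<^sup>2) \<longlonglongrightarrow> (0 + sqrt (K * \<delta>))\<^sup>2"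
        by (intro tendsto_intros w0)
      show "\<exists>N. \<forall>n\<ge>N. integral {0..1} (\<lambda>x. (w (t (r n)) x)\<^sup>2 * bump x0 \<delta> x) \<le> (w (t (r n)) x0 + sqrt (K * \<delta>))\<^sup>2"
      proof (intro exI[of _ 0] allI impI)
        fix n
        let ?s = "t (r n)"
        have "integral {0..1} (\<lambda>x. (w ?s x)\<^sup>2 * bump x0 \<delta> x) \<le> integral {0..1 :: real} (\<lambda>x. (w ?s x0 + sqrt (K * \<delta>))\<^sup>2)"
        proof (rule integral_le)
          show "(\<lambda>x. (w ?s x)\<^sup>2 * bump x0 \<delta> x) integrable_on {0..1}"
            by (intro integrable_continuous_real continuous_intros cont_w t_pos continuous_on_bump \<delta>)
          fix x :: real assume x: "x \<in> {0..1}"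
          show "(w ?s x)\<^sup>2 * bump x0 \<delta> x \<le> (w ?s x0 + sqrt (K * \<delta>))\<^sup>2"
          proof (cases "\<bar>x - x0\<bar> \<le> \<delta>")
            case True
            have "m x \<le> m x0"
            proof (cases "x = x0")
              case False
              have "x \<in> ({x0 - e<..<x0 + e} \<inter> {0..1}) - {x0}" using True \<delta>(3) x False by auto
              then show ?thesis using e(2)[of x] by simp
            qed simp
            then have "exp (?s * (m x - m x0)) * w ?s x0 \<le> 1 * w ?s x0"
              using t_pos w_pos[OF t_pos x01] by (intro mult_right_mono) (auto simp: mult_le_0_iff less_imp_le)
            moreover have "sqrt (K * \<bar>x - x0\<bar>) \<le> sqrt (K * \<delta>)"
              using True K1 by (intro real_sqrt_le_mono mult_left_mono) auto
            ultimately have "w ?s x \<le> w ?s x0 + sqrt (K * \<delta>)"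
              using \<delta>0(2)[OF t_pos x, of "r n"] True \<delta> by linarith
            then have "(w ?s x)\<^sup>2 \<le> (w ?s x0 + sqrt (K * \<delta>))\<^sup>2"
              using w_pos[OF t_pos x] by (intro power_mono) (auto simp: less_imp_le)
            then have "(w ?s x)\<^sup>2 * bump x0 \<delta> x \<le> (w ?s x0 + sqrt (K * \<delta>))\<^sup>2 * 1"
              using bump_bounds \<delta> by (intro mult_mono) auto
            then show ?thesis by simp
          qed (use bump_bounds(4)[OF \<delta>(1)] in simp)
        qed auto
        then show "integral {0..1} (\<lambda>x. (w ?s x)\<^sup>2 * bump x0 \<delta> x) \<le> (w ?s x0 + sqrt (K * \<delta>))\<^sup>2" by simp
      qed
    qed
    also have "\<dots> = K * \<delta>" using K1 \<delta> by simp
    finally show False using bump_integral_ge[OF x01 \<delta>(1)] \<delta>(4) by linarith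
  qed
  then have "L = c x0" using le by simp
  then show ?thesis using lam by simp
qed

end

section \<open>Laplace asymptotics at a maximum of finite order\<close>

locale peak_profile = neumann_limit_measure +
  fixes x0 A :: real and k :: nat
  assumes x0_M1: "x0 \<in> M1 m" and mass: "measure \<mu> {x0} > 0" and k2: "k \<ge> 2" and A0: "A \<noteq> 0"
    and taylor: "((\<lambda>x. (m x - m x0) / (x - x0) ^ k) \<longlongrightarrow> A / fact k) (at x0 within {0..1})"
begin

definition \<beta> :: real where "\<beta> = A / fact k"
text \<open>The rescaled domain, closed so that it contains y = 0, the peak itself; the open
  half-lines of the final statement differ from it by a null set.\<close>

definition S :: "real set" where "S = (if x0 = 0 then {0..} else if x0 = 1 then {..0} else UNIV)"
text \<open>The concentration length, fixed by \<open>s * eps s ^ k = 1\<close>, which frees the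
  leading term of \<open>s * (m x - m x0)\<close> from s.\<close>

definition eps :: "real \<Rightarrow> real" where "eps s = s powr (- 1 / real k)"

lemma \<beta>0: "\<beta> \<noteq> 0" using A0 by (simp add: \<beta>_def)

lemma x01: "x0 \<in> {0..1}" using x0_M1 by (auto simp: M1_def)

lemma below_peak: "\<exists>d>0. \<forall>x\<in>{0..1}. \<bar>x - x0\<bar> < d \<longrightarrow> x \<noteq> x0 \<longrightarrow> m x < m x0"
proof -
  obtain e where e: "e > 0" "\<And>y. y \<in> ({x0 - e<..<x0 + e} \<inter> {0..1}) - {x0} \<Longrightarrow> m y < m x0"
    using x0_M1 by (auto simp: M1_def)
  have "m x < m x0" if "x \<in> {0..1}" "\<bar>x - x0\<bar> < e" "x \<noteq> x0" for x
    by (rule e(2)) (use that in auto)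
  then show ?thesis using e(1) by blast
qed

lemma eps_pos: "s > 0 \<Longrightarrow> eps s > 0" by (simp add: eps_def)

lemma eps_power: "s > 0 \<Longrightarrow> s * eps s ^ k = 1"
proof -
  assume s: "s > 0"
  have "eps s ^ k = eps s powr real k" by (rule powr_realpow[OF eps_pos[OF s], symmetric])
  also have "\<dots> = s powr - 1" using k2 by (simp add: eps_def powr_powr)
  finally show ?thesis using s by (simp add: powr_minus)
qed

lemma eps_tendsto: "(eps \<longlongrightarrow> 0) at_top"
  unfolding eps_def using k2 by (intro tendsto_neg_powr filterlim_ident) (simp add: field_simps)

lemma in_S: "s > 0 \<Longrightarrow> x0 + eps s * y \<in> {0..1} \<Longrightarrow> y \<in> S"
  using eps_pos[of s] by (auto simp: S_def zero_le_mult_iff mult_le_0_iff)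

lemma eventually_inside: "\<forall>\<^sub>F s in at_top. \<forall>y\<in>S. \<bar>y\<bar> \<le> R \<longrightarrow> x0 + eps s * y \<in> {0..1}"
proof -
  define d where "d = (if x0 = 0 \<or> x0 = 1 then 1 else min x0 (1 - x0))"
  have d: "d > 0" using x01 by (auto simp: d_def)
  have "((\<lambda>s. eps s * \<bar>R\<bar>) \<longlongrightarrow> 0 * \<bar>R\<bar>) at_top" by (intro tendsto_intros eps_tendsto)
  then have "\<forall>\<^sub>F s in at_top. eps s * \<bar>R\<bar> < d" using d by (intro order_tendstoD(2)) auto
  then show ?thesis using eventually_gt_at_top[of 0]
  proof eventually_elim
    case (elim s)
    show ?case
    proof (intro ballI impI)
      fix y assume y: "y \<in> S" "\<bar>y\<bar> \<le> R"
      have "\<bar>eps s * y\<bar> \<le> eps s * \<bar>R\<bar>"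
        using y(2) eps_pos[OF elim(2)] by (simp add: abs_mult mult_left_mono)
      then have lt: "\<bar>eps s * y\<bar> < d" using elim(1) by linarith
      have "x0 = 0 \<Longrightarrow> 0 \<le> eps s * y" "x0 = 1 \<Longrightarrow> eps s * y \<le> 0"
        using y(1)[unfolded S_def] eps_pos[OF elim(2)] by (simp_all add: mult_le_0_iff)
      then show "x0 + eps s * y \<in> {0..1}"
        using lt x01 by (auto simp: d_def abs_less_iff split: if_splits)
    qed
  qed
qed

text \<open>The Taylor quotient is multiplied by \<open>y ^ k\<close>, so the tolerance is divided
  by a bound for \<open>\<bar>y\<bar> ^ k\<close>, with 1 added to keep the divisor
  positive.\<close>

lemma exponent_limit:
  assumes "\<eta> > 0"
  shows "\<forall>\<^sub>F s in at_top. \<forall>y\<in>S. \<bar>y\<bar> \<le> R \<longrightarrow> \<bar>s * (m (x0 + eps s * y) - m x0) - \<beta> * y ^ k\<bar> \<le> \<eta>"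
proof -
  have R1: "\<bar>R\<bar> ^ k + 1 > 0" by (simp add: add_nonneg_pos)
  then have "\<forall>\<^sub>F x in at x0 within {0..1}. dist ((m x - m x0) / (x - x0) ^ k) \<beta> < \<eta> / (\<bar>R\<bar> ^ k + 1)"
    using taylor assms unfolding \<beta>_def by (intro tendstoD) auto
  then obtain d where d: "d > 0" "\<And>x. x \<in> {0..1} \<Longrightarrow> x \<noteq> x0 \<Longrightarrow> dist x x0 < d \<Longrightarrow>
      dist ((m x - m x0) / (x - x0) ^ k) \<beta> < \<eta> / (\<bar>R\<bar> ^ k + 1)"
    unfolding eventually_at by blast
  have "((\<lambda>s. eps s * \<bar>R\<bar>) \<longlongrightarrow> 0 * \<bar>R\<bar>) at_top" by (intro tendsto_intros eps_tendsto)
  then have "\<forall>\<^sub>F s in at_top. eps s * \<bar>R\<bar> < d" using d by (intro order_tendstoD(2)) auto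
  then show ?thesis using eventually_gt_at_top[of 0] eventually_inside[of R]
  proof eventually_elim
    case (elim s)
    show ?case
    proof (intro ballI impI)
      fix y assume y: "y \<in> S" "\<bar>y\<bar> \<le> R"
      have yR: "\<bar>y\<bar> \<le> \<bar>R\<bar>" using y(2) by linarith
      show "\<bar>s * (m (x0 + eps s * y) - m x0) - \<beta> * y ^ k\<bar> \<le> \<eta>"
      proof (cases "y = 0")
        case True
        then show ?thesis using assms k2 by (simp add: power_0_left)
      next
        case False
        let ?x = "x0 + eps s * y"
        have ne: "eps s * y \<noteq> 0" using False eps_pos[OF elim(2)] by simp
        have "\<bar>eps s * y\<bar> \<le> eps s * \<bar>R\<bar>"
          using yR eps_pos[OF elim(2)] by (simp add: abs_mult mult_left_mono)
        then have "\<bar>(m ?x - m x0) / (eps s * y) ^ k - \<beta>\<bar> < \<eta> / (\<bar>R\<bar> ^ k + 1)"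
          using d(2)[of ?x] elim y ne by (auto simp: dist_real_def)
        then have "\<bar>(m ?x - m x0) / (eps s * y) ^ k - \<beta>\<bar> * \<bar>y\<bar> ^ k \<le> \<eta> / (\<bar>R\<bar> ^ k + 1) * (\<bar>R\<bar> ^ k + 1)"
          using power_mono[OF yR, of k] assms R1 by (intro mult_mono) auto
        then have "\<bar>(m ?x - m x0) / (eps s * y) ^ k - \<beta>\<bar> * \<bar>y\<bar> ^ k \<le> \<eta>" using R1 by simp
        moreover have "s * (m ?x - m x0) - \<beta> * y ^ k = ((m ?x - m x0) / (eps s * y) ^ k - \<beta>) * y ^ k"
        proof -
          have "s = 1 / eps s ^ k" using eps_power[OF elim(2)] eps_pos[OF elim(2)] by (simp add: field_simps)
          then have "s * (m ?x - m x0) = (m ?x - m x0) / eps s ^ k" by (metis mult.left_neutral times_divide_eq_left)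
          moreover have "(m ?x - m x0) / (eps s * y) ^ k * y ^ k = (m ?x - m x0) / eps s ^ k"
            using False by (simp add: power_mult_distrib)
          ultimately show ?thesis by (simp only: left_diff_distrib)
        qed
        ultimately show ?thesis by (simp add: abs_mult power_abs)
      qed
    qed
  qed
qed

lemma exponent_tendsto:
  assumes "y \<in> S"
  shows "((\<lambda>s. s * (m (x0 + eps s * y) - m x0)) \<longlongrightarrow> \<beta> * y ^ k) at_top"
proof (rule tendstoI)
  fix e :: real assume "e > 0"
  then have "\<forall>\<^sub>F s in at_top. \<forall>z\<in>S. \<bar>z\<bar> \<le> \<bar>y\<bar> \<longrightarrow> \<bar>s * (m (x0 + eps s * z) - m x0) - \<beta> * z ^ k\<bar> \<le> e / 2"
    by (intro exponent_limit) simp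
  then show "\<forall>\<^sub>F s in at_top. dist (s * (m (x0 + eps s * y) - m x0)) (\<beta> * y ^ k) < e"
  proof eventually_elim
    case (elim s)
    then have "\<bar>s * (m (x0 + eps s * y) - m x0) - \<beta> * y ^ k\<bar> \<le> e / 2" using assms by blast
    then show ?case using \<open>e > 0\<close> by (simp add: dist_real_def)
  qed
qed

lemma eventually_exponent_nonpos: "\<forall>\<^sub>F s in at_top. \<forall>y\<in>S. \<bar>y\<bar> \<le> R \<longrightarrow> s * (m (x0 + eps s * y) - m x0) \<le> 0"
proof -
  obtain d where d: "d > 0" "\<forall>x\<in>{0..1}. \<bar>x - x0\<bar> < d \<longrightarrow> x \<noteq> x0 \<longrightarrow> m x < m x0"
    using below_peak by blast
  have "((\<lambda>s. eps s * \<bar>R\<bar>) \<longlongrightarrow> 0 * \<bar>R\<bar>) at_top" by (intro tendsto_intros eps_tendsto)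
  then have "\<forall>\<^sub>F s in at_top. eps s * \<bar>R\<bar> < d" using d by (intro order_tendstoD(2)) auto
  then show ?thesis using eventually_gt_at_top[of 0] eventually_inside[of R]
  proof eventually_elim
    case (elim s)
    show ?case
    proof (intro ballI impI)
      fix y assume y: "y \<in> S" "\<bar>y\<bar> \<le> R"
      have yR: "\<bar>y\<bar> \<le> \<bar>R\<bar>" using y(2) by linarith
      have "\<bar>eps s * y\<bar> \<le> eps s * \<bar>R\<bar>"
        using yR eps_pos[OF elim(2)] by (simp add: abs_mult mult_left_mono)
      then have "\<bar>(x0 + eps s * y) - x0\<bar> < d" using elim(1) by simp
      moreover have "x0 + eps s * y \<in> {0..1}" using elim(3) y by blast
      ultimately have "m (x0 + eps s * y) \<le> m x0"
        using d(2) by (cases "x0 + eps s * y = x0") (auto intro: less_imp_le)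
      then show "s * (m (x0 + eps s * y) - m x0) \<le> 0" using elim(2) by (simp add: mult_le_0_iff)
    qed
  qed
qed

text \<open>The sign is inherited from the nonpositive exponents in the limit and not from the
  parity of k, because at an endpoint k may be odd.\<close>

lemma \<beta>_nonpos:
  assumes y: "y \<in> S" shows "\<beta> * y ^ k \<le> 0" "\<beta> * y ^ k = - (\<bar>\<beta>\<bar> * \<bar>y\<bar> ^ k)"
proof -
  have "\<forall>\<^sub>F s in at_top. s * (m (x0 + eps s * y) - m x0) \<le> 0"
    using eventually_exponent_nonpos[of "\<bar>y\<bar>"] by eventually_elim (use y in auto)
  then show le: "\<beta> * y ^ k \<le> 0"
    by (intro tendsto_upperbound[OF exponent_tendsto[OF y]]) auto
  then have "\<bar>\<beta> * y ^ k\<bar> = - (\<beta> * y ^ k)" by simp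
  then show "\<beta> * y ^ k = - (\<bar>\<beta>\<bar> * \<bar>y\<bar> ^ k)" by (simp add: abs_mult power_abs)
qed

text \<open>Half of the leading coefficient absorbs the Taylor error; this is the source of the
  domination in Laplace's method.\<close>

lemma potential_upper_bound:
  "\<exists>\<delta>>0. \<forall>x\<in>{0..1}. \<bar>x - x0\<bar> \<le> \<delta> \<longrightarrow> m x - m x0 \<le> - (\<bar>\<beta>\<bar> / 2 * \<bar>x - x0\<bar> ^ k)"
proof -
  have "\<forall>\<^sub>F x in at x0 within {0..1}. dist ((m x - m x0) / (x - x0) ^ k) \<beta> < \<bar>\<beta>\<bar> / 2"
    using taylor \<beta>0 unfolding \<beta>_def[symmetric] by (intro tendstoD) auto
  then obtain d where d: "d > 0" "\<And>x. x \<in> {0..1} \<Longrightarrow> x \<noteq> x0 \<Longrightarrow> dist x x0 < d \<Longrightarrow>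
      dist ((m x - m x0) / (x - x0) ^ k) \<beta> < \<bar>\<beta>\<bar> / 2"
    unfolding eventually_at by blast
  obtain d' where d': "d' > 0" "\<forall>x\<in>{0..1}. \<bar>x - x0\<bar> < d' \<longrightarrow> x \<noteq> x0 \<longrightarrow> m x < m x0"
    using below_peak by blast
  have "m x - m x0 \<le> - (\<bar>\<beta>\<bar> / 2 * \<bar>x - x0\<bar> ^ k)" if x: "x \<in> {0..1}" "\<bar>x - x0\<bar> \<le> min d d' / 2" for x
  proof (cases "x = x0")
    case True
    then show ?thesis using k2 by (simp add: power_0_left)
  next
    case False
    have "min d d' / 2 < d" "min d d' / 2 < d'" using d d' by (auto simp: min_def)
    then have near: "\<bar>x - x0\<bar> < d" "\<bar>x - x0\<bar> < d'" using x(2) by linarith+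
    have "\<bar>\<beta>\<bar> / 2 \<le> \<bar>(m x - m x0) / (x - x0) ^ k\<bar>"
      using d(2)[OF x(1) False] near unfolding dist_real_def by linarith
    then have "\<bar>\<beta>\<bar> / 2 * \<bar>x - x0\<bar> ^ k \<le> \<bar>m x - m x0\<bar>"
      using False by (simp add: abs_divide power_abs field_simps)
    then show ?thesis using d'(2) x(1) near(2) False by auto
  qed
  then show ?thesis using d(1) d'(1) by (intro exI[of _ "min d d' / 2"]) auto
qed

section \<open>Laplace's method for the rescaled mass\<close>

definition I :: real where "I = integral S (\<lambda>y. exp (2 * (\<beta> * y ^ k)))"

text \<open>The squared L2 norm near \<open>x0\<close> of the comparison function
  \<open>exp (s * (m x - m x0))\<close>, localized by the bump.\<close>

definition Nrm :: "real \<Rightarrow> real \<Rightarrow> real" where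
  "Nrm \<delta> s = integral {0..1} (\<lambda>x. exp (2 * s * (m x - m x0)) * bump x0 \<delta> x)"

lemma dominating_integrable: "a > 0 \<Longrightarrow> (\<lambda>y. exp (- (a * \<bar>y\<bar>))) integrable_on S"
  using exp_abs_integrable[of a] by (simp add: S_def)

text \<open>Trades the power for a linear function, so that one exponential dominates for every
  k.\<close>

lemma abs_le_power: "\<bar>y\<bar> - 1 \<le> \<bar>y\<bar> ^ k" for y :: real
proof (cases "\<bar>y\<bar> \<ge> 1")
  case True
  then have "\<bar>y\<bar> \<le> \<bar>y\<bar> ^ k" using k2 by (intro self_le_power) auto
  then show ?thesis by linarith
next
  case False
  then show ?thesis using zero_le_power[of "\<bar>y\<bar>" k] by linarith
qed

text \<open>The substitution x = \<open>x0 + eps s * y\<close> turns \<open>Nrm\<close> into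
  \<open>eps s\<close> times an integral over S, and dominated convergence gives both its limit I
  and the integrability of the limit function.\<close>

lemma profile_integrable: "(\<lambda>y. exp (2 * (\<beta> * y ^ k))) integrable_on S"
  and I_pos: "I > 0"
  and Laplace: "\<exists>\<delta>1>0. \<forall>\<delta>. 0 < \<delta> \<longrightarrow> \<delta> \<le> \<delta>1 \<longrightarrow> (\<lambda>n. Nrm \<delta> (t n) / eps (t n)) \<longlonglongrightarrow> I"
proof -
  obtain \<delta>1 where \<delta>1: "\<delta>1 > 0" "\<And>x. x \<in> {0..1} \<Longrightarrow> \<bar>x - x0\<bar> \<le> \<delta>1 \<Longrightarrow>
      m x - m x0 \<le> - (\<bar>\<beta>\<bar> / 2 * \<bar>x - x0\<bar> ^ k)"
    using potential_upper_bound by blast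
  have main: "(\<lambda>y. exp (2 * (\<beta> * y ^ k))) integrable_on S \<and> (\<lambda>n. Nrm \<delta> (t n) / eps (t n)) \<longlonglongrightarrow> I"
    if \<delta>: "0 < \<delta>" "\<delta> \<le> \<delta>1" for \<delta>
  proof -
    define F where "F s x = exp (2 * s * (m x - m x0)) * bump x0 \<delta> x" for s x
    define f where "f s y = (if x0 + eps s * y \<in> {0..1} then F s (x0 + eps s * y) else 0)" for s y
    have hi: "(f s has_integral Nrm \<delta> s / eps s) S" if s: "s > 0" for s
    proof -
      note e = eps_pos[OF s]
      have "(F s has_integral Nrm \<delta> s) {0..1}"
        unfolding F_def[abs_def] Nrm_def
        by (intro integrable_integral integrable_continuous_real continuous_intros m_cont continuous_on_bump \<delta>)
      then have "((\<lambda>y. F s (eps s * y + x0)) has_integral Nrm \<delta> s / eps s) {(0 - x0) / eps s..(1 - x0) / eps s}"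
        using has_integral_affinity'[of "F s" "Nrm \<delta> s" 0 1 "eps s" x0] e by (simp add: divide_inverse mult.commute)
      moreover have "{(0 - x0) / eps s..(1 - x0) / eps s} = {y. x0 + eps s * y \<in> {0..1}}"
        using e by (auto simp: field_simps)
      ultimately have "((\<lambda>y. F s (x0 + eps s * y)) has_integral Nrm \<delta> s / eps s) {y. x0 + eps s * y \<in> {0..1}}"
        by (simp add: add.commute)
      moreover have "{y. x0 + eps s * y \<in> {0..1}} \<subseteq> S" using in_S[OF s] by blast
      ultimately have "((\<lambda>y. if y \<in> {y. x0 + eps s * y \<in> {0..1}} then F s (x0 + eps s * y) else 0)
          has_integral Nrm \<delta> s / eps s) S"
        by (subst has_integral_restrict)
      then show ?thesis by (simp add: f_def[abs_def])
    qed
    have lim: "(\<lambda>n. f (t n) y) \<longlonglongrightarrow> exp (2 * (\<beta> * y ^ k))" if y: "y \<in> S" for y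
    proof -
      have "((\<lambda>s. exp (2 * (s * (m (x0 + eps s * y) - m x0))) * bump x0 \<delta> (x0 + eps s * y))
          \<longlongrightarrow> exp (2 * (\<beta> * y ^ k)) * bump x0 \<delta> (x0 + 0 * y)) at_top"
      proof (intro tendsto_mult[of "\<lambda>s. exp (2 * (s * (m (x0 + eps s * y) - m x0)))"] tendsto_exp
            tendsto_mult[OF tendsto_const exponent_tendsto[OF y]])
        have "isCont (bump x0 \<delta>) (x0 + 0 * y)"
          using continuous_on_bump[OF \<delta>(1), of UNIV x0] by (simp add: continuous_on_eq_continuous_at)
        moreover have "((\<lambda>s. x0 + eps s * y) \<longlongrightarrow> x0 + 0 * y) at_top"
          by (intro tendsto_intros eps_tendsto)
        ultimately show "((\<lambda>s. bump x0 \<delta> (x0 + eps s * y)) \<longlongrightarrow> bump x0 \<delta> (x0 + 0 * y)) at_top"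
          by (rule isCont_tendsto_compose)
      qed
      moreover have "\<forall>\<^sub>F s in at_top. exp (2 * (s * (m (x0 + eps s * y) - m x0))) * bump x0 \<delta> (x0 + eps s * y) = f s y"
        using eventually_inside[of "\<bar>y\<bar>"]
        by eventually_elim (use y in \<open>auto simp: f_def F_def mult.assoc\<close>)
      ultimately have "((\<lambda>s. f s y) \<longlongrightarrow> exp (2 * (\<beta> * y ^ k)) * bump x0 \<delta> (x0 + 0 * y)) at_top"
        by (rule Lim_transform_eventually)
      then have "((\<lambda>s. f s y) \<longlongrightarrow> exp (2 * (\<beta> * y ^ k))) at_top" by (simp add: bump_bounds)
      then show ?thesis using t_lim by (rule filterlim_compose)
    qed
    have bound: "norm (f s y) \<le> exp \<bar>\<beta>\<bar> * exp (- (\<bar>\<beta>\<bar> * \<bar>y\<bar>))" if s: "s > 0" for s y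
    proof (cases "x0 + eps s * y \<in> {0..1} \<and> \<bar>eps s * y\<bar> \<le> \<delta>")
      case True
      then have "m (x0 + eps s * y) - m x0 \<le> - (\<bar>\<beta>\<bar> / 2 * \<bar>eps s * y\<bar> ^ k)"
        using \<delta>1(2)[of "x0 + eps s * y"] \<delta> by auto
      then have "2 * s * (m (x0 + eps s * y) - m x0) \<le> 2 * s * - (\<bar>\<beta>\<bar> / 2 * \<bar>eps s * y\<bar> ^ k)"
        using s by (intro mult_left_mono) auto
      also have "\<dots> = - (\<bar>\<beta>\<bar> * ((s * eps s ^ k) * \<bar>y\<bar> ^ k))"
        using eps_pos[OF s] by (simp add: abs_mult power_mult_distrib)
      also have "\<dots> = - (\<bar>\<beta>\<bar> * \<bar>y\<bar> ^ k)" by (simp add: eps_power[OF s])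
      also have "\<dots> \<le> - (\<bar>\<beta>\<bar> * (\<bar>y\<bar> - 1))"
        using abs_le_power[of y] by (simp add: mult_left_mono)
      finally have "exp (2 * s * (m (x0 + eps s * y) - m x0)) \<le> exp (\<bar>\<beta>\<bar> - \<bar>\<beta>\<bar> * \<bar>y\<bar>)"
        by (simp add: algebra_simps)
      also have "\<dots> = exp \<bar>\<beta>\<bar> * exp (- (\<bar>\<beta>\<bar> * \<bar>y\<bar>))" by (simp flip: exp_add)
      finally have "exp (2 * s * (m (x0 + eps s * y) - m x0)) * bump x0 \<delta> (x0 + eps s * y)
          \<le> (exp \<bar>\<beta>\<bar> * exp (- (\<bar>\<beta>\<bar> * \<bar>y\<bar>))) * 1"
        using bump_bounds \<delta> by (intro mult_mono) auto
      then show ?thesis using True bump_bounds(1) by (simp add: f_def F_def abs_mult)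
    next
      case False
      then have "f s y = 0" using bump_bounds(4)[OF \<delta>(1), of "x0 + eps s * y" x0] by (auto simp: f_def F_def)
      then show ?thesis by simp
    qed
    have dom: "(\<lambda>y. exp \<bar>\<beta>\<bar> * exp (- (\<bar>\<beta>\<bar> * \<bar>y\<bar>))) integrable_on S"
      using dominating_integrable[of "\<bar>\<beta>\<bar>"] \<beta>0 by (intro integrable_on_mult_right) auto
    have fi: "f (t n) integrable_on S" for n using hi[OF t_pos] by blast
    have "(\<lambda>n. integral S (f (t n))) \<longlonglongrightarrow> integral S (\<lambda>y. exp (2 * (\<beta> * y ^ k)))"
      by (rule dominated_convergence(2)[OF fi dom bound[OF t_pos] lim])
    moreover have "integral S (f (t n)) = Nrm \<delta> (t n) / eps (t n)" for n
      by (rule integral_unique[OF hi[OF t_pos]])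
    moreover have "(\<lambda>y. exp (2 * (\<beta> * y ^ k))) integrable_on S"
      by (rule dominated_convergence(1)[OF fi dom bound[OF t_pos] lim])
    ultimately show ?thesis by (simp add: I_def)
  qed
  then show int: "(\<lambda>y. exp (2 * (\<beta> * y ^ k))) integrable_on S" using \<delta>1(1) by blast
  show "\<exists>\<delta>1>0. \<forall>\<delta>. 0 < \<delta> \<longrightarrow> \<delta> \<le> \<delta>1 \<longrightarrow> (\<lambda>n. Nrm \<delta> (t n) / eps (t n)) \<longlonglongrightarrow> I"
    using main \<delta>1(1) by blast
  \<comment> \<open>A unit interval inside S, on which the integrand is at least
    \<open>exp (- (2 * \<bar>\<beta>\<bar>))\<close>; it bounds I from below.\<close>
  define J :: "real set" where "J = (if x0 = 1 then {- 1..0} else {0..1})"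
  have J: "J \<subseteq> S" by (auto simp: J_def S_def)
  have "exp (- (2 * \<bar>\<beta>\<bar>)) = integral J (\<lambda>y. exp (- (2 * \<bar>\<beta>\<bar>)))" by (simp add: J_def)
  also have "\<dots> \<le> integral J (\<lambda>y. exp (2 * (\<beta> * y ^ k)))"
  proof (rule integral_le)
    show "(\<lambda>y. exp (- (2 * \<bar>\<beta>\<bar>))) integrable_on J"
      "(\<lambda>y. exp (2 * (\<beta> * y ^ k))) integrable_on J"
      unfolding J_def by (auto intro!: integrable_continuous_real continuous_intros)
    fix y assume y: "y \<in> J"
    have "\<bar>y\<bar> ^ k \<le> 1" using y by (intro power_le_one) (auto simp: J_def split: if_splits)
    then have "\<bar>\<beta>\<bar> * \<bar>y\<bar> ^ k \<le> \<bar>\<beta>\<bar> * 1" by (intro mult_left_mono) auto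
    then show "exp (- (2 * \<bar>\<beta>\<bar>)) \<le> exp (2 * (\<beta> * y ^ k))"
    proof -
      have "y \<in> S" using y J by blast
      from \<beta>_nonpos(2)[OF this] show ?thesis using \<open>\<bar>\<beta>\<bar> * \<bar>y\<bar> ^ k \<le> \<bar>\<beta>\<bar> * 1\<close> by simp
    qed
  qed
  also have "\<dots> \<le> I"
    unfolding I_def
    by (rule integral_subset_le[OF J _ int])
      (auto simp: J_def intro!: integrable_continuous_real continuous_intros)
  finally show "I > 0" by (meson exp_gt_zero less_le_trans)
qed

text \<open>The amplitude of the rescaled w at y = 0, up to the factor that contains the
  mass.\<close>

definition \<alpha> :: "nat \<Rightarrow> real" where "\<alpha> n = w (t n) x0 * sqrt (eps (t n))"

lemma \<alpha>_nonneg: "\<alpha> n \<ge> 0"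
  using w_pos[OF t_pos x01] eps_pos[OF t_pos] by (simp add: \<alpha>_def less_imp_le)

text \<open>Compares w with its exponential shape by the reverse triangle inequality in L2. The
  error does not depend on n, so \<delta> can be sent to 0 after n.\<close>

lemma peak_L2_estimate:
  "\<exists>\<delta>1>0. \<forall>\<delta>. 0 < \<delta> \<longrightarrow> \<delta> \<le> \<delta>1 \<longrightarrow> (\<forall>n.
    \<bar>sqrt (integral {0..1} (\<lambda>x. (w (t n) x)\<^sup>2 * bump x0 \<delta> x)) - \<alpha> n * sqrt (Nrm \<delta> (t n) / eps (t n))\<bar>
      \<le> sqrt (K * \<delta>))"
proof -
  obtain \<delta>1 where \<delta>1: "\<delta>1 > 0" "\<And>s x. s > 0 \<Longrightarrow> x \<in> {0..1} \<Longrightarrow> \<bar>x - x0\<bar> \<le> \<delta>1 \<Longrightarrow>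
    \<bar>w s x - exp (s * (m x - m x0)) * w s x0\<bar> \<le> sqrt (K * \<bar>x - x0\<bar>)"
    using peak_transport[OF x0_M1] by blast
  have "\<bar>sqrt (integral {0..1} (\<lambda>x. (w (t n) x)\<^sup>2 * bump x0 \<delta> x)) - \<alpha> n * sqrt (Nrm \<delta> (t n) / eps (t n))\<bar>
      \<le> sqrt (K * \<delta>)" if \<delta>: "0 < \<delta>" "\<delta> \<le> \<delta>1" for \<delta> n
  proof -
    let ?s = "t n"
    \<comment> \<open>The square root of the bump makes the squares carry exactly the weight tested
      against \<mu>.\<close>
    define f where "f x = w ?s x * sqrt (bump x0 \<delta> x)" for x
    define h where "h x = w ?s x0 * (exp (?s * (m x - m x0)) * sqrt (bump x0 \<delta> x))" for x
    have cf: "continuous_on {0..1} f" and ch: "continuous_on {0..1} h"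
      unfolding f_def[abs_def] h_def[abs_def]
      by (intro continuous_intros cont_w t_pos m_cont continuous_on_bump \<delta>)+
    have "integral {0..1} (\<lambda>x. (f x - h x)\<^sup>2) \<le> integral {0..1 :: real} (\<lambda>x. K * \<delta>)"
    proof (rule integral_le)
      show "(\<lambda>x. (f x - h x)\<^sup>2) integrable_on {0..1}"
        by (intro integrable_continuous_real continuous_intros cf ch)
      fix x :: real assume x: "x \<in> {0..1}"
      have eq: "(f x - h x)\<^sup>2 = (w ?s x - exp (?s * (m x - m x0)) * w ?s x0)\<^sup>2 * bump x0 \<delta> x"
      proof -
        have "f x - h x = (w ?s x - exp (?s * (m x - m x0)) * w ?s x0) * sqrt (bump x0 \<delta> x)"
          by (simp add: f_def h_def algebra_simps)
        then show ?thesis by (simp add: power_mult_distrib bump_bounds)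
      qed
      show "(f x - h x)\<^sup>2 \<le> K * \<delta>"
      proof (cases "\<bar>x - x0\<bar> \<le> \<delta>")
        case True
        have "\<bar>w ?s x - exp (?s * (m x - m x0)) * w ?s x0\<bar> \<le> sqrt (K * \<bar>x - x0\<bar>)"
          using \<delta>1(2)[OF t_pos x] True \<delta> by simp
        also have "\<dots> \<le> sqrt (K * \<delta>)"
          using True K1 by (intro real_sqrt_le_mono mult_left_mono) auto
        finally have "\<bar>w ?s x - exp (?s * (m x - m x0)) * w ?s x0\<bar>\<^sup>2 \<le> (sqrt (K * \<delta>))\<^sup>2"
          by (intro power_mono) auto
        then have "(w ?s x - exp (?s * (m x - m x0)) * w ?s x0)\<^sup>2 * bump x0 \<delta> x \<le> (K * \<delta>) * 1"
          using K1 \<delta> bump_bounds by (intro mult_mono) auto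
        then show ?thesis by (simp add: eq)
      next
        case False
        then show ?thesis using bump_bounds(4)[OF \<delta>(1), of x x0] K1 \<delta> by (simp add: eq)
      qed
    qed auto
    then have "integral {0..1} (\<lambda>x. (f x - h x)\<^sup>2) \<le> K * \<delta>" by simp
    from L2_norm_diff_le[OF cf ch this]
    have "\<bar>sqrt (integral {0..1} (\<lambda>x. (f x)\<^sup>2)) - sqrt (integral {0..1} (\<lambda>x. (h x)\<^sup>2))\<bar> \<le> sqrt (K * \<delta>)" .
    moreover have "(\<lambda>x. (f x)\<^sup>2) = (\<lambda>x. (w ?s x)\<^sup>2 * bump x0 \<delta> x)"
      by (simp add: f_def power_mult_distrib bump_bounds)
    moreover have "(\<lambda>x. (h x)\<^sup>2) = (\<lambda>x. (w ?s x0)\<^sup>2 * (exp (2 * ?s * (m x - m x0)) * bump x0 \<delta> x))"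
      by (simp add: h_def power_mult_distrib bump_bounds mult.assoc flip: exp_double)
    moreover have "sqrt ((w ?s x0)\<^sup>2 * Nrm \<delta> ?s) = \<alpha> n * sqrt (Nrm \<delta> ?s / eps ?s)"
      using w_pos[OF t_pos x01, of n] eps_pos[OF t_pos, of n]
      by (simp add: \<alpha>_def real_sqrt_mult real_sqrt_divide less_imp_le)
    ultimately show ?thesis by (simp add: Nrm_def)
  qed
  then show ?thesis using \<delta>1(1) by blast
qed

text \<open>An iterated limit: for fixed \<delta> mass and normalization converge in n, then the
  bump shrinks to the point. A bound on \<alpha> is obtained first, so that the normalization may be
  replaced by its limit.\<close>

lemma \<alpha>_limit: "\<alpha> \<longlonglongrightarrow> sqrt (measure \<mu> {x0}) / sqrt I"
proof -
  obtain d1 where d1: "d1 > 0" "\<And>\<delta>. 0 < \<delta> \<Longrightarrow> \<delta> \<le> d1 \<Longrightarrow> (\<lambda>n. Nrm \<delta> (t n) / eps (t n)) \<longlonglongrightarrow> I"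
    using Laplace by blast
  obtain d2 where d2: "d2 > 0" "\<And>\<delta> n. 0 < \<delta> \<Longrightarrow> \<delta> \<le> d2 \<Longrightarrow>
    \<bar>sqrt (integral {0..1} (\<lambda>x. (w (t n) x)\<^sup>2 * bump x0 \<delta> x)) - \<alpha> n * sqrt (Nrm \<delta> (t n) / eps (t n))\<bar>
      \<le> sqrt (K * \<delta>)"
    using peak_L2_estimate by blast
  define q where "q \<delta> n = sqrt (Nrm \<delta> (t n) / eps (t n))" for \<delta> n
  define P where "P \<delta> n = sqrt (integral {0..1} (\<lambda>x. (w (t n) x)\<^sup>2 * bump x0 \<delta> x))" for \<delta> n
  define p where "p \<delta> = sqrt (\<integral>x. bump x0 \<delta> x \<partial>\<mu>)" for \<delta>
  have q: "q \<delta> \<longlonglongrightarrow> sqrt I" if "0 < \<delta>" "\<delta> \<le> d1" for \<delta>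
    unfolding q_def by (intro tendsto_real_sqrt d1 that)
  have P: "P \<delta> \<longlonglongrightarrow> p \<delta>" if "0 < \<delta>" for \<delta>
    unfolding P_def p_def by (intro tendsto_real_sqrt \<mu>_lim continuous_on_bump that)
  have Pq: "\<bar>P \<delta> n - \<alpha> n * q \<delta> n\<bar> \<le> sqrt (K * \<delta>)" if "0 < \<delta>" "\<delta> \<le> d2" for \<delta> n
    using d2(2)[OF that] by (simp add: P_def q_def)
  define d where "d = min d1 d2"
  have d: "0 < d" "d \<le> d1" "d \<le> d2" using d1 d2 by (auto simp: d_def)
  obtain B where B: "B > 0" "\<forall>\<^sub>F n in sequentially. \<alpha> n \<le> B"
  proof -
    \<comment> \<open>The numerator eventually bounds \<alpha> times the normalization
      \<open>q d\<close>, which is eventually above the denominator, half its limit.\<close>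
    define B where "B = (p d + 1 + sqrt (K * d)) / (sqrt I / 2)"
    have "p d \<ge> 0" using bump_integral_ge[OF x01 d(1)] mass by (simp add: p_def)
    moreover have "sqrt (K * d) \<ge> 0" using K1 d by simp
    ultimately have num: "p d + 1 + sqrt (K * d) > 0" by linarith
    have "\<forall>\<^sub>F n in sequentially. sqrt I / 2 < q d n"
      using q[OF d(1,2)] I_pos by (intro order_tendstoD(1)) auto
    moreover have "\<forall>\<^sub>F n in sequentially. P d n < p d + 1"
      using P[OF d(1)] by (intro order_tendstoD(2)) auto
    ultimately have "\<forall>\<^sub>F n in sequentially. \<alpha> n \<le> B"
    proof eventually_elim
      case (elim n)
      have "\<alpha> n * (sqrt I / 2) \<le> \<alpha> n * q d n" using elim(1) \<alpha>_nonneg[of n] by (intro mult_left_mono) auto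
      also have "\<dots> \<le> p d + 1 + sqrt (K * d)" using Pq[OF d(1,3), of n] elim(2) by linarith
      finally show ?case using I_pos by (simp add: B_def field_simps)
    qed
    moreover have "B > 0" using num I_pos by (simp add: B_def)
    ultimately show ?thesis using that by blast
  qed
  have "(\<lambda>n. \<alpha> n * sqrt I) \<longlonglongrightarrow> sqrt (measure \<mu> {x0})"
  proof (rule tendstoI)
    fix e :: real assume e: "e > 0"
    have small: "(\<lambda>i. 1 / real (Suc i)) \<longlonglongrightarrow> 0"
      using LIMSEQ_inverse_real_of_nat by (simp add: inverse_eq_divide)
    have "(\<lambda>i. sqrt (K * (1 / real (Suc i)))) \<longlonglongrightarrow> sqrt (K * 0)"
      by (intro tendsto_real_sqrt tendsto_mult tendsto_const small)
    then have 1: "\<forall>\<^sub>F i in sequentially. sqrt (K * (1 / real (Suc i))) < e / 4"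
      using e by (intro order_tendstoD(2)) auto
    have "(\<lambda>i. p (1 / real (Suc i))) \<longlonglongrightarrow> sqrt (measure \<mu> {x0})"
      unfolding p_def by (intro tendsto_real_sqrt bump_integral_limit x01)
    then have 2: "\<forall>\<^sub>F i in sequentially. dist (p (1 / real (Suc i))) (sqrt (measure \<mu> {x0})) < e / 4"
      using e by (intro tendstoD) auto
    have 3: "\<forall>\<^sub>F i in sequentially. 1 / real (Suc i) < d"
      using small d(1) by (intro order_tendstoD(2)) auto
    have "\<forall>\<^sub>F i in sequentially. sqrt (K * (1 / real (Suc i))) < e / 4 \<and>
        dist (p (1 / real (Suc i))) (sqrt (measure \<mu> {x0})) < e / 4 \<and> 1 / real (Suc i) < d"
      using 1 2 3 by eventually_elim simp
    then obtain i where i: "sqrt (K * (1 / real (Suc i))) < e / 4"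
      "dist (p (1 / real (Suc i))) (sqrt (measure \<mu> {x0})) < e / 4" "1 / real (Suc i) < d"
      by (elim eventually_happens'[OF sequentially_bot, THEN exE] conjE)
    define \<delta> where "\<delta> = 1 / real (Suc i)"
    have \<delta>: "0 < \<delta>" "\<delta> \<le> d1" "\<delta> \<le> d2" using i(3) d by (auto simp: \<delta>_def)
    have a: "\<forall>\<^sub>F n in sequentially. dist (P \<delta> n) (p \<delta>) < e / 4"
      using P[OF \<delta>(1)] e by (intro tendstoD) auto
    have b: "\<forall>\<^sub>F n in sequentially. dist (q \<delta> n) (sqrt I) < e / 4 / B"
      using q[OF \<delta>(1,2)] e B(1) by (intro tendstoD) auto
    show "\<forall>\<^sub>F n in sequentially. dist (\<alpha> n * sqrt I) (sqrt (measure \<mu> {x0})) < e"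
      using a b B(2)
    proof eventually_elim
      case (elim n)
      have "\<bar>\<alpha> n * sqrt I - \<alpha> n * q \<delta> n\<bar> = \<alpha> n * \<bar>sqrt I - q \<delta> n\<bar>"
        using \<alpha>_nonneg[of n] by (simp add: abs_mult flip: right_diff_distrib)
      also have "\<dots> \<le> B * (e / 4 / B)"
        using elim(2,3) \<alpha>_nonneg[of n] by (intro mult_mono) (auto simp: dist_real_def abs_minus_commute)
      also have "\<dots> = e / 4" using B(1) by simp
      finally have "\<bar>\<alpha> n * sqrt I - \<alpha> n * q \<delta> n\<bar> \<le> e / 4" .
      moreover have "\<bar>P \<delta> n - \<alpha> n * q \<delta> n\<bar> < e / 4"
        using Pq[OF \<delta>(1,3), of n] i(1) by (simp add: \<delta>_def)
      moreover have "\<bar>P \<delta> n - p \<delta>\<bar> < e / 4" using elim(1) by (simp add: dist_real_def)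
      moreover have "\<bar>p \<delta> - sqrt (measure \<mu> {x0})\<bar> < e / 4" using i(2) by (simp add: dist_real_def \<delta>_def)
      ultimately show ?case unfolding dist_real_def by linarith
    qed
  qed
  then have "(\<lambda>n. \<alpha> n * sqrt I / sqrt I) \<longlonglongrightarrow> sqrt (measure \<mu> {x0}) / sqrt I"
    using I_pos by (intro tendsto_divide) auto
  then show ?thesis using I_pos by simp
qed

end

text \<open>W solves a first-order linear equation; differentiating that equation once more gives
  the two terms of the profile equation, and the factorials come from A / k! losing one factor at a
  time.\<close>

lemma exp_profile_derivatives:
  fixes A B y :: real
  assumes "k \<ge> 2"
  defines "W \<equiv> \<lambda>y. B * exp (A / fact k * y ^ k)"
  shows "(W has_real_derivative A / fact (k - 1) * y ^ (k - 1) * W y) (at y)"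
    "((\<lambda>y. A / fact (k - 1) * y ^ (k - 1) * W y) has_real_derivative
      (((A / fact (k - 1)) ^ 2 * y ^ (2 * (k - 1)) + (A / fact (k - 2)) * y ^ (k - 2)) * W y)) (at y)"
proof -
  obtain n where k: "k = Suc (Suc n)"
    using assms(1) le_Suc_ex[of 2 k] by (auto simp: numeral_2_eq_2)
  have f: "fact k = real k * fact (k - 1)" "fact (k - 1) = real (k - 1) * fact (k - 2)"
    by (simp_all add: k del: of_nat_Suc)
  have "(W has_real_derivative B * (exp (A / fact k * y ^ k) * (A / fact k * (real k * y ^ (k - 1))))) (at y)"
    for y unfolding W_def by (auto intro!: derivative_eq_intros)
  moreover have "B * (exp (A / fact k * y ^ k) * (A / fact k * (real k * y ^ (k - 1))))
      = A / fact (k - 1) * y ^ (k - 1) * W y" for y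
  proof -
    have "A / fact k * real k = A / fact (k - 1)" using k by (subst f(1)) simp
    then have "B * (exp (A / fact k * y ^ k) * ((A / fact k * real k) * y ^ (k - 1)))
        = B * (exp (A / fact k * y ^ k) * (A / fact (k - 1) * y ^ (k - 1)))" by simp
    then show ?thesis unfolding W_def by (simp only: mult_ac)
  qed
  ultimately have d: "(W has_real_derivative A / fact (k - 1) * y ^ (k - 1) * W y) (at y)" for y
    by simp
  then show "(W has_real_derivative A / fact (k - 1) * y ^ (k - 1) * W y) (at y)" .
  have "((\<lambda>y. A / fact (k - 1) * y ^ (k - 1) * W y) has_real_derivative
      A / fact (k - 1) * (real (k - 1) * y ^ (k - 1 - 1)) * W y
      + A / fact (k - 1) * y ^ (k - 1) * W y * (A / fact (k - 1) * y ^ (k - 1))) (at y)"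
    using DERIV_mult[OF DERIV_cmult[OF DERIV_pow[of "k - 1" y UNIV], of "A / fact (k - 1)"] d[of y]]
    by (simp only: One_nat_def)
  also have "A / fact (k - 1) * (real (k - 1) * y ^ (k - 1 - 1)) * W y
      + A / fact (k - 1) * y ^ (k - 1) * W y * (A / fact (k - 1) * y ^ (k - 1))
    = ((A / fact (k - 1)) ^ 2 * y ^ (2 * (k - 1)) + (A / fact (k - 2)) * y ^ (k - 2)) * W y"
  proof -
    have "A / fact (k - 1) * real (k - 1) = A / fact (k - 2)"
      using k by (subst f(2)) simp
    then have "A / fact (k - 1) * (real (k - 1) * y ^ (k - 1 - 1)) = A / fact (k - 2) * y ^ (k - 2)"
      by (simp only: mult.assoc[symmetric]) (simp add: numeral_2_eq_2)
    moreover have "y ^ (2 * (k - 1)) = y ^ (k - 1) * y ^ (k - 1)"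
      by (simp add: mult_2 power_add)
    moreover have "a * w + p * z * w * (p * z) = (p\<^sup>2 * (z * z) + a) * w" for a w p z :: real
      by (simp add: power2_eq_square algebra_simps)
    ultimately show ?thesis by (simp only:)
  qed
  finally show "((\<lambda>y. A / fact (k - 1) * y ^ (k - 1) * W y) has_real_derivative
      (((A / fact (k - 1)) ^ 2 * y ^ (2 * (k - 1)) + (A / fact (k - 2)) * y ^ (k - 2)) * W y)) (at y)" .
qed

context peak_profile
begin

text \<open>The rescaled limit of \<open>exp (s * (m x - m x0))\<close>, divided by sqrt I to have
  unit mass.\<close>

definition W :: "real \<Rightarrow> real" where "W y = 1 / sqrt I * exp (A / fact k * y ^ k)"

lemma sqrt_eps: "s > 0 \<Longrightarrow> s powr (- 1 / (2 * real k)) = sqrt (eps s)"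
  using eps_pos[of s] by (simp add: eps_def powr_powr mult.commute flip: powr_half_sqrt)

lemma W_positive_profile:
  assumes R: "R \<subseteq> S" "negligible (S - R)"
  shows "positive_profile A k R W"
proof -
  have "((\<lambda>y. exp (2 * (\<beta> * y ^ k))) has_integral I) S"
    unfolding I_def by (rule integrable_integral[OF profile_integrable])
  then have "((\<lambda>y. 1 / I * exp (2 * (\<beta> * y ^ k))) has_integral 1 / I * I) S"
    by (rule has_integral_mult_right)
  moreover have "(\<lambda>y. 1 / I * exp (2 * (\<beta> * y ^ k))) = (\<lambda>y. (W y)\<^sup>2)"
  proof
    fix y
    show "1 / I * exp (2 * (\<beta> * y ^ k)) = (W y)\<^sup>2"
      using I_pos unfolding W_def \<beta>_def exp_double by (simp add: power_mult_distrib power_divide)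
  qed
  ultimately have "((\<lambda>y. (W y)\<^sup>2) has_integral 1) S" using I_pos by simp
  then have "((\<lambda>y. (W y)\<^sup>2) has_integral 1) R"
    using R by (subst has_integral_spike_set_eq[of R S]) (auto intro: negligible_subset)
  moreover have "W y > 0" for y using I_pos by (simp add: W_def)
  moreover have "(W has_real_derivative A / fact (k - 1) * y ^ (k - 1) * W y) (at y)"
    "((\<lambda>y. A / fact (k - 1) * y ^ (k - 1) * W y) has_real_derivative
      (((A / fact (k - 1)) ^ 2 * y ^ (2 * (k - 1)) + (A / fact (k - 2)) * y ^ (k - 2)) * W y)) (at y)" for y
    unfolding W_def[abs_def] by (rule exp_profile_derivatives[OF k2])+
  ultimately show ?thesis
    unfolding positive_profile_def
    by (intro conjI ballI exI[of _ "\<lambda>y. A / fact (k - 1) * y ^ (k - 1) * W y"]) auto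
qed

text \<open>The rescaled w is \<open>c0 * \<alpha> n * E n y\<close>, whose factors converge by the
  amplitude and exponent limits, plus an error from \<open>peak_transport\<close> with bound
  \<open>c0 * sqrt (eps s) * sqrt (K * (eps s * R))\<close>, which vanishes.\<close>

lemma profile_limit:
  assumes "R \<ge> 0"
  shows "uniform_limit {y\<in>S. \<bar>y\<bar> \<le> R} (\<lambda>n. rescaled w \<mu> x0 k (t n)) W sequentially"
proof -
  let ?S = "{y\<in>S. \<bar>y\<bar> \<le> R}"
  define c0 where "c0 = measure \<mu> {x0} powr (- 1 / 2)"
  have c0: "c0 > 0" using mass by (simp add: c0_def)
  have c0M: "c0 * sqrt (measure \<mu> {x0}) = 1"
  proof -
    have "sqrt (measure \<mu> {x0}) = measure \<mu> {x0} powr (1 / 2)" using mass by (simp add: powr_half_sqrt)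
    then have "c0 * sqrt (measure \<mu> {x0}) = measure \<mu> {x0} powr (- 1 / 2 + 1 / 2)"
      unfolding c0_def by (simp only: powr_add)
    also have "\<dots> = measure \<mu> {x0} powr 0" by simp
    finally show ?thesis using mass by simp
  qed
  define E where "E n y = exp (t n * (m (x0 + eps (t n) * y) - m x0))" for n y
  have E: "uniform_limit ?S E (\<lambda>y. exp (\<beta> * y ^ k)) sequentially"
  proof (rule uniform_limitI)
    fix e :: real assume "e > 0"
    have "\<forall>\<^sub>F s in at_top. \<forall>y\<in>?S. dist (exp (s * (m (x0 + eps s * y) - m x0))) (exp (\<beta> * y ^ k)) < e"
      using exponent_limit[of "e / 2" R, OF half_gt_zero[OF \<open>e > 0\<close>]] eventually_exponent_nonpos[of R]
    proof eventually_elim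
      case (elim s)
      show ?case
      proof
        fix y assume y: "y \<in> ?S"
        have "\<bar>exp (s * (m (x0 + eps s * y) - m x0)) - exp (\<beta> * y ^ k)\<bar>
            \<le> \<bar>s * (m (x0 + eps s * y) - m x0) - \<beta> * y ^ k\<bar>"
          using elim(2) y \<beta>_nonpos(1) by (intro abs_exp_diff_le) auto
        also have "\<dots> \<le> e / 2" using elim(1) y by blast
        finally show "dist (exp (s * (m (x0 + eps s * y) - m x0))) (exp (\<beta> * y ^ k)) < e"
          using \<open>e > 0\<close> by (simp add: dist_real_def)
      qed
    qed
    then show "\<forall>\<^sub>F n in sequentially. \<forall>y\<in>?S. dist (E n y) (exp (\<beta> * y ^ k)) < e"
      unfolding E_def using t_lim by (rule eventually_compose_filterlim)
  qed
  have "(\<lambda>n. c0 * \<alpha> n) \<longlonglongrightarrow> c0 * (sqrt (measure \<mu> {x0}) / sqrt I)"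
    by (intro tendsto_intros \<alpha>_limit)
  then have "(\<lambda>n. c0 * \<alpha> n) \<longlonglongrightarrow> 1 / sqrt I" using c0M by (simp add: times_divide_eq_right)
  then have "uniform_limit ?S (\<lambda>n y. c0 * \<alpha> n) (\<lambda>y. 1 / sqrt I) sequentially"
    by (auto simp: uniform_limit_iff tendsto_iff elim: eventually_mono)
  then have "uniform_limit ?S (\<lambda>n y. c0 * \<alpha> n * E n y) (\<lambda>y. 1 / sqrt I * exp (\<beta> * y ^ k)) sequentially"
  proof (rule uniform_lim_mult[OF _ E])
    show "bounded ((\<lambda>y. 1 / sqrt I) ` ?S)" by (auto intro!: boundedI[where B = "norm (1 / sqrt I)"])
    show "bounded ((\<lambda>y. exp (\<beta> * y ^ k)) ` ?S)"
      using \<beta>_nonpos(1) by (auto intro!: boundedI[where B = 1])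
  qed
  then have lim: "uniform_limit ?S (\<lambda>n y. c0 * \<alpha> n * E n y) W sequentially"
    by (simp add: W_def[abs_def] \<beta>_def)
  obtain \<delta>0 where \<delta>0: "\<delta>0 > 0" "\<And>s x. s > 0 \<Longrightarrow> x \<in> {0..1} \<Longrightarrow> \<bar>x - x0\<bar> \<le> \<delta>0 \<Longrightarrow>
    \<bar>w s x - exp (s * (m x - m x0)) * w s x0\<bar> \<le> sqrt (K * \<bar>x - x0\<bar>)"
    using peak_transport[OF x0_M1] by blast
  have err: "\<forall>\<^sub>F s in at_top. \<forall>y\<in>?S. s > 0 \<longrightarrow>
      \<bar>w s (x0 + eps s * y) - exp (s * (m (x0 + eps s * y) - m x0)) * w s x0\<bar> \<le> sqrt (K * (eps s * R))"
  proof -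
    have "((\<lambda>s. eps s * R) \<longlongrightarrow> 0 * R) at_top" by (intro tendsto_intros eps_tendsto)
    then have "\<forall>\<^sub>F s in at_top. eps s * R < \<delta>0" using \<delta>0 by (intro order_tendstoD(2)) auto
    then show ?thesis using eventually_inside[of R]
    proof eventually_elim
      case (elim s)
      show ?case
      proof (intro ballI impI)
        fix y assume y: "y \<in> ?S" and s: "s > 0"
        have le: "\<bar>(x0 + eps s * y) - x0\<bar> \<le> eps s * R"
          using y eps_pos[OF s] by (simp add: abs_mult mult_left_mono)
        then have "\<bar>w s (x0 + eps s * y) - exp (s * (m (x0 + eps s * y) - m x0)) * w s x0\<bar>
            \<le> sqrt (K * \<bar>(x0 + eps s * y) - x0\<bar>)"
          using elim y by (intro \<delta>0(2) s) auto
        also have "\<dots> \<le> sqrt (K * (eps s * R))"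
          using le K1 by (intro real_sqrt_le_mono mult_left_mono) auto
        finally show "\<bar>w s (x0 + eps s * y) - exp (s * (m (x0 + eps s * y) - m x0)) * w s x0\<bar>
            \<le> sqrt (K * (eps s * R))" .
      qed
    qed
  qed
  have diff: "uniform_limit ?S (\<lambda>n y. rescaled w \<mu> x0 k (t n) y - c0 * \<alpha> n * E n y) (\<lambda>_. 0) sequentially"
  proof (rule uniform_limitI)
    fix e :: real assume "e > 0"
    have "((\<lambda>s. c0 * sqrt (eps s) * sqrt (K * (eps s * R))) \<longlongrightarrow> c0 * sqrt 0 * sqrt (K * (0 * R))) at_top"
      by (intro tendsto_intros eps_tendsto)
    then have "\<forall>\<^sub>F s in at_top. c0 * sqrt (eps s) * sqrt (K * (eps s * R)) < e"
      using \<open>e > 0\<close> by (intro order_tendstoD(2)) auto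
    then have small: "\<forall>\<^sub>F n in sequentially. c0 * sqrt (eps (t n)) * sqrt (K * (eps (t n) * R)) < e"
      using t_lim by (rule eventually_compose_filterlim)
    show "\<forall>\<^sub>F n in sequentially. \<forall>y\<in>?S. dist (rescaled w \<mu> x0 k (t n) y - c0 * \<alpha> n * E n y) 0 < e"
      using small eventually_compose_filterlim[OF err t_lim]
    proof eventually_elim
      case (elim n)
      show ?case
      proof
        fix y assume y: "y \<in> ?S"
        have "rescaled w \<mu> x0 k (t n) y - c0 * \<alpha> n * E n y
            = c0 * sqrt (eps (t n)) * (w (t n) (x0 + eps (t n) * y) - E n y * w (t n) x0)"
          unfolding rescaled_def c0_def[symmetric] sqrt_eps[OF t_pos] \<alpha>_def eps_def[symmetric]
          by (simp add: algebra_simps)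
        moreover have "\<bar>w (t n) (x0 + eps (t n) * y) - E n y * w (t n) x0\<bar> \<le> sqrt (K * (eps (t n) * R))"
          using elim(2) y t_pos[of n] unfolding E_def by blast
        ultimately have "\<bar>rescaled w \<mu> x0 k (t n) y - c0 * \<alpha> n * E n y\<bar>
            \<le> c0 * sqrt (eps (t n)) * sqrt (K * (eps (t n) * R))"
          using c0 eps_pos[OF t_pos, of n] by (simp add: abs_mult mult_left_mono)
        then show "dist (rescaled w \<mu> x0 k (t n) y - c0 * \<alpha> n * E n y) 0 < e"
          using elim(1) by (simp add: dist_real_def)
      qed
    qed
  qed
  from uniform_limit_add[OF diff lim] show ?thesis by simp
qed

end

section \<open>Eigenfunctions relative to an interval\<close>

lemma vector_derivative_within_Icc:
  fixes f :: "real \<Rightarrow> real"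
  assumes "(f has_real_derivative d) (at x within {a..b})" "a < b" "x \<in> {a..b}"
  shows "vector_derivative f (at x within {a..b}) = d"
  using assms by (intro vector_derivative_within_closed_interval)
    (auto simp: has_real_derivative_iff_has_vector_derivative)

lemma nderiv_1_eq:
  assumes "a < b" "x \<in> {a..b}" "(f has_real_derivative d) (at x within {a..b})"
  shows "nderiv {a..b} 1 f x = d"
  using vector_derivative_within_Icc[OF assms(3,1,2)] by simp

lemma nderiv_2_eq:
  assumes "a < b" and f: "\<And>x. x \<in> {a..b} \<Longrightarrow> (f has_real_derivative f' x) (at x within {a..b})"
    and f': "\<And>x. x \<in> {a..b} \<Longrightarrow> (f' has_real_derivative f'' x) (at x within {a..b})" and x: "x \<in> {a..b}"
  shows "nderiv {a..b} 2 f x = f'' x"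
    and "(nderiv {a..b} 1 f has_real_derivative f'' x) (at x within {a..b})"
proof -
  show d: "(nderiv {a..b} 1 f has_real_derivative f'' x) (at x within {a..b})"
    by (rule has_field_derivative_transform_within[OF f'[OF x] zero_less_one x])
      (rule nderiv_1_eq[symmetric, OF \<open>a < b\<close> _ f])
  show "nderiv {a..b} 2 f x = f'' x"
    using vector_derivative_within_Icc[OF d \<open>a < b\<close> x] by (simp add: numeral_2_eq_2)
qed

lemma Ck_on_2D:
  assumes "Ck_on 2 S f" "x \<in> S"
  shows "(f has_real_derivative nderiv S 1 f x) (at x within S)"
    and "(nderiv S 1 f has_real_derivative nderiv S 2 f x) (at x within S)"
  using assms by (auto simp: Ck_on_def has_real_derivative_iff_has_vector_derivative
      vector_derivative_works numeral_2_eq_2 less_Suc_eq)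

lemma Ck_on_2_continuous:
  assumes "Ck_on 2 S f"
  shows "continuous_on S f" "continuous_on S (nderiv S 1 f)" "continuous_on S (nderiv S 2 f)"
  using assms unfolding Ck_on_def by (metis zero_le nderiv.simps(1), metis one_le_numeral, metis order_refl)

lemma continuous_eq_on_Icc:
  fixes f h :: "real \<Rightarrow> real"
  assumes "a < b" "continuous_on {a..b} f" "continuous_on {a..b} h"
    and eq: "\<And>x. x \<in> {a<..<b} \<Longrightarrow> f x = h x" and x: "x \<in> {a..b}"
  shows "f x = h x"
proof -
  have "f x - h x = 0"
  proof (rule continuous_constant_on_closure[where S = "{a<..<b}" and f = "\<lambda>x. f x - h x"])
    show "continuous_on (closure {a<..<b}) (\<lambda>x. f x - h x)"
      using assms(1-3) by (auto intro!: continuous_intros)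
  qed (use assms in auto)
  then show ?thesis by simp
qed

text \<open>The equation is given in the open interval; continuity of the second derivative extends
  it to the ends, where the first-order system is used as well.\<close>

lemma eigenfunctionD:
  assumes e: "eigenfunction i j a b p c L u" and "a < b"
    and p: "continuous_on {a..b} p" and c: "continuous_on {a..b} c" and x: "x \<in> {a..b}"
  shows "(u has_real_derivative nderiv {a..b} 1 u x) (at x within {a..b})"
    and "(nderiv {a..b} 1 u has_real_derivative (c x - L) * u x - p x * nderiv {a..b} 1 u x) (at x within {a..b})"
proof -
  have C: "Ck_on 2 {a..b} u" using e by (simp add: eigenfunction_def)
  show "(u has_real_derivative nderiv {a..b} 1 u x) (at x within {a..b})" by (rule Ck_on_2D[OF C x])
  have "nderiv {a..b} 2 u x = (c x - L) * u x - p x * nderiv {a..b} 1 u x"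
  proof (rule continuous_eq_on_Icc[OF \<open>a < b\<close> Ck_on_2_continuous(3)[OF C] _ _ x])
    show "continuous_on {a..b} (\<lambda>x. (c x - L) * u x - p x * nderiv {a..b} 1 u x)"
      by (intro continuous_intros c p Ck_on_2_continuous[OF C])
    show "nderiv {a..b} 2 u x = (c x - L) * u x - p x * nderiv {a..b} 1 u x" if "x \<in> {a<..<b}" for x
      using e that unfolding eigenfunction_def by (auto simp: algebra_simps dest!: bspec[where x = x])
  qed
  then show "(nderiv {a..b} 1 u has_real_derivative (c x - L) * u x - p x * nderiv {a..b} 1 u x) (at x within {a..b})"
    using Ck_on_2D(2)[OF C x] by simp
qed

lemma bdry_cond_iff_bc: "bdry_cond i S u x \<longleftrightarrow> bc i (u x) (nderiv S 1 u x)"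
  by (cases i) (simp_all add: bc_def)

lemma solves_eigenfunction:
  assumes "a < b" and c: "continuous_on {a..b} c" and s: "solves c L a b u v"
    and "bc i (u a) (v a)" "bc j (u b) (v b)" and "x \<in> {a..b}" "u x \<noteq> 0"
  shows "eigenfunction i j a b (\<lambda>_. 0) c L u"
proof -
  note d = solvesD[OF s]
  have n1: "nderiv {a..b} 1 u y = v y" if "y \<in> {a..b}" for y
    by (rule nderiv_1_eq[OF \<open>a < b\<close> that d(1)[OF that]])
  have n2: "nderiv {a..b} 2 u y = (c y - L) * u y" if "y \<in> {a..b}" for y
    by (rule nderiv_2_eq(1)[OF \<open>a < b\<close> d that])
  have n1d: "(nderiv {a..b} 1 u has_real_derivative (c y - L) * u y) (at y within {a..b})" if "y \<in> {a..b}" for y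
    by (rule nderiv_2_eq(2)[OF \<open>a < b\<close> d that])
  have "Ck_on 2 {a..b} u"
    unfolding Ck_on_def
  proof (intro conjI allI impI ballI)
    fix l y assume l: "l < (2 :: nat)" and y: "y \<in> {a..b}"
    then consider "l = 0" | "l = 1" by linarith
    then show "nderiv {a..b} l u differentiable (at y within {a..b})"
      using d(1)[OF y] n1d[OF y] by cases (auto intro: differentiableI simp: has_field_derivative_def
          simp del: nderiv.simps(2) One_nat_def)
  next
    fix l assume l: "l \<le> (2 :: nat)"
    then consider "l = 0" | "l = 1" | "l = 2" by linarith
    then show "continuous_on {a..b} (nderiv {a..b} l u)"
    proof cases
      case 1
      then show ?thesis using solves_continuous[OF s] by simp
    next
      case 2
      have "continuous_on {a..b} (nderiv {a..b} 1 u)"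
        by (rule continuous_on_eq[OF solves_continuous(2)[OF s]]) (rule n1[symmetric])
      then show ?thesis using 2 by (simp only:)
    next
      case 3
      have "continuous_on {a..b} (\<lambda>y. (c y - L) * u y)" by (intro continuous_intros c solves_continuous[OF s])
      then have "continuous_on {a..b} (nderiv {a..b} 2 u)"
        by (rule continuous_on_eq) (rule n2[symmetric])
      then show ?thesis using 3 by (simp only:)
    qed
  qed
  moreover have "a \<in> {a..b}" "b \<in> {a..b}" using \<open>a < b\<close> by auto
  ultimately show ?thesis
    unfolding eigenfunction_def bdry_cond_iff_bc
    using n1 n2 assms(4-7) by (auto simp: algebra_simps)
qed

text \<open>A solution positive inside exhibits the value, and the Wronskian argument supplies the
  uniqueness behind the definite description.\<close>

lemma lambda1_eq:
  assumes "a < b" and c: "continuous_on {a..b} c" and s: "solves c L a b u v"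
    and pos: "\<forall>x\<in>{a<..<b}. u x > 0" and bcs: "bc i (u a) (v a)" "bc j (u b) (v b)"
  shows "lambda1 i j c a b = L" "eigenfunction i j a b (\<lambda>_. 0) c L u"
proof -
  have mid: "(a + b) / 2 \<in> {a<..<b}" using \<open>a < b\<close> by auto
  then have "u ((a + b) / 2) > 0" by (rule bspec[OF pos])
  then have mid': "(a + b) / 2 \<in> {a..b}" "u ((a + b) / 2) \<noteq> 0" using \<open>a < b\<close> by auto
  show e: "eigenfunction i j a b (\<lambda>_. 0) c L u"
    by (rule solves_eigenfunction[OF assms(1-3) bcs mid'])
  show "lambda1 i j c a b = L"
    unfolding lambda1_def principal_eigenvalue_def
  proof (rule the_equality)
    show "\<exists>\<phi>. eigenfunction i j a b (\<lambda>_. 0) c L \<phi> \<and> (\<forall>x\<in>{a<..<b}. \<phi> x > 0)" using e pos by blast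
    fix L' assume "\<exists>\<phi>. eigenfunction i j a b (\<lambda>_. 0) c L' \<phi> \<and> (\<forall>x\<in>{a<..<b}. \<phi> x > 0)"
    then obtain \<phi> where \<phi>: "eigenfunction i j a b (\<lambda>_. 0) c L' \<phi>" "\<forall>x\<in>{a<..<b}. \<phi> x > 0" by blast
    have "solves c L' a b \<phi> (nderiv {a..b} 1 \<phi>)"
      unfolding solves_def
      using eigenfunctionD[OF \<phi>(1) \<open>a < b\<close> continuous_on_const c] by auto
    moreover have "bc i (\<phi> a) (nderiv {a..b} 1 \<phi> a)" "bc j (\<phi> b) (nderiv {a..b} 1 \<phi> b)"
      using \<phi>(1) by (auto simp: eigenfunction_def bdry_cond_iff_bc)
    ultimately show "L' = L"
      using solves_principal_value_unique[OF \<open>a < b\<close> _ s] \<phi>(2) pos bcs by blast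
  qed
qed

section \<open>Endpoints of segments\<close>

lemma uniform_limit_transfer:
  assumes "uniform_limit X f h F" "\<forall>\<^sub>F n in F. \<forall>x\<in>X. f' n x = f n x" "\<And>x. x \<in> X \<Longrightarrow> h' x = h x"
  shows "uniform_limit X f' h' F"
proof (rule uniform_limitI)
  fix e :: real assume "e > 0"
  have "\<forall>\<^sub>F n in F. \<forall>x\<in>X. dist (f n x) (h x) < e" by (rule uniform_limitD[OF assms(1) \<open>e > 0\<close>])
  then show "\<forall>\<^sub>F n in F. \<forall>x\<in>X. dist (f' n x) (h' x) < e"
    using assms(2) by eventually_elim (use assms(3) in simp)
qed

text \<open>Before any t there is a point where n has left its level at b; weak monotonicity keeps
  \<open>n t\<close> at least as high.\<close>

lemma rises_rightI:
  assumes "b < 1" "0 \<le> b" "e > 0" and mono: "mono_on ({b..b + e} \<inter> {0..1}) n"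
    and nc: "\<And>t. b < t \<Longrightarrow> t \<le> 1 \<Longrightarrow> \<exists>x\<in>{b..t}. n x \<noteq> n b"
  shows "rises_right n b"
proof -
  define y where "y = min (b + e) 1"
  have y: "b < y" "y \<le> 1" and sub: "{b..y} \<subseteq> {b..b + e} \<inter> {0..1}" using assms(1-3) by (auto simp: y_def)
  have mo: "mono_on {b..y} n" by (rule mono_on_subset[OF mono sub])
  have "n b < n t" if t: "t \<in> {b<..y}" for t
  proof -
    obtain x where x: "x \<in> {b..t}" "n x \<noteq> n b" using nc[of t] t y by auto
    have "n b \<le> n x" "n x \<le> n t" using mono_onD[OF mo, of b x] mono_onD[OF mo, of x t] x t by auto
    then show ?thesis using x(2) by linarith
  qed
  then show ?thesis using y mo unfolding rises_right_def by blast
qed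

lemma nderiv_zero_of_constant:
  assumes "x \<in> {p<..<q}" "{p<..<q} \<subseteq> {0..1}" "\<And>z. z \<in> {p<..<q} \<Longrightarrow> m z = (C :: real)"
  shows "nderiv {0..1} 1 m x = 0"
proof (rule nderiv_1_eq)
  have "((\<lambda>_. C) has_real_derivative 0) (at x)" by simp
  then have "(m has_real_derivative 0) (at x)"
    by (rule has_field_derivative_transform_within_open[of _ _ _ "{p<..<q}"]) (use assms in auto)
  then show "(m has_real_derivative 0) (at x within {0..1})" by (rule has_field_derivative_at_within)
qed (use assms in auto)

text \<open>Constancy on {b..t} would make the derivative vanish on the open interval, against the
  segment condition for some e below t - b.\<close>

lemma not_constant_right:
  assumes nz: "\<forall>\<^sub>F e in at_right 0. \<exists>x\<in>{b<..<b + e}. nderiv {0..1} 1 m x \<noteq> 0"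
    and "0 \<le> b" "b < t" "t \<le> 1"
  shows "\<exists>x\<in>{b..t}. m x \<noteq> m b"
proof (rule ccontr)
  assume const: "\<not> ?thesis"
  have "\<forall>\<^sub>F e in at_right 0. e < t - b"
    using assms by (intro order_tendstoD(2)[OF tendsto_ident_at]) auto
  with nz have "\<forall>\<^sub>F e in at_right 0. (\<exists>x\<in>{b<..<b + e}. nderiv {0..1} 1 m x \<noteq> 0) \<and> e < t - b"
    by (rule eventually_conj)
  then obtain e x where e: "e < t - b" "x \<in> {b<..<b + e}" "nderiv {0..1} 1 m x \<noteq> 0"
    using eventually_happens'[OF trivial_limit_at_right_real[of 0]] by blast
  have "nderiv {0..1} 1 m x = 0"
  proof (rule nderiv_zero_of_constant[where p = b and q = t and C = "m b"])
    show "x \<in> {b<..<t}" "{b<..<t} \<subseteq> {0..1}" using e(1,2) assms(2-4) by auto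
    show "m z = m b" if "z \<in> {b<..<t}" for z
    proof -
      have "z \<in> {b..t}" using that by simp
      then show ?thesis using const by blast
    qed
  qed
  then show False using e(3) by simp
qed

lemma not_constant_left:
  assumes nz: "\<forall>\<^sub>F e in at_right 0. \<exists>x\<in>{a - e<..<a}. nderiv {0..1} 1 m x \<noteq> 0"
    and "1 - a < t" "t \<le> 1" "a \<le> 1"
  shows "\<exists>x\<in>{1 - a..t}. m (1 - x) \<noteq> m (1 - (1 - a))"
proof (rule ccontr)
  assume const: "\<not> ?thesis"
  have const': "m z = m a" if "z \<in> {1 - t..a}" for z
  proof -
    have "1 - z \<in> {1 - a..t}" using that by auto
    then have "m (1 - (1 - z)) = m (1 - (1 - a))" using const by blast
    then show ?thesis by simp
  qed
  have "\<forall>\<^sub>F e in at_right 0. e < t - (1 - a)"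
    using assms by (intro order_tendstoD(2)[OF tendsto_ident_at]) auto
  with nz have "\<forall>\<^sub>F e in at_right 0. (\<exists>x\<in>{a - e<..<a}. nderiv {0..1} 1 m x \<noteq> 0) \<and> e < t - (1 - a)"
    by (rule eventually_conj)
  then obtain e x where e: "e < t - (1 - a)" "x \<in> {a - e<..<a}" "nderiv {0..1} 1 m x \<noteq> 0"
    using eventually_happens'[OF trivial_limit_at_right_real[of 0]] by blast
  have "nderiv {0..1} 1 m x = 0"
  proof (rule nderiv_zero_of_constant[where p = "1 - t" and q = a and C = "m a"])
    show "x \<in> {1 - t<..<a}" "{1 - t<..<a} \<subseteq> {0..1}" using e(1,2) assms(2-4) by auto
    show "m z = m a" if "z \<in> {1 - t<..<a}" for z
      by (rule const') (use that in simp)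
  qed
  then show False using e(3) by simp
qed

lemma segment_flat:
  assumes "segment_of_local_max m a b" "t \<in> {a..b}" shows "m t = m a"
  using assms by (auto simp: segment_of_local_max_def constant_on_def)

text \<open>Beyond an end of type I the potential rises and drives w to 0; beyond one of type D it
  falls and drives g to 0.\<close>

lemma segment_right_end:
  assumes seg: "segment_of_local_max m a b" and "b < 1"
  shows "right_I m b \<Longrightarrow> right_end m b Dirichlet" "right_D m b \<Longrightarrow> right_end m b Neumann"
proof -
  have b: "0 \<le> b" using seg by (auto simp: segment_of_local_max_def)
  have nz: "\<forall>\<^sub>F e in at_right 0. \<exists>x\<in>{b<..<b + e}. nderiv {0..1} 1 m x \<noteq> 0"
    using seg \<open>b < 1\<close> by (simp add: segment_of_local_max_def)
  note nc = not_constant_right[OF nz b]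
  show "right_end m b Dirichlet" if "right_I m b"
    using that rises_rightI[OF \<open>b < 1\<close> b _ _ nc] by (auto simp: right_I_def right_end_def)
  show "right_end m b Neumann" if side: "right_D m b"
  proof -
    obtain e where "e > 0" "antimono_on ({b..b + e} \<inter> {0..1}) m" using side unfolding right_D_def by blast
    then have "rises_right (\<lambda>t. - m t) b"
      using nc by (intro rises_rightI[OF \<open>b < 1\<close> b \<open>e > 0\<close>]) (auto simp: monotone_on_def)
    then show ?thesis by (simp add: right_end_def)
  qed
qed

text \<open>On the left the roles are exchanged: type I means that m falls when moving away from the
  segment, so the reflected potential falls beyond 1 - a.\<close>

lemma segment_left_end:
  assumes seg: "segment_of_local_max m a b" and "0 < a"
  shows "left_I m a \<Longrightarrow> right_end (\<lambda>x. m (1 - x)) (1 - a) Neumann"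
    "left_D m a \<Longrightarrow> right_end (\<lambda>x. m (1 - x)) (1 - a) Dirichlet"
proof -
  have a: "1 - a < 1" "0 \<le> 1 - a" "a \<le> 1" using seg \<open>0 < a\<close> by (auto simp: segment_of_local_max_def)
  have nz: "\<forall>\<^sub>F e in at_right 0. \<exists>x\<in>{a - e<..<a}. nderiv {0..1} 1 m x \<noteq> 0"
    using seg \<open>0 < a\<close> by (simp add: segment_of_local_max_def)
  note nc = not_constant_left[OF nz _ _ a(3)]
  have mem: "1 - x \<in> {a - e..a} \<inter> {0..1}" if "x \<in> {1 - a..1 - a + e} \<inter> {0..1}" for x e :: real
    using that by auto
  show "right_end (\<lambda>x. m (1 - x)) (1 - a) Neumann" if side: "left_I m a"
  proof -
    obtain e where e: "e > 0" "mono_on ({a - e..a} \<inter> {0..1}) m" using side unfolding left_I_def by blast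
    have "mono_on ({1 - a..1 - a + e} \<inter> {0..1}) (\<lambda>x. - m (1 - x))"
    proof (rule mono_onI)
      fix x y :: real assume "x \<in> {1 - a..1 - a + e} \<inter> {0..1}" "y \<in> {1 - a..1 - a + e} \<inter> {0..1}" "x \<le> y"
      then show "- m (1 - x) \<le> - m (1 - y)" using mono_onD[OF e(2) mem mem] by simp
    qed
    then have "rises_right (\<lambda>x. - m (1 - x)) (1 - a)"
      using nc by (intro rises_rightI[OF a(1,2) e(1)]) auto
    then show ?thesis by (simp add: right_end_def)
  qed
  show "right_end (\<lambda>x. m (1 - x)) (1 - a) Dirichlet" if side: "left_D m a"
  proof -
    obtain e where e: "e > 0" "antimono_on ({a - e..a} \<inter> {0..1}) m" using side unfolding left_D_def by blast
    have "mono_on ({1 - a..1 - a + e} \<inter> {0..1}) (\<lambda>x. m (1 - x))"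
    proof (rule mono_onI)
      fix x y :: real assume "x \<in> {1 - a..1 - a + e} \<inter> {0..1}" "y \<in> {1 - a..1 - a + e} \<inter> {0..1}" "x \<le> y"
      then show "m (1 - x) \<le> m (1 - y)" using monotone_onD[OF e(2) mem mem] by simp
    qed
    then have "rises_right (\<lambda>x. m (1 - x)) (1 - a)"
      using nc by (intro rises_rightI[OF a(1,2) e(1)]) auto
    then show ?thesis by (simp add: right_end_def)
  qed
qed

section \<open>Conclusions for segments and peaks\<close>

context neumann_limit_measure
begin

text \<open>\<open>wt\<close> agrees with the w of the locale on [0,1], where all convergence takes
  place. On the segment its derivative is g, so C1 convergence is uniform convergence of the
  pair.\<close>

lemma segment_conclusion:
  assumes wt: "\<And>n x. x \<in> {0..1} \<Longrightarrow> wt (t n) x = w (t n) x"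
    and seg: "segment_of_local_max m a b"
    and ends: "right_end (\<lambda>x. m (1 - x)) (1 - a) i" "right_end m b j"
    and F: "closed F" "F \<noteq> {}" and O: "{0..1} - F \<subseteq> {a..b}" "{a..b} \<inter> F \<subseteq> {a, b}"
    and mass: "measure \<mu> ({0..1} - F) > 0"
  shows "(lam \<longlongrightarrow> lambda1 i j c a b) at_top \<and> converges_to_eigenfunction c wt t i j a b"
proof -
  have ab: "0 \<le> a" "a < b" "b \<le> 1" using seg by (auto simp: segment_of_local_max_def)
  have sub: "{a..b} \<subseteq> {0..1}" using ab by auto
  have flat: "\<And>t. t \<in> {a..b} \<Longrightarrow> m t = m a" by (rule segment_flat[OF seg])
  have cc: "continuous_on {a..b} c" by (rule continuous_on_subset[OF c_cont sub])
  obtain L U V where UV: "solves c L a b U V" and pos: "\<forall>x\<in>{a<..<b}. U x > 0"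
    and bcs: "bc i (U a) (V a)" "bc j (U b) (V b)" and lam: "(lam \<longlongrightarrow> L) at_top"
    and U: "uniform_limit {a..b} (\<lambda>n. w (t n)) U sequentially"
    and V: "uniform_limit {a..b} (\<lambda>n. g (t n)) V sequentially"
    using segment_convergence[OF ab flat ends F O mass] by blast
  note L = lambda1_eq[OF ab(2) cc UV pos bcs]
  have "nderiv {a..b} 1 (wt (t n)) x = g (t n) x" if x: "x \<in> {a..b}" for n x
  proof (rule nderiv_1_eq[OF ab(2) x])
    show "(wt (t n) has_real_derivative g (t n) x) (at x within {a..b})"
      by (rule has_field_derivative_transform_within[OF
            solvesD(1)[OF segment_solves[OF t_pos ab flat] x] zero_less_one x])
        (use wt sub in auto)
  qed
  moreover have "nderiv {a..b} 1 U x = V x" if x: "x \<in> {a..b}" for x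
    by (rule nderiv_1_eq[OF ab(2) x solvesD(1)[OF UV x]])
  ultimately have "uniform_limit {a..b} (\<lambda>n. nderiv {a..b} 1 (wt (t n))) (nderiv {a..b} 1 U) sequentially"
    by (intro uniform_limit_transfer[OF V]) auto
  moreover have "uniform_limit {a..b} (\<lambda>n. wt (t n)) U sequentially"
    by (rule uniform_limit_transfer[OF U]) (use wt sub in auto)
  ultimately have "C1_tendsto (\<lambda>n. wt (t n)) U a b" by (simp add: C1_tendsto_def)
  then show ?thesis
    unfolding converges_to_eigenfunction_def using L lam by blast
qed

lemma open_segment_conclusion:
  assumes wt: "\<And>n x. x \<in> {0..1} \<Longrightarrow> wt (t n) x = w (t n) x"
    and seg: "segment_of_local_max m a b" "0 < a" "b < 1"
    and ends: "right_end (\<lambda>x. m (1 - x)) (1 - a) i" "right_end m b j"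
    and mass: "measure \<mu> {a<..<b} > 0"
  shows "(lam \<longlongrightarrow> lambda1 i j c a b) at_top \<and> converges_to_eigenfunction c wt t i j a b"
proof (rule segment_conclusion[OF wt seg(1) ends, where F = "- {a<..<b}"])
  have "{0..1} - - {a<..<b} = {a<..<b}" using seg(2,3) by auto
  then show "0 < measure \<mu> ({0..1} - - {a<..<b})" using mass by simp
  show "closed (- {a<..<b})" by (intro closed_Compl) simp
  show "- {a<..<b} \<noteq> {}" by (auto intro: exI[of _ a])
qed auto

lemma left_segment_conclusion:
  assumes wt: "\<And>n x. x \<in> {0..1} \<Longrightarrow> wt (t n) x = w (t n) x"
    and seg: "segment_of_local_max m 0 b" "b < 1" and ends: "right_end m b j"
    and mass: "measure \<mu> {0..<b} > 0"
  shows "(lam \<longlongrightarrow> lambda1 Neumann j c 0 b) at_top \<and> converges_to_eigenfunction c wt t Neumann j 0 b"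
proof (rule segment_conclusion[OF wt seg(1) _ ends, where F = "{b..}"])
  have "{0..1} - {b..} = {0..<b}" using seg(2) by auto
  then show "0 < measure \<mu> ({0..1} - {b..})" using mass by simp
qed (auto simp: right_end_def)

lemma right_segment_conclusion:
  assumes wt: "\<And>n x. x \<in> {0..1} \<Longrightarrow> wt (t n) x = w (t n) x"
    and seg: "segment_of_local_max m a 1" "0 < a" and ends: "right_end (\<lambda>x. m (1 - x)) (1 - a) i"
    and mass: "measure \<mu> {a<..1} > 0"
  shows "(lam \<longlongrightarrow> lambda1 i Neumann c a 1) at_top \<and> converges_to_eigenfunction c wt t i Neumann a 1"
proof (rule segment_conclusion[OF wt seg(1) ends, where F = "{..a}"])
  have "{0..1} - {..a} = {a<..1}" using seg(2) by auto
  then show "0 < measure \<mu> ({0..1} - {..a})" using mass by simp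
qed (auto simp: right_end_def)

end

text \<open>The limit W is explicit and the amplitude converges along the whole sequence, so the
  identity serves as the subsequence.\<close>

lemma (in peak_profile) profile_conclusion:
  assumes wt: "\<And>n x. x \<in> {0..1} \<Longrightarrow> wt (t n) x = w (t n) x"
    and A: "A = nderiv {0..1} k m x0" and R: "R \<subseteq> S" "negligible (S - R)"
  shows "converges_to_profile m wt \<mu> t x0 k R"
  unfolding converges_to_profile_def
proof (intro exI[of _ "\<lambda>n::nat. n"] exI[of _ W] conjI allI impI)
  show "strict_mono (\<lambda>n :: nat. n)" by (simp add: strict_mono_def)
  show "positive_profile (nderiv {0..1} k m x0) k R W" using W_positive_profile[OF R] A by simp
  fix X :: "real set" assume X: "compact X \<and> X \<subseteq> R"
  then have "bounded X" by (intro compact_imp_bounded) simp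
  then obtain B where "\<forall>y\<in>X. \<bar>y\<bar> \<le> B" unfolding bounded_iff real_norm_def by blast
  then have sub: "X \<subseteq> {y\<in>S. \<bar>y\<bar> \<le> \<bar>B\<bar>}" using X R by force
  have "\<forall>\<^sub>F n in sequentially. \<forall>y\<in>S. \<bar>y\<bar> \<le> \<bar>B\<bar> \<longrightarrow> x0 + eps (t n) * y \<in> {0..1}"
    using eventually_inside t_lim by (rule eventually_compose_filterlim)
  then have "\<forall>\<^sub>F n in sequentially. \<forall>y\<in>X. rescaled wt \<mu> x0 k (t n) y = rescaled w \<mu> x0 k (t n) y"
  proof eventually_elim
    case (elim n)
    then show ?case using sub wt by (auto simp: rescaled_def eps_def)
  qed
  then show "uniform_limit X (\<lambda>n. rescaled wt \<mu> x0 k (t n)) W sequentially"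
    by (rule uniform_limit_transfer[OF uniform_limit_on_subset[OF profile_limit[OF abs_ge_zero] sub]]) auto
qed

text \<open>Supplies the flux form of the equation, positivity up to the boundary, and K = 2 C,
  where C bounds both |c| and |lam|.\<close>

lemma neumann_family_of_eigenfunctions:
  fixes m c lam :: "real \<Rightarrow> real" and \<phi> :: "real \<Rightarrow> real \<Rightarrow> real"
  assumes m_C2: "Ck_on 2 {0..1} m" and c: "continuous_on {0..1} c"
    and signs: "finitely_many_sign_changes (nderiv {0..1} 1 m)"
    and eig: "\<And>s. s > 0 \<Longrightarrow> eigenfunction Neumann Neumann 0 1 (drift m s) c (lam s) (\<phi> s)"
    and pos: "\<And>s x. s > 0 \<Longrightarrow> x \<in> {0<..<1} \<Longrightarrow> \<phi> s x > 0"
    and norm: "\<And>s. s > 0 \<Longrightarrow> ((\<lambda>x. (exp (s * m x) * \<phi> s x)\<^sup>2) has_integral 1) {0..1}"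
  shows "\<exists>K. neumann_family m c lam \<phi> (\<lambda>s x. exp (2 * s * m x) * nderiv {0..1} 1 (\<phi> s) x) K"
proof -
  define Q where "Q s x = exp (2 * s * m x) * nderiv {0..1} 1 (\<phi> s) x" for s x
  note mc = Ck_on_2_continuous[OF m_C2]
  have dm: "(m has_real_derivative nderiv {0..1} 1 m x) (at x within {0..1})" if "x \<in> {0..1}" for x
    by (rule Ck_on_2D(1)[OF m_C2 that])
  have cd: "continuous_on {0..1} (drift m s)" for s
    unfolding drift_def[abs_def] by (intro continuous_intros mc)
  have d\<phi>: "(\<phi> s has_real_derivative exp (- (2 * s * m x)) * Q s x) (at x within {0..1})"
    if "s > 0" "x \<in> {0..1}" for s x
    using eigenfunctionD(1)[OF eig[OF that(1)] zero_less_one cd c that(2)]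
    by (simp add: Q_def exp_minus mult.assoc[symmetric])
  have dQ: "(Q s has_real_derivative (c x - lam s) * exp (2 * s * m x) * \<phi> s x) (at x within {0..1})"
    if "s > 0" "x \<in> {0..1}" for s x
  proof -
    note d2 = eigenfunctionD(2)[OF eig[OF that(1)] zero_less_one cd c that(2)]
    have "((\<lambda>x. exp (2 * s * m x)) has_real_derivative exp (2 * s * m x) * (2 * s * nderiv {0..1} 1 m x))
        (at x within {0..1})"
      by (rule derivative_eq_intros refl dm[OF that(2)])+ (simp del: nderiv.simps)
    from DERIV_mult[OF this d2]
    show ?thesis by (simp add: Q_def[abs_def] drift_def algebra_simps del: nderiv.simps)
  qed
  have cont\<phi>: "continuous_on {0..1} (\<phi> s)" if "s > 0" for s
    by (rule DERIV_continuous_on) (rule d\<phi>[OF that])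
  have bd: "Q s 0 = 0" "Q s 1 = 0" if "s > 0" for s
    using eig[OF that] by (auto simp: eigenfunction_def Q_def simp del: nderiv.simps)
  have nonneg: "\<phi> s x \<ge> 0" if "s > 0" "x \<in> {0..1}" for s x
  proof (rule continuous_ge_on_closure[where S = "{0<..<1}" and f = "\<phi> s"])
    show "continuous_on (closure {0<..<1}) (\<phi> s)" "x \<in> closure {0<..<1}"
      using cont\<phi>[OF that(1)] that(2) by simp_all
  qed (rule less_imp_le, rule pos[OF that(1)])
  obtain C where C: "C \<ge> 1" "\<And>x. x \<in> {0..1} \<Longrightarrow> \<bar>c x\<bar> \<le> C" using coefficient_bound[OF c] by blast
  have pos': "\<phi> s x > 0" if s: "s > 0" and x: "x \<in> {0..1}" for s x
  proof (rule ccontr)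
    assume "\<not> \<phi> s x > 0"
    \<comment> \<open>A zero can only sit at an endpoint, where the Neumann condition makes Q vanish
      too; uniqueness for the system then contradicts positivity inside.\<close>
    then have zero: "\<phi> s x = 0" using nonneg[OF s x] by simp
    then have "x \<notin> {0<..<1}" using pos[OF s, of x] by auto
    then have "x = 0 \<or> x = 1" using x by auto
    then have Qz: "Q s x = 0" using bd[OF s] by auto
    have cont: "continuous_on {0..1} (\<lambda>t. exp (- (2 * s * m t)))"
      "continuous_on {0..1} (\<lambda>t. (c t - lam s) * exp (2 * s * m t))"
      by (intro continuous_intros mc c)+
    obtain K1 where K1: "\<And>t. t \<in> {0..1} \<Longrightarrow> \<bar>exp (- (2 * s * m t))\<bar> \<le> K1"
      using coefficient_bound[OF cont(1)] by blast
    obtain K2 where K2: "\<And>t. t \<in> {0..1} \<Longrightarrow> \<bar>(c t - lam s) * exp (2 * s * m t)\<bar> \<le> K2"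
      using coefficient_bound[OF cont(2)] by blast
    have "\<phi> s (1 / 2) = 0 \<and> Q s (1 / 2) = 0"
    proof (rule linear_system_unique[OF d\<phi>[OF s] dQ[OF s] _ _ x zero Qz])
      show "\<bar>exp (- (2 * s * m t))\<bar> \<le> max K1 K2" "\<bar>(c t - lam s) * exp (2 * s * m t)\<bar> \<le> max K1 K2"
        if "t \<in> {0..1}" for t
        using K1[OF that] K2[OF that] by (auto simp: le_max_iff_disj)
    qed auto
    then show False using pos[OF s, of "1 / 2"] by simp
  qed
  have lam_le: "lam s \<le> C" if s: "s > 0" for s
  proof (rule ccontr)
    assume "\<not> lam s \<le> C"
    \<comment> \<open>If lam exceeded every value of c, the flux would be strictly monotone, yet it
      vanishes at both ends.\<close>
    have "- Q s 0 < - Q s 1"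
    proof (rule derivative_pos_imp_less[OF zero_less_one DERIV_minus[OF dQ[OF s]]])
      fix x :: real assume "x \<in> {0<..<1}"
      then have x: "x \<in> {0..1}" by auto
      have "c x - lam s < 0" using C(2)[OF x] \<open>\<not> lam s \<le> C\<close> by linarith
      then show "0 < - ((c x - lam s) * exp (2 * s * m x) * \<phi> s x)"
        using pos'[OF s x] by (simp add: mult_neg_pos)
    qed
    then show False using bd[OF s] by simp
  qed
  have lam_ge: "- C \<le> lam s" if s: "s > 0" for s
  proof (rule ccontr)
    assume "\<not> - C \<le> lam s"
    have "Q s 0 < Q s 1"
    proof (rule derivative_pos_imp_less[OF zero_less_one dQ[OF s]])
      fix x :: real assume "x \<in> {0<..<1}"
      then have x: "x \<in> {0..1}" by auto
      have "c x - lam s > 0" using C(2)[OF x] \<open>\<not> - C \<le> lam s\<close> by linarith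
      then show "0 < (c x - lam s) * exp (2 * s * m x) * \<phi> s x"
        using pos'[OF s x] by simp
    qed
    then show False using bd[OF s] by simp
  qed
  obtain P where P: "finite P" "(\<Union>(a, b)\<in>P. {a..b}) = {0..1}"
    "\<forall>(a, b)\<in>P. (\<forall>x\<in>{a..b}. nderiv {0..1} 1 m x \<ge> 0) \<or> (\<forall>x\<in>{a..b}. nderiv {0..1} 1 m x \<le> 0)"
    using signs unfolding finitely_many_sign_changes_def by blast
  have "mono_on {a..b} m \<or> mono_on {a..b} (\<lambda>x. - m x)" if ab: "(a, b) \<in> P" for a b
  proof -
    have "(\<lambda>(a, b). {a..b}) (a, b) \<subseteq> {0..1}" unfolding P(2)[symmetric] by (rule UN_upper[OF ab])
    then have sub: "{a..b} \<subseteq> {0..1}" by (simp only: prod.case)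
    have d: "(m has_real_derivative nderiv {0..1} 1 m t) (at t within {x..y})"
      if "a \<le> x" "y \<le> b" "t \<in> {x..y}" for x y t
      by (rule has_field_derivative_subset[OF dm]) (use that sub in auto)
    consider "\<forall>x\<in>{a..b}. nderiv {0..1} 1 m x \<ge> 0" | "\<forall>x\<in>{a..b}. nderiv {0..1} 1 m x \<le> 0"
      using P(3) ab by blast
    then show ?thesis
    proof cases
      case 1
      have "m x \<le> m y" if "x \<in> {a..b}" "y \<in> {a..b}" "x \<le> y" for x y
        by (rule derivative_nonneg_imp_le[OF that(3) d]) (use 1 that in auto)
      then show ?thesis by (auto intro: mono_onI)
    next
      case 2
      have "- m x \<le> - m y" if "x \<in> {a..b}" "y \<in> {a..b}" "x \<le> y" for x y
        by (rule derivative_nonneg_imp_le[OF that(3) DERIV_minus[OF d]]) (use 2 that in auto)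
      then show ?thesis by (auto intro: mono_onI)
    qed
  qed
  then have pieces: "\<exists>P. finite P \<and> (\<Union>(a, b)\<in>P. {a..b}) = {0..1} \<and>
      (\<forall>(a, b)\<in>P. mono_on {a..b} m \<or> mono_on {a..b} (\<lambda>x. - m x))"
    using P(1,2) by blast
  have "neumann_family m c lam \<phi> Q (2 * C)"
  proof
    show "\<bar>c x - lam s\<bar> \<le> 2 * C" if "s > 0" "x \<in> {0..1}" for s x
      using C(2)[OF that(2)] lam_le[OF that(1)] lam_ge[OF that(1)] by linarith
  qed (use mc c C(1) pos' d\<phi> dQ bd norm pieces in auto)
  then show ?thesis unfolding Q_def[abs_def] by blast
qed

theorem theorem1p4:
  fixes m c :: "real \<Rightarrow> real"
    and \<phi> w :: "real \<Rightarrow> real \<Rightarrow> real"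
    and s :: "nat \<Rightarrow> real"
    and \<mu> :: "real measure"
  assumes m_C2: "Ck_on 2 {0..1} m"
    and c_cont: "continuous_on {0..1} c"
    and m_nonconst: "\<not> m constant_on {0..1}"
    and m_signs: "finitely_many_sign_changes (nderiv {0..1} 1 m)"
    and \<phi>_eigen: "\<And>t. t > 0 \<Longrightarrow>
          eigenfunction Neumann Neumann 0 1 (drift m t) c (lambdaN m c t) (\<phi> t)"
    and \<phi>_pos: "\<And>t x. t > 0 \<Longrightarrow> x \<in> {0<..<1} \<Longrightarrow> \<phi> t x > 0"
    and w_def: "\<And>t x. t > 0 \<Longrightarrow> x \<in> {0..1} \<Longrightarrow> w t x = exp (t * m x) * \<phi> t x"
    and w_norm: "\<And>t. t > 0 \<Longrightarrow> ((\<lambda>x. (w t x) ^ 2) has_integral 1) {0..1}"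
    and s_pos: "\<And>j. s j > 0"
    and s_lim: "filterlim s at_top sequentially"
    and \<mu>_prob: "prob_space \<mu>"
    and \<mu>_sets: "sets \<mu> = sets (restrict_space borel {0..1})"
    and \<mu>_lim: "\<And>\<zeta> :: real \<Rightarrow> real. continuous_on {0..1} \<zeta> \<Longrightarrow>
          (\<lambda>j. integral {0..1} (\<lambda>x. (w (s j) x) ^ 2 * \<zeta> x)) \<longlonglongrightarrow> (\<integral>x. \<zeta> x \<partial>\<mu>)"
  shows
    "(\<forall>x0\<in>M1 m. \<forall>k\<ge>2.
        differentiable_times_at k {0..1} m x0 \<and>
        (\<forall>i\<in>{1..k - 1}. nderiv {0..1} i m x0 = 0) \<and> nderiv {0..1} k m x0 \<noteq> 0 \<and>
        measure \<mu> {x0} > 0 \<longrightarrow>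
        (lambdaN m c \<longlongrightarrow> c x0) at_top \<and>
        (x0 \<in> {0<..<1} \<longrightarrow> converges_to_profile m w \<mu> s x0 k UNIV) \<and>
        (x0 = 0 \<longrightarrow> converges_to_profile m w \<mu> s x0 k {0<..}) \<and>
        (x0 = 1 \<longrightarrow> converges_to_profile m w \<mu> s x0 k {..<0})) \<and>
     (\<forall>(a, b)\<in>M2 m. measure \<mu> {a<..<b} > 0 \<longrightarrow>
        (lambdaN m c \<longlongrightarrow> lambda1 Neumann Dirichlet c a b) at_top \<and>
        converges_to_eigenfunction c w s Neumann Dirichlet a b) \<and>
     (\<forall>(a, b)\<in>M3 m. measure \<mu> {a<..<b} > 0 \<longrightarrow>
        (lambdaN m c \<longlongrightarrow> lambda1 Neumann Neumann c a b) at_top \<and>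
        converges_to_eigenfunction c w s Neumann Neumann a b) \<and>
     (\<forall>(a, b)\<in>M4 m. measure \<mu> {a<..<b} > 0 \<longrightarrow>
        (lambdaN m c \<longlongrightarrow> lambda1 Dirichlet Dirichlet c a b) at_top \<and>
        converges_to_eigenfunction c w s Dirichlet Dirichlet a b) \<and>
     (\<forall>(a, b)\<in>M5 m. measure \<mu> {a<..<b} > 0 \<longrightarrow>
        (lambdaN m c \<longlongrightarrow> lambda1 Dirichlet Neumann c a b) at_top \<and>
        converges_to_eigenfunction c w s Dirichlet Neumann a b) \<and>
     (\<forall>(a, b)\<in>M6 m. measure \<mu> {a..<b} > 0 \<longrightarrow>
        (lambdaN m c \<longlongrightarrow> lambda1 Neumann Dirichlet c a b) at_top \<and>
        converges_to_eigenfunction c w s Neumann Dirichlet a b) \<and>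
     (\<forall>(a, b)\<in>M7 m. measure \<mu> {a..<b} > 0 \<longrightarrow>
        (lambdaN m c \<longlongrightarrow> lambda1 Neumann Neumann c a b) at_top \<and>
        converges_to_eigenfunction c w s Neumann Neumann a b) \<and>
     (\<forall>(a, b)\<in>M8 m. measure \<mu> {a<..b} > 0 \<longrightarrow>
        (lambdaN m c \<longlongrightarrow> lambda1 Neumann Neumann c a b) at_top \<and>
        converges_to_eigenfunction c w s Neumann Neumann a b) \<and>
     (\<forall>(a, b)\<in>M9 m. measure \<mu> {a<..b} > 0 \<longrightarrow>
        (lambdaN m c \<longlongrightarrow> lambda1 Dirichlet Neumann c a b) at_top \<and>
        converges_to_eigenfunction c w s Dirichlet Neumann a b)"
proof -
  define Q where "Q = (\<lambda>s x. exp (2 * s * m x) * nderiv {0..1} 1 (\<phi> s) x)"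
  have norm: "((\<lambda>x. (exp (t * m x) * \<phi> t x)\<^sup>2) has_integral 1) {0..1}" if "t > 0" for t
    by (rule has_integral_eq[OF _ w_norm[OF that]]) (simp add: w_def[OF that])
  obtain K where "neumann_family m c (lambdaN m c) \<phi> Q K"
    using neumann_family_of_eigenfunctions[OF m_C2 c_cont m_signs \<phi>_eigen \<phi>_pos norm]
    unfolding Q_def by blast
  then interpret fam: neumann_family m c "lambdaN m c" \<phi> Q K .
  have wt: "w (s n) x = fam.w (s n) x" if "x \<in> {0..1}" for n x
    using w_def[OF s_pos that] by (simp add: fam.w_def)
  interpret lim: neumann_limit_measure m c "lambdaN m c" \<phi> Q K s \<mu>
  proof (intro neumann_limit_measure.intro neumann_limit_measure_axioms.intro fam.neumann_family_axioms)
    fix \<zeta> :: "real \<Rightarrow> real" assume "continuous_on {0..1} \<zeta>"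
    then have "(\<lambda>n. integral {0..1} (\<lambda>x. (w (s n) x)\<^sup>2 * \<zeta> x)) \<longlonglongrightarrow> (\<integral>x. \<zeta> x \<partial>\<mu>)" by (rule \<mu>_lim)
    moreover have "integral {0..1} (\<lambda>x. (w (s n) x)\<^sup>2 * \<zeta> x) = integral {0..1} (\<lambda>x. (fam.w (s n) x)\<^sup>2 * \<zeta> x)" for n
      by (rule integral_cong) (simp add: wt)
    ultimately show "(\<lambda>n. integral {0..1} (\<lambda>x. (fam.w (s n) x)\<^sup>2 * \<zeta> x)) \<longlonglongrightarrow> (\<integral>x. \<zeta> x \<partial>\<mu>)"
      by simp
  qed (fact s_pos s_lim \<mu>_prob \<mu>_sets)+
  have peak: "\<forall>x0\<in>M1 m. \<forall>k\<ge>2.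
        differentiable_times_at k {0..1} m x0 \<and>
        (\<forall>i\<in>{1..k - 1}. nderiv {0..1} i m x0 = 0) \<and> nderiv {0..1} k m x0 \<noteq> 0 \<and>
        measure \<mu> {x0} > 0 \<longrightarrow>
        (lambdaN m c \<longlongrightarrow> c x0) at_top \<and>
        (x0 \<in> {0<..<1} \<longrightarrow> converges_to_profile m w \<mu> s x0 k UNIV) \<and>
        (x0 = 0 \<longrightarrow> converges_to_profile m w \<mu> s x0 k {0<..}) \<and>
        (x0 = 1 \<longrightarrow> converges_to_profile m w \<mu> s x0 k {..<0})"
  proof (intro ballI allI impI; elim conjE)
    fix x0 k
    assume x0: "x0 \<in> M1 m" and k: "2 \<le> k" and d: "differentiable_times_at k {0..1} m x0"
      and z: "\<forall>i\<in>{1..k - 1}. nderiv {0..1} i m x0 = 0" and A: "nderiv {0..1} k m x0 \<noteq> 0"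
      and mass: "measure \<mu> {x0} > 0"
    have x01: "x0 \<in> {0..1}" using x0 by (auto simp: M1_def)
    interpret pk: peak_profile m c "lambdaN m c" \<phi> Q K s \<mu> x0 "nderiv {0..1} k m x0" k
    proof
      show "((\<lambda>x. (m x - m x0) / (x - x0) ^ k) \<longlongrightarrow> nderiv {0..1} k m x0 / fact k) (at x0 within {0..1})"
        by (rule Peano_remainder[OF refl zero_less_one x01 d _ z]) (use k in simp)
    qed (use x0 mass k A in auto)
    \<comment> \<open>The profile is asserted on open half-lines while \<open>pk.S\<close> is
      closed: at most the point 0 is lost.\<close>
    have "negligible (pk.S - R)" if "pk.S - R \<subseteq> {0}" for R
      by (rule negligible_subset[OF _ that]) simp
    then have profile: "converges_to_profile m w \<mu> s x0 k R" if "R \<subseteq> pk.S" "pk.S - R \<subseteq> {0}" for R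
      using pk.profile_conclusion[OF wt refl that(1)] that(2) by simp
    have "x0 \<in> {0<..<1} \<Longrightarrow> pk.S = UNIV" "x0 = 0 \<Longrightarrow> pk.S = {0..}" "x0 = 1 \<Longrightarrow> pk.S = {..0}"
      unfolding pk.S_def by auto
    then have "x0 \<in> {0<..<1} \<Longrightarrow> converges_to_profile m w \<mu> s x0 k UNIV"
      "x0 = 0 \<Longrightarrow> converges_to_profile m w \<mu> s x0 k {0<..}"
      "x0 = 1 \<Longrightarrow> converges_to_profile m w \<mu> s x0 k {..<0}"
      by (intro profile; force)+
    then show "(lambdaN m c \<longlongrightarrow> c x0) at_top \<and>
        (x0 \<in> {0<..<1} \<longrightarrow> converges_to_profile m w \<mu> s x0 k UNIV) \<and>
        (x0 = 0 \<longrightarrow> converges_to_profile m w \<mu> s x0 k {0<..}) \<and>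
        (x0 = 1 \<longrightarrow> converges_to_profile m w \<mu> s x0 k {..<0})"
      using lim.lam_limit_peak[OF x0 mass] by blast
  qed
  have M2: "\<forall>(a, b)\<in>M2 m. measure \<mu> {a<..<b} > 0 \<longrightarrow>
        (lambdaN m c \<longlongrightarrow> lambda1 Neumann Dirichlet c a b) at_top \<and>
        converges_to_eigenfunction c w s Neumann Dirichlet a b"
  proof (clarify)
    fix a b assume ab: "(a, b) \<in> M2 m" and mass: "measure \<mu> {a<..<b} > 0"
    have seg: "segment_of_local_max m a b" "0 < a" "b < 1" "left_I m a" "right_I m b" using ab by (auto simp: M2_def)
    show "(lambdaN m c \<longlongrightarrow> lambda1 Neumann Dirichlet c a b) at_top \<and>
        converges_to_eigenfunction c w s Neumann Dirichlet a b"
      by (rule lim.open_segment_conclusion[OF wt seg(1-3) segment_left_end(1)[OF seg(1,2,4)]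
            segment_right_end(1)[OF seg(1,3,5)] mass])
  qed
  have M3: "\<forall>(a, b)\<in>M3 m. measure \<mu> {a<..<b} > 0 \<longrightarrow>
        (lambdaN m c \<longlongrightarrow> lambda1 Neumann Neumann c a b) at_top \<and>
        converges_to_eigenfunction c w s Neumann Neumann a b"
  proof (clarify)
    fix a b assume ab: "(a, b) \<in> M3 m" and mass: "measure \<mu> {a<..<b} > 0"
    have seg: "segment_of_local_max m a b" "0 < a" "b < 1" "left_I m a" "right_D m b" using ab by (auto simp: M3_def)
    show "(lambdaN m c \<longlongrightarrow> lambda1 Neumann Neumann c a b) at_top \<and>
        converges_to_eigenfunction c w s Neumann Neumann a b"
      by (rule lim.open_segment_conclusion[OF wt seg(1-3) segment_left_end(1)[OF seg(1,2,4)]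
            segment_right_end(2)[OF seg(1,3,5)] mass])
  qed
  have M4: "\<forall>(a, b)\<in>M4 m. measure \<mu> {a<..<b} > 0 \<longrightarrow>
        (lambdaN m c \<longlongrightarrow> lambda1 Dirichlet Dirichlet c a b) at_top \<and>
        converges_to_eigenfunction c w s Dirichlet Dirichlet a b"
  proof (clarify)
    fix a b assume ab: "(a, b) \<in> M4 m" and mass: "measure \<mu> {a<..<b} > 0"
    have seg: "segment_of_local_max m a b" "0 < a" "b < 1" "left_D m a" "right_I m b" using ab by (auto simp: M4_def)
    show "(lambdaN m c \<longlongrightarrow> lambda1 Dirichlet Dirichlet c a b) at_top \<and>
        converges_to_eigenfunction c w s Dirichlet Dirichlet a b"
      by (rule lim.open_segment_conclusion[OF wt seg(1-3) segment_left_end(2)[OF seg(1,2,4)]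
            segment_right_end(1)[OF seg(1,3,5)] mass])
  qed
  have M5: "\<forall>(a, b)\<in>M5 m. measure \<mu> {a<..<b} > 0 \<longrightarrow>
        (lambdaN m c \<longlongrightarrow> lambda1 Dirichlet Neumann c a b) at_top \<and>
        converges_to_eigenfunction c w s Dirichlet Neumann a b"
  proof (clarify)
    fix a b assume ab: "(a, b) \<in> M5 m" and mass: "measure \<mu> {a<..<b} > 0"
    have seg: "segment_of_local_max m a b" "0 < a" "b < 1" "left_D m a" "right_D m b" using ab by (auto simp: M5_def)
    show "(lambdaN m c \<longlongrightarrow> lambda1 Dirichlet Neumann c a b) at_top \<and>
        converges_to_eigenfunction c w s Dirichlet Neumann a b"
      by (rule lim.open_segment_conclusion[OF wt seg(1-3) segment_left_end(2)[OF seg(1,2,4)]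
            segment_right_end(2)[OF seg(1,3,5)] mass])
  qed
  have M6: "\<forall>(a, b)\<in>M6 m. measure \<mu> {a..<b} > 0 \<longrightarrow>
        (lambdaN m c \<longlongrightarrow> lambda1 Neumann Dirichlet c a b) at_top \<and>
        converges_to_eigenfunction c w s Neumann Dirichlet a b"
  proof (clarify)
    fix a b assume ab: "(a, b) \<in> M6 m" and mass: "measure \<mu> {a..<b} > 0"
    have seg: "segment_of_local_max m 0 b" "b < 1" "right_I m b" and a: "a = 0" using ab by (auto simp: M6_def)
    show "(lambdaN m c \<longlongrightarrow> lambda1 Neumann Dirichlet c a b) at_top \<and>
        converges_to_eigenfunction c w s Neumann Dirichlet a b"
      unfolding a by (rule lim.left_segment_conclusion[OF wt seg(1,2) segment_right_end(1)[OF seg] mass[unfolded a]])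
  qed
  have M7: "\<forall>(a, b)\<in>M7 m. measure \<mu> {a..<b} > 0 \<longrightarrow>
        (lambdaN m c \<longlongrightarrow> lambda1 Neumann Neumann c a b) at_top \<and>
        converges_to_eigenfunction c w s Neumann Neumann a b"
  proof (clarify)
    fix a b assume ab: "(a, b) \<in> M7 m" and mass: "measure \<mu> {a..<b} > 0"
    have seg: "segment_of_local_max m 0 b" "b < 1" "right_D m b" and a: "a = 0" using ab by (auto simp: M7_def)
    show "(lambdaN m c \<longlongrightarrow> lambda1 Neumann Neumann c a b) at_top \<and>
        converges_to_eigenfunction c w s Neumann Neumann a b"
      unfolding a by (rule lim.left_segment_conclusion[OF wt seg(1,2) segment_right_end(2)[OF seg] mass[unfolded a]])
  qed
  have M8: "\<forall>(a, b)\<in>M8 m. measure \<mu> {a<..b} > 0 \<longrightarrow>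
        (lambdaN m c \<longlongrightarrow> lambda1 Neumann Neumann c a b) at_top \<and>
        converges_to_eigenfunction c w s Neumann Neumann a b"
  proof (clarify)
    fix a b assume ab: "(a, b) \<in> M8 m" and mass: "measure \<mu> {a<..b} > 0"
    have seg: "segment_of_local_max m a 1" "0 < a" "left_I m a" and b: "b = 1" using ab by (auto simp: M8_def)
    show "(lambdaN m c \<longlongrightarrow> lambda1 Neumann Neumann c a b) at_top \<and>
        converges_to_eigenfunction c w s Neumann Neumann a b"
      unfolding b by (rule lim.right_segment_conclusion[OF wt seg(1,2) segment_left_end(1)[OF seg] mass[unfolded b]])
  qed
  have M9: "\<forall>(a, b)\<in>M9 m. measure \<mu> {a<..b} > 0 \<longrightarrow>
        (lambdaN m c \<longlongrightarrow> lambda1 Dirichlet Neumann c a b) at_top \<and>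
        converges_to_eigenfunction c w s Dirichlet Neumann a b"
  proof (clarify)
    fix a b assume ab: "(a, b) \<in> M9 m" and mass: "measure \<mu> {a<..b} > 0"
    have seg: "segment_of_local_max m a 1" "0 < a" "left_D m a" and b: "b = 1" using ab by (auto simp: M9_def)
    show "(lambdaN m c \<longlongrightarrow> lambda1 Dirichlet Neumann c a b) at_top \<and>
        converges_to_eigenfunction c w s Dirichlet Neumann a b"
      unfolding b by (rule lim.right_segment_conclusion[OF wt seg(1,2) segment_left_end(2)[OF seg] mass[unfolded b]])
  qed
  show ?thesis
    by (intro conjI peak M2 M3 M4 M5 M6 M7 M8 M9)
qed

end
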